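(* Let $m=p+q$ with $p,q\ge1$, $\mathbb R^m=\mathbb R^p\oplus\mathbb R^q$, $x=u+v$ with $u\in\mathbb R^p$, $v\in\mathbb R^q$. For $s,k,i\in\mathbb N$, $P_k^{\pm}(u)\in\mathcal M_k^{\pm}(\mathbb R^p,\mathbb C_p)$ and $Q_i(v)\in\mathcal M_i(\mathbb R^q,\mathbb C_q)$, the $\mathrm{Spin}(p)\times\mathrm{Spin}(q)$-invariant building blocks of $\mathcal M(\mathbb R^m,\mathbb C_m)$ listed below are eigenfunctions of the three commuting operators $S_u$, $S_v$ and $\Gamma_x-\frac{m-1}2$, with the following eigenvalues (in this order): - $P_M(|u|^{2s}P_k^+(u)Q_i(v))$: $\ -(k+\frac{p-1}2),\ -(i+\frac{q-1}2),\ -(k+i+2s+\frac{m-1}2)$; - $P_M(|u|^{2s}P_k^-(u)Q_i(v))$: $\ (k+\frac{p-1}2),\ (i+\frac{q-1}2),\ -(k+i+2s+\frac{m-1}2)$; - $P_M(u|u|^{2s}P_k^+(u)Q_i(v))$: $\ -(-1)^p(k+\frac{p-1}2),\ (-1)^p(i+\frac{q-1}2),\ -(k+i+2s+1+\frac{m-1}2)$; - $P_M(u|u|^{2s}P_k^-(u)Q_i(v))$: $\ (-1)^p(k+\frac{p-1}2),\ -(-1)^p(i+\frac{q-1}2),\ -(k+i+2s+1+\frac{m-1}2)$. These eigenvalues determine the labels $(s,k,i)$ in a unique way. As a result, all summands in $$\mathcal M(\mathbb R^m,\mathbb C_m)=\bigoplus_{s,k,i\in\mathbb N,\ \pm}\tau_M\big(u^s\mathcal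 M_k^{\pm}(\mathbb R^p,\mathbb C_p)\otimes\mathcal M_i(\mathbb R^q,\mathbb C_q)\big)$$ are Fischer orthogonal.
   Context: $\mathbb N=\{0,1,2,\dots\}$. $\mathbb C_m$ is the complex Clifford algebra generated by $e_1,\dots,e_m$ with $e_ie_j+e_je_i=-2\delta_{ij}$; $\mathbb C_p$ is the subalgebra generated by $e_1,\dots,e_p$ (a basis of $\mathbb R^p$) and $\mathbb C_q$ the subalgebra generated by $e_{p+1},\dots,e_m$ (a basis of $\mathbb R^q$). Clifford elements act by left multiplication on Clifford-valued polynomials. $x=\sum_{j=1}^mx_je_j$, $u=\sum_{j\le p}x_je_j$, $v=\sum_{j>p}x_je_j$; $\partial_x=\sum_{j=1}^me_j\partial_{x_j}$, $\partial_u=\sum_{j\le p}e_j\partial_{x_j}$, $\partial_v=\sum_{j>p}e_j\partial_{x_j}$. $\mathcal P(\mathbb R^d,\mathbb C_d)$ is the space of $\mathbb C_d$-valued polynomials; $\mathcal M(\mathbb R^d,\mathbb C_d)$ is its subspace of monogenic polynomials (annihilated by the Dirac operator of $\mathbb R^d$ acting from the left) and $\mathcal M_k(\mathbb R^d,\mathbb C_d)$ the subspace of those homogeneous of degree $k$. $P_M$ is the projection of $\mathcal P(\mathbb R^m,\mathbb C_m)$ onto the $s=0$ summand of the Fischer decomposition $\mathcal P(\mathbb R^m,\mathbb C_m)=\bigoplus_{s\ge0}x^s\mathcal M(\mathbb R^m,\mathbb C_m)$, and $\tau_M$ is the linear map $\mathcal P(\mathbb R^p,\mathbb C_p)\otimes\mathcal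 M(\mathbb R^q,\mathbb C_q)\to\mathcal M(\mathbb R^m,\mathbb C_m)$ with $\tau_M(K\otimes G)=P_M(K(u)G(v))$ (product in $\mathbb C_m$). $\Gamma_x=\frac12([\partial_x,x]+m)$, $\Gamma_u=\frac12([\partial_u,u]+p)$, $\Gamma_v=\frac12([\partial_v,v]+q)$ (operator commutators). With $e_P=e_1\cdots e_p$ and $c=(-\mathrm i)^{p(p+1)/2}$ (here $\mathrm i$ is the imaginary unit; one has $(ce_P)^2=1$), $S_u=ce_P(\Gamma_u-\frac{p-1}2)$ and $S_v=ce_P(\Gamma_v-\frac{q-1}2)$. $\mathcal M_k^{\pm}(\mathbb R^p,\mathbb C_p)$ is the $\pm1$-eigenspace of left multiplication by $ce_P$ on $\mathcal M_k(\mathbb R^p,\mathbb C_p)$. $\mathrm{Spin}(d)$ (products of an even number of unit vectors) acts by $L(s)P(x)=sP(s^{-1}xs)$. The Fischer inner product of $P=\sum_AP_A(x)e_A$ and $Q$ is $\langle P,Q\rangle_m=[\bar P(\partial_x)Q(x)]_0|_{x=0}$, where $[\cdot]_0$ is the scalar part and $\bar P(\partial_x)=\sum_A\overline{P_A}(\partial_{x_1},\dots,\partial_{x_m})\bar e_A$, with $\overline{P_A}$ having complex conjugated coefficients and $\bar{\cdot}$ on $e_A$ the anti-involution with $\bar e_j=-e_j$. *)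

theory Defs
  imports Complex_Main "HOL-Library.Poly_Mapping" "HOL-Library.FSet"
begin

abbreviation lookup where "lookup \<equiv> Poly_Mapping.lookup"
abbreviation keys where "keys \<equiv> Poly_Mapping.keys"

section \<open>The complex Clifford algebra\<close>

text \<open>
  One algebra on generators indexed by all natural numbers is used; the algebras
  \<open>\<complex>\<^sub>m\<close>, \<open>\<complex>\<^sub>p\<close>, \<open>\<complex>\<^sub>q\<close> are its subalgebras \<open>Cl {1..m}\<close>, \<open>Cl {1..p}\<close>, \<open>Cl {p+1..m}\<close>
  below. An element is a finitely supported family of complex coefficients with respect to the
  basis \<open>e\<^sub>A\<close> (\<open>A\<close> a finite set of indices), where \<open>e\<^sub>A\<close> is the product of the \<open>e\<^sub>j\<close>, \<open>j \<in> A\<close>,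
  in increasing order (see \<open>blade_eq_prod_list\<close>).
\<close>

typedef clifford = "UNIV :: (nat fset \<Rightarrow>\<^sub>0 complex) set"
  morphisms coeffs Clifford by simp

setup_lifting type_definition_clifford

definition symdiff :: "nat fset \<Rightarrow> nat fset \<Rightarrow> nat fset" where
  "symdiff A B = (A |-| B) |\<union>| (B |-| A)"

text \<open>
  \<open>e\<^sub>A e\<^sub>B = blade_sign A B \<cdot> e\<^bsub>A \<triangle> B\<^esub>\<close>: one sign for each transposition of \<open>e\<^sub>i\<close> and \<open>e\<^sub>j\<close> with
  \<open>j < i\<close>, and one for each square \<open>e\<^sub>i e\<^sub>i = -1\<close>.
\<close>

definition blade_sign :: "nat fset \<Rightarrow> nat fset \<Rightarrow> complex" where
  "blade_sign A B = (\<Prod>i\<in>fset A. \<Prod>j\<in>fset B. if j \<le> i then -1 else 1)"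

definition cmul :: "(nat fset \<Rightarrow>\<^sub>0 complex) \<Rightarrow> (nat fset \<Rightarrow>\<^sub>0 complex) \<Rightarrow> (nat fset \<Rightarrow>\<^sub>0 complex)" where
  "cmul a b = (\<Sum>A\<in>keys a. \<Sum>B\<in>keys b.
     Poly_Mapping.single (symdiff A B) (blade_sign A B * lookup a A * lookup b B))"

lemma symdiff_assoc: "symdiff (symdiff A B) C = symdiff A (symdiff B C)"
  by (auto simp: symdiff_def)

lemma symdiff_empty [simp]: "symdiff {||} A = A" "symdiff A {||} = A"
  by (auto simp: symdiff_def)

lemma prod_symdiff:
  fixes f :: "nat \<Rightarrow> complex"
  assumes "\<And>x. f x * f x = 1"
  shows "(\<Prod>x\<in>fset (symdiff A B). f x) = (\<Prod>x\<in>fset A. f x) * (\<Prod>x\<in>fset B. f x)"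
proof -
  let ?A = "fset A" and ?B = "fset B"
  have A: "prod f ?A = prod f (?A - ?B) * prod f (?A \<inter> ?B)"
    by (subst prod.union_disjoint [symmetric]) (auto intro!: prod.cong)
  have B: "prod f ?B = prod f (?B - ?A) * prod f (?A \<inter> ?B)"
    by (subst prod.union_disjoint [symmetric]) (auto intro!: prod.cong)
  have S: "prod f (fset (symdiff A B)) = prod f (?A - ?B) * prod f (?B - ?A)"
    by (subst prod.union_disjoint [symmetric]) (auto simp: symdiff_def intro!: prod.cong)
  have "prod f (?A \<inter> ?B) * prod f (?A \<inter> ?B) = 1"
    by (simp add: prod.distrib [symmetric] assms)
  then show ?thesis
    unfolding S A B by (simp add: mult_ac)
qed

lemma blade_sign_symdiff_left: "blade_sign (symdiff A B) C = blade_sign A C * blade_sign B C"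
  unfolding blade_sign_def
  by (rule prod_symdiff) (auto simp: prod.distrib [symmetric] intro!: prod.neutral)

lemma blade_sign_symdiff_right: "blade_sign A (symdiff B C) = blade_sign A B * blade_sign A C"
  unfolding blade_sign_def prod.distrib [symmetric]
  by (intro prod.cong refl prod_symdiff) auto

lemma blade_sign_empty [simp]: "blade_sign {||} A = 1" "blade_sign A {||} = 1"
  by (simp_all add: blade_sign_def)

lemma cmul_superset:
  assumes "finite S" "finite T" "keys a \<subseteq> S" "keys b \<subseteq> T"
  shows "cmul a b = (\<Sum>A\<in>S. \<Sum>B\<in>T.
     Poly_Mapping.single (symdiff A B) (blade_sign A B * lookup a A * lookup b B))"
proof -
  have "cmul a b = (\<Sum>A\<in>keys a. \<Sum>B\<in>T.
     Poly_Mapping.single (symdiff A B) (blade_sign A B * lookup a A * lookup b B))"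
    unfolding cmul_def using assms
    by (intro sum.cong refl sum.mono_neutral_left) (auto simp: in_keys_iff)
  also have "\<dots> = (\<Sum>A\<in>S. \<Sum>B\<in>T.
     Poly_Mapping.single (symdiff A B) (blade_sign A B * lookup a A * lookup b B))"
    using assms by (intro sum.mono_neutral_left) (auto simp: in_keys_iff)
  finally show ?thesis .
qed

lemma cmul_add_left: "cmul (a + b) c = cmul a c + cmul b c"
proof -
  have "keys (a + b) \<subseteq> keys a \<union> keys b" by (rule keys_add)
  then show ?thesis
    using cmul_superset [of "keys a \<union> keys b" "keys c" "a + b" c]
      cmul_superset [of "keys a \<union> keys b" "keys c" a c]
      cmul_superset [of "keys a \<union> keys b" "keys c" b c]
    by (simp add: lookup_add algebra_simps single_add sum.distrib)
qed

lemma cmul_add_right: "cmul a (b + c) = cmul a b + cmul a c"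
proof -
  have "keys (b + c) \<subseteq> keys b \<union> keys c" by (rule keys_add)
  then show ?thesis
    using cmul_superset [of "keys a" "keys b \<union> keys c" a "b + c"]
      cmul_superset [of "keys a" "keys b \<union> keys c" a b]
      cmul_superset [of "keys a" "keys b \<union> keys c" a c]
    by (simp add: lookup_add algebra_simps single_add sum.distrib)
qed

lemma cmul_zero [simp]: "cmul 0 a = 0" "cmul a 0 = 0"
  by (simp_all add: cmul_def)

lemma cmul_single: "cmul (Poly_Mapping.single A a) (Poly_Mapping.single B b) =
    Poly_Mapping.single (symdiff A B) (blade_sign A B * a * b)"
  using cmul_superset [of "{A}" "{B}" "Poly_Mapping.single A a" "Poly_Mapping.single B b"] by simp

lemma blade_induct [case_names zero single add]:
  fixes f :: "'a \<Rightarrow>\<^sub>0 complex"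
  assumes "P 0" "\<And>A a. P (Poly_Mapping.single A a)" "\<And>f g. P f \<Longrightarrow> P g \<Longrightarrow> P (f + g)"
  shows "P f"
proof (induction f rule: update_induct)
  case const
  show ?case by (rule assms)
next
  case (update f a b)
  have "Poly_Mapping.update a b f = Poly_Mapping.single a b + f"
    using update by (intro poly_mapping_eqI)
      (auto simp: lookup_update lookup_add lookup_single when_def in_keys_iff)
  then show ?case using assms update by simp
qed

lemma cmul_assoc: "cmul (cmul a b) c = cmul a (cmul b c)"
proof (induction a rule: blade_induct)
  case (single A x)
  show ?case
  proof (induction b rule: blade_induct)
    case (single B y)
    show ?case
      by (induction c rule: blade_induct)
        (simp_all add: cmul_single cmul_add_right symdiff_assoc blade_sign_symdiff_left
          blade_sign_symdiff_right mult_ac)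
  qed (simp_all add: cmul_add_left cmul_add_right)
qed (simp_all add: cmul_add_left)

instantiation clifford :: ring_1
begin

lift_definition zero_clifford :: clifford is 0 .
lift_definition one_clifford :: clifford is "Poly_Mapping.single {||} 1" .
lift_definition plus_clifford :: "clifford \<Rightarrow> clifford \<Rightarrow> clifford" is "(+)" .
lift_definition minus_clifford :: "clifford \<Rightarrow> clifford \<Rightarrow> clifford" is "(-)" .
lift_definition uminus_clifford :: "clifford \<Rightarrow> clifford" is uminus .
lift_definition times_clifford :: "clifford \<Rightarrow> clifford \<Rightarrow> clifford" is cmul .

instance
proof
  fix a b c :: clifford
  show "1 * a = a"
  proof transfer
    fix a :: "nat fset \<Rightarrow>\<^sub>0 complex"
    show "cmul (Poly_Mapping.single {||} 1) a = a"
      by (induction a rule: blade_induct) (simp_all add: cmul_single cmul_add_right)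
  qed
  show "a * 1 = a"
  proof transfer
    fix a :: "nat fset \<Rightarrow>\<^sub>0 complex"
    show "cmul a (Poly_Mapping.single {||} 1) = a"
      by (induction a rule: blade_induct) (simp_all add: cmul_single cmul_add_left)
  qed
  show "(0::clifford) \<noteq> 1"
    by transfer (metis lookup_single_eq lookup_zero zero_neq_one)
qed (transfer; simp add: cmul_assoc cmul_add_left cmul_add_right algebra_simps)+

end

lift_definition blade :: "nat fset \<Rightarrow> clifford" is "\<lambda>A. Poly_Mapping.single A 1" .

lift_definition scalar :: "complex \<Rightarrow> clifford" is "\<lambda>z. Poly_Mapping.single {||} z" .

lift_definition scalar_part :: "clifford \<Rightarrow> complex" is "\<lambda>a. lookup a {||}" .

definition gen :: "nat \<Rightarrow> clifford" where
  "gen j = blade {|j|}"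

definition Cl :: "nat set \<Rightarrow> clifford set" where
  "Cl I = {a. \<forall>A\<in>keys (coeffs a). fset A \<subseteq> I}"

lemma gen_anticommute: "gen i * gen j + gen j * gen i = scalar (if i = j then -2 else 0)"
proof -
  have "symdiff {|i|} {|j|} = symdiff {|j|} {|i|}" by (auto simp: symdiff_def)
  moreover have "symdiff {|i|} {|i|} = {||}" by (auto simp: symdiff_def)
  ultimately show ?thesis
    unfolding gen_def
    by transfer (auto simp: cmul_single blade_sign_def single_add [symmetric])
qed

lemma blade_finsert:
  assumes "\<forall>j\<in>fset A. i < j"
  shows "blade (finsert i A) = gen i * blade A"
proof -
  have *: "symdiff {|i|} A = finsert i A"
    using assms by (auto simp: symdiff_def)
  have **: "blade_sign {|i|} A = 1"
    using assms by (auto simp: blade_sign_def intro!: prod.neutral)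
  show ?thesis
    using * ** unfolding gen_def by transfer (simp add: cmul_single)
qed

lemma blade_eq_prod_list: "blade A = prod_list (map gen (sorted_list_of_fset A))"
proof -
  have "blade (fset_of_list xs) = prod_list (map gen xs)" if "sorted xs" "distinct xs" for xs
    using that
  proof (induction xs)
    case Nil
    show ?case by simp (transfer, simp)
  next
    case (Cons x xs)
    then have "\<forall>j\<in>fset (fset_of_list xs). x < j"
      by (auto simp: fset_of_list.rep_eq order.strict_iff_order)
    with Cons show ?case by (simp add: blade_finsert)
  qed
  moreover have "fset_of_list (sorted_list_of_fset A) = A"
    by (rule fset_eqI) (simp add: fset_of_list_elem sorted_list_of_fset.rep_eq)
  ultimately show ?thesis
    by (metis sorted_list_of_fset.rep_eq sorted_sorted_list_of_set distinct_sorted_list_of_set)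
qed

text \<open>
  The conjugation occurring in the Fischer inner product: the conjugate-linear
  anti-automorphism with \<open>e\<^sub>j \<mapsto> -e\<^sub>j\<close>. Since \<open>e\<^sub>A e\<^sub>A = blade_sign A A\<close> and the conjugate of
  \<open>e\<^sub>A\<close> is its inverse, the blade \<open>e\<^sub>A\<close> is mapped to \<open>blade_sign A A \<cdot> e\<^sub>A\<close>; see
  \<open>cbar_gen\<close>, \<open>cbar_scalar\<close>, \<open>cbar_add\<close>, \<open>cbar_mult\<close>.
\<close>

definition cbar_coeffs :: "(nat fset \<Rightarrow>\<^sub>0 complex) \<Rightarrow> (nat fset \<Rightarrow>\<^sub>0 complex)" where
  "cbar_coeffs a =
     (\<Sum>A\<in>keys a. Poly_Mapping.single A (blade_sign A A * cnj (lookup a A)))"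

lift_definition cbar :: "clifford \<Rightarrow> clifford" is cbar_coeffs .

lemma cbar_coeffs_superset:
  assumes "finite S" "keys a \<subseteq> S"
  shows "cbar_coeffs a = (\<Sum>A\<in>S. Poly_Mapping.single A (blade_sign A A * cnj (lookup a A)))"
  unfolding cbar_coeffs_def using assms
  by (intro sum.mono_neutral_left) (auto simp: in_keys_iff)

lemma cbar_coeffs_single:
  "cbar_coeffs (Poly_Mapping.single A z) = Poly_Mapping.single A (blade_sign A A * cnj z)"
  using cbar_coeffs_superset [of "{A}" "Poly_Mapping.single A z"] by simp

lemma cbar_coeffs_add: "cbar_coeffs (a + b) = cbar_coeffs a + cbar_coeffs b"
proof -
  have "keys (a + b) \<subseteq> keys a \<union> keys b" by (rule keys_add)
  then show ?thesis
    using cbar_coeffs_superset [of "keys a \<union> keys b" "a + b"]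
      cbar_coeffs_superset [of "keys a \<union> keys b" a]
      cbar_coeffs_superset [of "keys a \<union> keys b" b]
    by (simp add: lookup_add algebra_simps single_add sum.distrib)
qed

lemma cbar_coeffs_zero: "cbar_coeffs 0 = 0"
  by (simp add: cbar_coeffs_def)

lemma cbar_add: "cbar (a + b) = cbar a + cbar b"
  by transfer (rule cbar_coeffs_add)

lemma cbar_scalar: "cbar (scalar z) = scalar (cnj z)"
  by transfer (simp add: cbar_coeffs_single)

lemma cbar_gen: "cbar (gen j) = - gen j"
  unfolding gen_def by transfer (simp add: cbar_coeffs_single blade_sign_def single_uminus)

lemma cbar_mult: "cbar (a * b) = cbar b * cbar a"
proof transfer
  fix a b :: "nat fset \<Rightarrow>\<^sub>0 complex"
  have sq: "blade_sign A B * blade_sign A B = 1" for A B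
    by (auto simp: blade_sign_def prod.distrib [symmetric] intro!: prod.neutral)
  have comm: "symdiff A B = symdiff B A" for A B
    by (auto simp: symdiff_def)
  have cnj: "cnj (blade_sign A B) = blade_sign A B" for A B
    by (simp add: blade_sign_def if_distrib cong: if_cong)
  have eq: "blade_sign (symdiff A B) (symdiff A B) * blade_sign A B =
      blade_sign B A * blade_sign A A * blade_sign B B" for A B
    using sq [of A B]
    by (simp add: blade_sign_symdiff_left blade_sign_symdiff_right)
  show "cbar_coeffs (cmul a b) = cmul (cbar_coeffs b) (cbar_coeffs a)"
  proof (induction a rule: blade_induct)
    case (single A x)
    show ?case
    proof (induction b rule: blade_induct)
      case (single B y)
      show ?case
        using arg_cong [OF eq [of A B], of "\<lambda>t. Poly_Mapping.single (symdiff A B) (t * cnj x * cnj y)"]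
        by (simp add: cmul_single cbar_coeffs_single comm [of B A] cnj mult_ac)
    qed (simp_all add: cmul_add_left cmul_add_right cbar_coeffs_add cbar_coeffs_zero)
  qed (simp_all add: cmul_add_left cmul_add_right cbar_coeffs_add cbar_coeffs_zero)
qed


section \<open>Clifford-valued polynomials\<close>

text \<open>The variables are indexed by \<open>nat\<close> and commute with the coefficients.\<close>

type_synonym cpoly = "(nat \<Rightarrow>\<^sub>0 nat) \<Rightarrow>\<^sub>0 clifford"

definition pconst :: "clifford \<Rightarrow> cpoly" where
  "pconst a = Poly_Mapping.single 0 a"

definition pvar :: "nat \<Rightarrow> cpoly" where
  "pvar j = Poly_Mapping.single (Poly_Mapping.single j 1) 1"

definition pscale :: "complex \<Rightarrow> cpoly \<Rightarrow> cpoly" where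
  "pscale z F = pconst (scalar z) * F"

lemma scalar_add: "scalar (a + b) = scalar a + scalar b"
  by transfer (simp add: single_add)

lemma scalar_mult: "scalar (a * b) = scalar a * scalar b"
  by transfer (simp add: cmul_single)

lemma scalar_one: "scalar 1 = 1"
  by transfer simp

interpretation cpoly: vector_space pscale
proof
  show "pscale a (x + y) = pscale a x + pscale a y" for a x y
    by (simp add: pscale_def distrib_left)
  show "pscale (a + b) x = pscale a x + pscale b x" for a b x
    by (simp add: pscale_def pconst_def scalar_add single_add distrib_right)
  show "pscale a (pscale b x) = pscale (a * b) x" for a b x
    by (simp add: pscale_def pconst_def scalar_mult mult_single flip: mult.assoc)
  show "pscale 1 x = x" for x
    by (simp add: pscale_def pconst_def scalar_one)
qed

text \<open>\<open>polys I\<close> is \<open>\<P>(\<real>\<^sup>d, \<complex>\<^sub>d)\<close> with coordinates and generators indexed by \<open>I\<close>, \<open>|I| = d\<close>.\<close>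

definition polys :: "nat set \<Rightarrow> cpoly set" where
  "polys I = {F. \<forall>\<alpha>\<in>keys F. keys \<alpha> \<subseteq> I \<and> lookup F \<alpha> \<in> Cl I}"

definition homogeneous :: "nat \<Rightarrow> cpoly \<Rightarrow> bool" where
  "homogeneous k F \<longleftrightarrow> (\<forall>\<alpha>\<in>keys F. (\<Sum>j\<in>keys \<alpha>. lookup \<alpha> j) = k)"

definition partial_deriv :: "nat \<Rightarrow> cpoly \<Rightarrow> cpoly" where
  "partial_deriv j F = (\<Sum>\<alpha>\<in>keys F.
     Poly_Mapping.single (\<alpha> - Poly_Mapping.single j 1) (of_nat (lookup \<alpha> j) * lookup F \<alpha>))"

definition vec_var :: "nat set \<Rightarrow> cpoly" where
  "vec_var I = (\<Sum>j\<in>I. pconst (gen j) * pvar j)"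

definition norm_sq :: "nat set \<Rightarrow> cpoly" where
  "norm_sq I = (\<Sum>j\<in>I. pvar j ^ 2)"

definition dirac :: "nat set \<Rightarrow> cpoly \<Rightarrow> cpoly" where
  "dirac I F = (\<Sum>j\<in>I. pconst (gen j) * partial_deriv j F)"

definition monogenic :: "nat set \<Rightarrow> cpoly set" where
  "monogenic I = {F \<in> polys I. dirac I F = 0}"

definition monogenic_deg :: "nat set \<Rightarrow> nat \<Rightarrow> cpoly set" where
  "monogenic_deg I k = {F \<in> monogenic I. homogeneous k F}"

section \<open>Direct sums, the Fischer decomposition and \<open>\<tau>\<^sub>M\<close>\<close>

definition decomposes :: "('i \<Rightarrow> cpoly set) \<Rightarrow> cpoly \<Rightarrow> ('i \<Rightarrow> cpoly) \<Rightarrow> bool" where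
  "decomposes W F H \<longleftrightarrow>
     (\<forall>i. H i \<in> W i) \<and> finite {i. H i \<noteq> 0} \<and> F = (\<Sum>i | H i \<noteq> 0. H i)"

definition is_direct_sum :: "cpoly set \<Rightarrow> ('i \<Rightarrow> cpoly set) \<Rightarrow> bool" where
  "is_direct_sum V W \<longleftrightarrow>
     cpoly.subspace V \<and> (\<forall>i. cpoly.subspace (W i) \<and> W i \<subseteq> V) \<and>
     (\<forall>F\<in>V. \<exists>!H. decomposes W F H)"

text \<open>
  \<open>P\<^sub>M\<close>: the component with index \<open>s = 0\<close> in \<open>\<P>(\<real>\<^sup>m, \<complex>\<^sub>m) = \<Oplus>\<^sub>s x\<^sup>s \<M>(\<real>\<^sup>m, \<complex>\<^sub>m)\<close>, for
  arguments in \<open>polys I\<close>.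
\<close>

definition P_M :: "nat set \<Rightarrow> cpoly \<Rightarrow> cpoly" where
  "P_M I F = (THE H. decomposes (\<lambda>s. (\<lambda>G. vec_var I ^ s * G) ` monogenic I) F H) 0"

text \<open>
  The image \<open>\<tau>\<^sub>M(A \<otimes> B)\<close> of the tensor product of two subspaces is the span of the images
  of the pure tensors.
\<close>

definition tau_M_image :: "nat set \<Rightarrow> cpoly set \<Rightarrow> cpoly set \<Rightarrow> cpoly set" where
  "tau_M_image I A B = cpoly.span {P_M I (K * G) | K G. K \<in> A \<and> G \<in> B}"

section \<open>The operators\<close>

definition Gamma :: "nat set \<Rightarrow> cpoly \<Rightarrow> cpoly" where
  "Gamma I F = pscale (1 / 2)
     (dirac I (vec_var I * F) - vec_var I * dirac I F + pscale (of_nat (card I)) F)"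

definition c_e_P :: "nat \<Rightarrow> clifford" where
  "c_e_P p = scalar ((- \<i>) ^ (p * (p + 1) div 2)) * prod_list (map gen [1..<p + 1])"

definition shifted_Gamma :: "nat set \<Rightarrow> cpoly \<Rightarrow> cpoly" where
  "shifted_Gamma I F = Gamma I F - pscale ((of_nat (card I) - 1) / 2) F"

definition S_u :: "nat \<Rightarrow> cpoly \<Rightarrow> cpoly" where
  "S_u p F = pconst (c_e_P p) * shifted_Gamma {1..p} F"

definition S_v :: "nat \<Rightarrow> nat \<Rightarrow> cpoly \<Rightarrow> cpoly" where
  "S_v p q F = pconst (c_e_P p) * shifted_Gamma {p + 1..p + q} F"

datatype pm = Plus | Minus

fun pm_value :: "pm \<Rightarrow> complex" where
  "pm_value Plus = 1"
| "pm_value Minus = -1"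

definition monogenic_pm :: "nat \<Rightarrow> pm \<Rightarrow> nat \<Rightarrow> cpoly set" where
  "monogenic_pm p \<epsilon> k =
     {F \<in> monogenic_deg {1..p} k. pconst (c_e_P p) * F = pscale (pm_value \<epsilon>) F}"

definition summand :: "nat \<Rightarrow> nat \<Rightarrow> nat \<times> nat \<times> nat \<times> pm \<Rightarrow> cpoly set" where
  "summand p q = (\<lambda>(s, k, i, \<epsilon>). tau_M_image {1..p + q}
     ((\<lambda>K. vec_var {1..p} ^ s * K) ` monogenic_pm p \<epsilon> k) (monogenic_deg {p + 1..p + q} i))"

text \<open>
  Eigenvalues of \<open>S\<^sub>u\<close>, \<open>S\<^sub>v\<close> and \<open>\<Gamma>\<^sub>x - (m-1)/2\<close> on \<open>P\<^sub>M(|u|\<^bsup>2s\<^esup> P\<^sub>k\<^sup>\<plusminus> Q\<^sub>i)\<close> (first argument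
  after \<open>q\<close> is \<open>False\<close>) and on \<open>P\<^sub>M(u |u|\<^bsup>2s\<^esup> P\<^sub>k\<^sup>\<plusminus> Q\<^sub>i)\<close> (it is \<open>True\<close>).
\<close>

fun eigenvalues ::
  "nat \<Rightarrow> nat \<Rightarrow> bool \<Rightarrow> pm \<Rightarrow> nat \<Rightarrow> nat \<Rightarrow> nat \<Rightarrow> complex \<times> complex \<times> complex" where
  "eigenvalues p q False Plus s k i =
     (- (of_nat k + (of_nat p - 1) / 2),
      - (of_nat i + (of_nat q - 1) / 2),
      - (of_nat (k + i + 2 * s) + (of_nat (p + q) - 1) / 2))"
| "eigenvalues p q False Minus s k i =
     (of_nat k + (of_nat p - 1) / 2,
      of_nat i + (of_nat q - 1) / 2,
      - (of_nat (k + i + 2 * s) + (of_nat (p + q) - 1) / 2))"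
| "eigenvalues p q True Plus s k i =
     (- ((- 1) ^ p) * (of_nat k + (of_nat p - 1) / 2),
      (- 1) ^ p * (of_nat i + (of_nat q - 1) / 2),
      - (of_nat (k + i + 2 * s + 1) + (of_nat (p + q) - 1) / 2))"
| "eigenvalues p q True Minus s k i =
     ((- 1) ^ p * (of_nat k + (of_nat p - 1) / 2),
      - ((- 1) ^ p) * (of_nat i + (of_nat q - 1) / 2),
      - (of_nat (k + i + 2 * s + 1) + (of_nat (p + q) - 1) / 2))"

definition eigenfunction :: "(cpoly \<Rightarrow> cpoly) \<Rightarrow> complex \<Rightarrow> cpoly \<Rightarrow> bool" where
  "eigenfunction T z F \<longleftrightarrow> F \<noteq> 0 \<and> T F = pscale z F"

definition joint_eigenfunction ::
  "nat \<Rightarrow> nat \<Rightarrow> cpoly \<Rightarrow> complex \<times> complex \<times> complex \<Rightarrow> bool" where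
  "joint_eigenfunction p q F = (\<lambda>(a, b, c).
     eigenfunction (S_u p) a F \<and> eigenfunction (S_v p q) b F \<and>
     eigenfunction (shifted_Gamma {1..p + q}) c F)"

section \<open>The action of the spin group\<close>

definition unit_vectors :: "nat set \<Rightarrow> clifford set" where
  "unit_vectors I = {\<Sum>j\<in>I. scalar (of_real (a j)) * gen j | a :: nat \<Rightarrow> real. (\<Sum>j\<in>I. (a j)\<^sup>2) = 1}"

definition Spin :: "nat set \<Rightarrow> clifford set" where
  "Spin I = {prod_list vs | vs. even (length vs) \<and> set vs \<subseteq> unit_vectors I}"

definition cinv :: "clifford \<Rightarrow> clifford" where
  "cinv s = (THE t. s * t = 1 \<and> t * s = 1)"

text \<open>
  Substitution of the polynomials \<open>\<phi> i\<close> for the variables; only used for \<open>\<phi> i\<close> with scalar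
  coefficients, which commute, so that the order of the factors is immaterial.
\<close>

definition psubst :: "(nat \<Rightarrow> cpoly) \<Rightarrow> cpoly \<Rightarrow> cpoly" where
  "psubst \<phi> F = (\<Sum>\<alpha>\<in>keys F. pconst (lookup F \<alpha>) *
     prod_list (map (\<lambda>i. \<phi> i ^ lookup \<alpha> i) (sorted_list_of_set (keys \<alpha>))))"

text \<open>The \<open>i\<close>-th coordinate of \<open>s\<^sup>-\<^sup>1 x s = \<Sum>\<^sub>j x\<^sub>j s\<^sup>-\<^sup>1 e\<^sub>j s\<close>.\<close>

definition conj_coord :: "nat set \<Rightarrow> clifford \<Rightarrow> nat \<Rightarrow> cpoly" where
  "conj_coord I s i = (\<Sum>j\<in>I. pscale (lookup (coeffs (cinv s * gen j * s)) {|i|}) (pvar j))"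

definition L :: "nat set \<Rightarrow> clifford \<Rightarrow> cpoly \<Rightarrow> cpoly" where
  "L I s F = pconst s * psubst (conj_coord I s) F"

section \<open>The Fischer inner product\<close>

definition multi_deriv :: "(nat \<Rightarrow>\<^sub>0 nat) \<Rightarrow> cpoly \<Rightarrow> cpoly" where
  "multi_deriv \<alpha> =
     foldr (\<lambda>j. partial_deriv j ^^ lookup \<alpha> j) (sorted_list_of_set (keys \<alpha>))"

text \<open>The value of a polynomial at \<open>x = 0\<close> is its coefficient at the monomial \<open>0\<close>.\<close>

definition fischer :: "cpoly \<Rightarrow> cpoly \<Rightarrow> complex" where
  "fischer F G = scalar_part
     (lookup (\<Sum>\<alpha>\<in>keys F. pconst (cbar (lookup F \<alpha>)) * multi_deriv \<alpha> G) 0)"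

end

theory Submission
  imports Defs
begin

text \<open>
  Write \<open>\<Gamma>'\<close> for the shifted Gamma operators. From \<open>{x, \<partial>} = - (2 E + d)\<close>, \<open>[E, x] = x\<close> and
  \<open>[E, \<partial>] = - \<partial>\<close> (\<open>E\<close> the Euler operator) it follows that \<open>\<Gamma>'\<close> anticommutes with \<open>x\<close> and \<open>\<partial>\<close>, so
  \<open>S\<^sub>u\<close>, \<open>S\<^sub>v\<close> and \<open>\<Gamma>'\<^sub>x\<close> commute with \<open>x\<close> and \<open>\<partial>\<^sub>x\<close> up to sign. Hence they commute with \<open>P\<^sub>M\<close>, and
  their eigenvalues on \<open>P\<^sub>M(u\<^sup>s P Q)\<close> are those on \<open>u\<^sup>s P Q\<close>. All of them are self-adjoint, which gives
  orthogonality whenever the labels \<open>(s, k, i)\<close> differ. For \<open>p = q = 1\<close>, \<open>k = i = 0\<close> both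
  eigenvalues of \<open>S\<^sub>u\<close> and \<open>S\<^sub>v\<close> vanish and do not see the sign \<open>\<plusminus>\<close>; in all cases the sign is
  detected by a fourth operator, the reflection \<open>F(u, v) \<mapsto> c e\<^sub>P F(- u, v)\<close>.

  A polynomial \<open>K(u) G(v)\<close> is a sum of terms \<open>v\<^sup>j u\<^sup>s P Q\<close> by the Fischer decompositions in \<open>u\<close> and
  in \<open>v\<close>; modulo the multiples of \<open>x = u + v\<close>, which \<open>P\<^sub>M\<close> kills, \<open>v\<close> may be replaced by \<open>- u\<close>.
  So the summands span, and orthogonality makes the sum direct. Therefore each summand is the
  full joint eigenspace of the four operators, and it is invariant under the spin group because
  the spin action commutes with them.
\<close>

text \<open>The factor \<open>c_e_P p\<close> is what makes the operators compatible with
  \<open>x = u + v\<close>. The shifted Gamma operator of one block anticommutes with the vector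
  variable of that block but commutes with the other one, so on its own it does not pass
  \<open>x\<close> with a single sign. The pseudoscalar also has opposite signs on the two blocks,
  and the two discrepancies cancel: \<open>S_u\<close> passes both \<open>u\<close> and
  \<open>v\<close> with \<open>(-1)^p\<close>, \<open>S_v\<close> with \<open>-(-1)^p\<close>. The
  reflection works for the same reason, since the sign change of \<open>u\<close> alone is
  compensated by \<open>c_e_P p\<close>.

  The eigenvalue of the shifted Gamma operator of \<open>x\<close> is read off the projection
  itself, which is monogenic and homogeneous of degree \<open>s + k + i\<close>.

  Eigenfunctions must be nonzero, which is a separate issue: \<open>u^s P Q\<close> lies in the
  kernel of the Dirac operator in \<open>v\<close>, this kernel contains no nonzero multiple of
  \<open>x\<close>, and \<open>P_M\<close> vanishes exactly on the multiples of \<open>x\<close>.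
  Injectivity and uniqueness arguments rest on two positivity facts, that of \<open>2 E + n\<close>
  on monomials and that of the Fischer form; no dimensions are counted.\<close>

abbreviation single where "single \<equiv> Poly_Mapping.single"

section \<open>The Clifford algebra\<close>

lemma scalar_zero [simp]: "scalar 0 = 0"
  by transfer simp

lemma scalar_uminus: "scalar (- z) = - scalar z"
  by transfer (simp add: single_uminus)

lemma scalar_of_nat: "scalar (of_nat n) = of_nat n"
  by (induction n) (simp_all add: scalar_add scalar_one)

lemma coeffs_simps [simp]:
  "coeffs 0 = 0" "coeffs (a + b) = coeffs a + coeffs b" "coeffs (a - b) = coeffs a - coeffs b"
  "coeffs (- a) = - coeffs a" "coeffs (scalar z) = single {||} z"
  "coeffs (blade B) = single B 1"
  by (transfer; simp)+

lemma coeffs_eqI: "coeffs a = coeffs b \<Longrightarrow> a = b"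
  by (simp add: coeffs_inject)

lemma coeffs_sum: "coeffs (sum f S) = (\<Sum>x\<in>S. coeffs (f x))"
  by (induction S rule: infinite_finite_induct) simp_all

lemma coeffs_scalar_blade: "coeffs (scalar z * blade B) = single B z"
  by transfer (simp add: cmul_single)

lemma poly_mapping_sum_single:
  fixes f :: "'a \<Rightarrow>\<^sub>0 'b::comm_monoid_add"
  shows "f = (\<Sum>k\<in>keys f. single k (lookup f k))"
proof (rule poly_mapping_eqI)
  fix k
  show "lookup f k = lookup (\<Sum>k\<in>keys f. single k (lookup f k)) k"
    by (simp add: lookup_sum lookup_single when_def sum.delta' in_keys_iff)
qed

lemma clifford_expand:
  "a = (\<Sum>B\<in>keys (coeffs a). scalar (lookup (coeffs a) B) * blade B)"
  by (rule coeffs_eqI) (simp add: coeffs_sum coeffs_scalar_blade flip: poly_mapping_sum_single)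

lemma Cl_induct [consumes 1, case_names zero blade add]:
  assumes "a \<in> Cl I" "P 0" "\<And>z B. fset B \<subseteq> I \<Longrightarrow> P (scalar z * blade B)"
    "\<And>a b. P a \<Longrightarrow> P b \<Longrightarrow> P (a + b)"
  shows "P a"
proof -
  have "P (\<Sum>B\<in>S. scalar (lookup (coeffs a) B) * blade B)" if "S \<subseteq> keys (coeffs a)" "finite S" for S
    using that(2,1) assms by (induction S) (auto simp: Cl_def)
  then show ?thesis
    using clifford_expand [of a] by (metis finite_keys order_refl)
qed

lemma Cl_UNIV [simp]: "a \<in> Cl UNIV"
  by (simp add: Cl_def)

lemmas clifford_induct [case_names zero blade add] = Cl_induct [OF Cl_UNIV]

lemma blade_mult: "blade A * blade B = scalar (blade_sign A B) * blade (symdiff A B)"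
  by transfer (simp add: cmul_single)

lemma scalar_central: "scalar z * a = a * scalar z"
proof (induction a rule: clifford_induct)
  case (blade w B)
  have "scalar z * blade B = blade B * scalar z"
    by transfer (simp add: cmul_single)
  then show ?case
    by (metis mult.assoc mult.commute scalar_mult)
qed (simp_all add: algebra_simps)

lemma scalar_scalar_mult: "scalar z * (scalar w * a) = scalar (z * w) * a"
  by (simp add: scalar_mult mult.assoc)

lemma scalar_left_commute: "b * (scalar z * a) = scalar z * (b * a)"
  by (simp add: scalar_central flip: mult.assoc) (simp add: scalar_central mult.assoc)

lemma scalar_blade_mult:
  "scalar z * blade A * (scalar w * blade B) =
    scalar (z * w * blade_sign A B) * blade (symdiff A B)"
  by (simp add: mult.assoc scalar_left_commute [of "blade A"] blade_mult scalar_scalar_mult)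

lemma blade_sign_sq: "blade_sign A B * blade_sign A B = 1"
  by (auto simp: blade_sign_def prod.distrib [symmetric] intro!: prod.neutral)

lemma scalar_mult_eq_0_iff: "scalar z * a = 0 \<longleftrightarrow> z = 0 \<or> a = 0"
proof
  assume *: "scalar z * a = 0"
  show "z = 0 \<or> a = 0"
  proof (cases "z = 0")
    case False
    have "a = scalar (inverse z) * (scalar z * a)"
      using False by (simp add: scalar_one flip: mult.assoc scalar_mult)
    then show ?thesis using * by simp
  qed simp
qed auto

lemma of_nat_mult_clifford_eq_0_iff: "of_nat n * (a :: clifford) = 0 \<longleftrightarrow> n = 0 \<or> a = 0"
  using scalar_mult_eq_0_iff [of "of_nat n" a] by (simp add: scalar_of_nat)

lemma gen_sq [simp]: "gen j * gen j = -1"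
proof -
  have "symdiff {|j|} {|j|} = {||}" by (auto simp: symdiff_def)
  then show ?thesis unfolding gen_def
    by transfer (simp add: cmul_single blade_sign_def single_uminus)
qed

lemma gen_sq_left [simp]: "gen j * (gen j * a) = - a"
  by (simp flip: mult.assoc)

lemma gen_anti: "i \<noteq> j \<Longrightarrow> gen i * gen j = - (gen j * gen i)"
  using gen_anticommute [of i j] by (simp add: eq_neg_iff_add_eq_0)

lemma symdiff_commute: "symdiff A B = symdiff B A"
  by (auto simp: symdiff_def)

text \<open>Moving \<open>gen j\<close> across a blade costs one sign for each factor different from
  \<open>gen j\<close>, which commutes with itself. In terms of \<open>blade_sign\<close>, a pair
  \<open>i\<close>, \<open>j\<close> is counted once in each order, hence twice if
  \<open>i = j\<close>.\<close>

lemma blade_gen: "blade B * gen j = scalar ((-1) ^ card (fset B - {j})) * (gen j * blade B)"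
proof -
  have "(\<Prod>i\<in>fset B. (if j \<le> i then -1 else 1) * (if i \<le> j then -1 else (1::complex)))
      = (\<Prod>i\<in>fset B - {j}. -1)"
    by (intro prod.mono_neutral_cong_right) auto
  then have s: "blade_sign B {|j|} * blade_sign {|j|} B = (-1) ^ card (fset B - {j})"
    by (simp add: blade_sign_def prod.distrib [symmetric])
  have "blade_sign B {|j|} = (-1) ^ card (fset B - {j}) * blade_sign {|j|} B"
    using s blade_sign_sq by (metis mult.assoc mult.right_neutral)
  then show ?thesis
    by (simp add: gen_def blade_mult symdiff_commute [of B] scalar_mult mult.assoc)
qed

lemma Cl_zero [simp]: "0 \<in> Cl I" and Cl_scalar [simp]: "scalar z \<in> Cl I"
  and Cl_one [simp]: "1 \<in> Cl I"
  using Cl_def scalar_one by (auto simp: Cl_def one_clifford.rep_eq)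

lemma Cl_add: "a \<in> Cl I \<Longrightarrow> b \<in> Cl I \<Longrightarrow> a + b \<in> Cl I"
  using keys_add [of "coeffs a" "coeffs b"] by (auto simp: Cl_def)

lemma Cl_blade: "fset B \<subseteq> I \<Longrightarrow> blade B \<in> Cl I"
  by (auto simp: Cl_def)

lemma Cl_gen: "j \<in> I \<Longrightarrow> gen j \<in> Cl I"
  by (simp add: gen_def Cl_blade)

lemma Cl_mult: "a \<in> Cl I \<Longrightarrow> b \<in> Cl I \<Longrightarrow> a * b \<in> Cl I"
proof (induction a rule: Cl_induct)
  case (blade z A)
  from blade(2,1) show ?case
  proof (induction b rule: Cl_induct)
    case (blade w B)
    have "fset (symdiff A B) \<subseteq> I" using blade by (auto simp: symdiff_def)
    then show ?case
      by (auto simp: scalar_blade_mult Cl_def coeffs_scalar_blade)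
  qed (simp_all add: distrib_left Cl_add)
qed (simp_all add: distrib_right Cl_add)

lemma Cl_of_nat [simp]: "of_nat n \<in> Cl I"
  by (metis Cl_scalar scalar_of_nat)

lemma Cl_sum: "(\<And>x. x \<in> S \<Longrightarrow> f x \<in> Cl I) \<Longrightarrow> sum f S \<in> Cl I"
  by (induction S rule: infinite_finite_induct) (auto intro: Cl_add)

lemma Cl_mono: "I \<subseteq> J \<Longrightarrow> Cl I \<subseteq> Cl J"
  by (auto simp: Cl_def)

section \<open>Scalar part, conjugation and the Hermitian form on the Clifford algebra\<close>

lemma scalar_part_add: "scalar_part (a + b) = scalar_part a + scalar_part b"
  by transfer (simp add: lookup_add)

lemma scalar_part_zero [simp]: "scalar_part 0 = 0"
  by transfer simp

lemma scalar_part_scalar_mult: "scalar_part (scalar z * a) = z * scalar_part a"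
proof (induction a rule: clifford_induct)
  case (blade w B)
  have "scalar z * (scalar w * blade B) = scalar (z * w) * blade B"
    by (simp add: scalar_mult mult.assoc)
  then show ?case
    by (simp add: scalar_part.rep_eq coeffs_scalar_blade lookup_single when_def)
qed (simp_all add: scalar_part_add algebra_simps)

text \<open>The trace property: two blades have a product with nonzero scalar part only if they
  coincide. It later yields that conjugation by a versor has an orthogonal matrix.\<close>

lemma scalar_part_mult_commute: "scalar_part (a * b) = scalar_part (b * a)"
proof (induction a rule: clifford_induct)
  case (blade z A)
  show ?case
  proof (induction b rule: clifford_induct)
    case (blade w B)
    have "symdiff A B = {||} \<Longrightarrow> A = B" by (auto simp: symdiff_def)
    then show ?case
      by (auto simp: scalar_blade_mult scalar_part.rep_eq coeffs_scalar_blade lookup_single when_def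
          symdiff_commute [of B A])
  qed (simp_all add: distrib_left distrib_right scalar_part_add)
qed (simp_all add: distrib_left distrib_right scalar_part_add)

lemma cbar_zero [simp]: "cbar 0 = 0"
  by transfer (simp add: cbar_coeffs_zero)

lemma cbar_one [simp]: "cbar 1 = 1"
  using cbar_scalar [of 1] by (simp add: scalar_one)

lemma cbar_sum: "cbar (sum f S) = (\<Sum>x\<in>S. cbar (f x))"
  by (induction S rule: infinite_finite_induct) (simp_all add: cbar_add)

lemma cbar_blade: "cbar (blade B) = scalar (blade_sign B B) * blade B"
  by transfer (simp add: cbar_coeffs_single cmul_single)

lemma symdiff_self [simp]: "symdiff A A = {||}"
  by (auto simp: symdiff_def)

lemma blade_empty [simp]: "blade {||} = 1"
  by transfer simp

lemma cbar_blade_mult [simp]: "cbar (blade B) * blade B = 1" "blade B * cbar (blade B) = 1"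
  by (simp_all add: cbar_blade mult.assoc scalar_left_commute [of "blade B"] blade_mult
      scalar_scalar_mult blade_sign_sq scalar_one flip: scalar_mult)

lemma cbar_cbar [simp]: "cbar (cbar a) = a"
proof (induction a rule: clifford_induct)
  case (blade z B)
  have "cnj (blade_sign B B) = blade_sign B B"
    by (simp add: blade_sign_def if_distrib cong: if_cong)
  then have "cbar (cbar (blade B)) = blade B"
    by (simp add: cbar_blade cbar_mult cbar_scalar scalar_central [of _ "blade B", symmetric]
        scalar_central [of _ "scalar w * b" for w b, symmetric]
        scalar_scalar_mult blade_sign_sq scalar_one flip: mult.assoc scalar_mult)
  then show ?case
    by (simp add: cbar_mult cbar_scalar scalar_central)
qed (simp_all add: cbar_add)

text \<open>The conjugate of a blade is its inverse, so the blades are orthonormal for this form.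
  The positivity of the Fischer inner product comes from here.\<close>

lemma scalar_part_cbar_mult:
  "scalar_part (cbar a * b) = (\<Sum>B\<in>keys (coeffs a). cnj (lookup (coeffs a) B) * lookup (coeffs b) B)"
proof -
  have 1: "scalar_part (cbar (blade A) * b) = lookup (coeffs b) A" for A
  proof (induction b rule: clifford_induct)
    case (blade z B)
    have "cbar (blade A) * (scalar z * blade B) =
        scalar (z * blade_sign A A * blade_sign A B) * blade (symdiff A B)"
      unfolding cbar_blade scalar_blade_mult by (simp add: mult_ac)
    moreover have "symdiff A B = {||} \<Longrightarrow> A = B" by (auto simp: symdiff_def)
    ultimately show ?case
      using blade_sign_sq [of B B]
      by (auto simp: scalar_part.rep_eq coeffs_scalar_blade lookup_single when_def)
  qed (simp_all add: distrib_left scalar_part_add lookup_add)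
  have 2: "scalar_part (sum f S) = (\<Sum>x\<in>S. scalar_part (f x))" for f :: "nat fset \<Rightarrow> clifford" and S
    by (induction S rule: infinite_finite_induct) (simp_all add: scalar_part_add)
  have "cbar a * b = (\<Sum>B\<in>keys (coeffs a).
      scalar (cnj (lookup (coeffs a) B)) * (cbar (blade B) * b))"
    by (subst (1) clifford_expand [of a])
      (simp add: cbar_sum cbar_mult cbar_scalar sum_distrib_right scalar_central mult.assoc)
  then show ?thesis
    by (simp add: 2 scalar_part_scalar_mult 1)
qed

section \<open>The pseudoscalar \<open>c_e_P\<close>\<close>

lemma c_e_P_eq_blade:
  "c_e_P p = scalar ((- \<i>) ^ (p * (p + 1) div 2)) * blade (fset_of_list [1..<p + 1])"
proof -
  have "sorted_list_of_fset (fset_of_list [1..<p + 1]) = [1..<p + 1]"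
    by (subst sorted_list_of_fset.rep_eq, subst fset_of_list.rep_eq)
      (intro sorted_list_of_set.idem_if_sorted_distinct; simp del: upt_Suc)
  then show ?thesis
    by (simp only: c_e_P_def blade_eq_prod_list)
qed

lemma c_e_P_sq [simp]: "c_e_P p * c_e_P p = 1"
proof -
  let ?B = "fset_of_list [1..<p + 1]"
  have B: "fset ?B = {1..p}" by (auto simp: fset_of_list.rep_eq)
  have "(\<Prod>j\<in>{1..p}. if j \<le> i then -1 else (1::complex)) = (-1) ^ i" if "i \<in> {1..p}" for i
  proof -
    have "(\<Prod>j\<in>{1..p}. if j \<le> i then -1 else (1::complex)) = (\<Prod>j\<in>{1..i}. -1)"
      using that by (intro prod.mono_neutral_cong_right) auto
    then show ?thesis by simp
  qed
  then have "blade_sign ?B ?B = (\<Prod>i\<in>{1..p}. (-1) ^ i)"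
    unfolding blade_sign_def B by (intro prod.cong refl)
  also have "\<dots> = (-1) ^ (\<Sum>i\<in>{1..p}. i)"
    by (simp add: power_sum)
  also have "(\<Sum>i\<in>{1..p}. i) = p * (p + 1) div 2"
    using gauss_sum_from_Suc_0 [of p, where 'a = nat] by simp
  finally have s: "blade_sign ?B ?B = (-1) ^ (p * (p + 1) div 2)" .
  \<comment> \<open>The sign \<open>s\<close> is the square of \<open>e_P\<close>. The power of
    \<open>- \<i>\<close> in \<open>c_e_P\<close> has the same exponent, so its square cancels that
    sign.\<close>
  have "((- \<i>) * (- \<i>)) ^ n * (-1) ^ n = (1::complex)" for n
    by (simp flip: power_mult_distrib)
  then have "(- \<i>) ^ n * (- \<i>) ^ n * (-1) ^ n = (1::complex)" for n
    by (simp only: power_mult_distrib)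
  moreover have "c_e_P p * c_e_P p = scalar ((- \<i>) ^ (p * (p + 1) div 2) *
      (- \<i>) ^ (p * (p + 1) div 2) * blade_sign ?B ?B) * blade (symdiff ?B ?B)"
    unfolding c_e_P_eq_blade by (rule scalar_blade_mult)
  ultimately show ?thesis
    by (simp only: s symdiff_self blade_empty scalar_one mult_1_right)
qed

text \<open>The element is unitary because its scalar factor has modulus 1, and it is its own
  inverse by \<open>c_e_P_sq\<close>; hence it equals its conjugate. This makes left multiplication
  by it self-adjoint for the Fischer form.\<close>

lemma cbar_c_e_P [simp]: "cbar (c_e_P p) = c_e_P p"
proof -
  have "cmod ((- \<i>) ^ n) = 1" for n by (simp add: norm_power)
  then have c: "cnj ((- \<i>) ^ n) * (- \<i>) ^ n = 1" for n
    using complex_norm_square [of "(- \<i>) ^ n"] by (metis mult.commute of_real_1 power_one)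
  have "cbar (c_e_P p) * c_e_P p = scalar (cnj ((- \<i>) ^ (p * (p + 1) div 2)) *
      (- \<i>) ^ (p * (p + 1) div 2)) * (cbar (blade (fset_of_list [1..<p + 1])) *
      blade (fset_of_list [1..<p + 1]))"
    unfolding c_e_P_eq_blade cbar_mult cbar_scalar
    by (simp only: mult.assoc scalar_left_commute [of "cbar (blade B)" for B] scalar_scalar_mult)
  then have "cbar (c_e_P p) * c_e_P p = 1"
    by (simp only: c cbar_blade_mult scalar_one mult_1_right)
  then show ?thesis
    by (metis c_e_P_sq mult.assoc mult.left_neutral mult.right_neutral)
qed

text \<open>A generator inside \<open>{1..p}\<close> crosses \<open>p - 1\<close> other factors, one
  outside crosses \<open>p\<close>. The two signs are opposite, which is the property that
  \<open>S_u\<close>, \<open>S_v\<close> and the reflection exploit.\<close>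

lemma c_e_P_gen:
  shows "j \<in> {1..p} \<Longrightarrow> c_e_P p * gen j = scalar (- ((-1) ^ p)) * (gen j * c_e_P p)"
    and "j \<notin> {1..p} \<Longrightarrow> c_e_P p * gen j = scalar ((-1) ^ p) * (gen j * c_e_P p)"
proof -
  have B: "fset (fset_of_list [1..<p + 1]) = {1..p}" by (auto simp: fset_of_list.rep_eq)
  have *: "c_e_P p * gen j = scalar ((-1) ^ card ({1..p} - {j})) * (gen j * c_e_P p)"
    using blade_gen [of "fset_of_list [1..<p + 1]" j] unfolding c_e_P_eq_blade B
    by (simp add: mult.assoc scalar_left_commute [of "gen j"] scalar_scalar_mult mult.commute)
  have "j \<in> {1..p} \<Longrightarrow> (-1) ^ card ({1..p} - {j}) = (- ((-1) ^ p) :: complex)"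
    by (cases p) auto
  with * show "j \<in> {1..p} \<Longrightarrow> c_e_P p * gen j = scalar (- ((-1) ^ p)) * (gen j * c_e_P p)"
    by simp
  show "j \<notin> {1..p} \<Longrightarrow> c_e_P p * gen j = scalar ((-1) ^ p) * (gen j * c_e_P p)"
    using * by simp
qed

lemma Cl_c_e_P: "{1..p} \<subseteq> I \<Longrightarrow> c_e_P p \<in> Cl I"
  unfolding c_e_P_eq_blade
  by (intro Cl_mult Cl_scalar Cl_blade) (auto simp: fset_of_list.rep_eq)

section \<open>Clifford-valued polynomials\<close>

lemma pconst_simps [simp]: "pconst 0 = 0" "pconst 1 = 1"
  by (simp_all add: pconst_def)

lemma pconst_add: "pconst (a + b) = pconst a + pconst b"
  by (simp add: pconst_def single_add)

lemma pconst_uminus: "pconst (- a) = - pconst a"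
  by (simp add: pconst_def single_uminus)

lemma pconst_mult: "pconst (a * b) = pconst a * pconst b"
  by (simp add: pconst_def mult_single)

lemma pconst_sum: "pconst (sum f S) = (\<Sum>x\<in>S. pconst (f x))"
  by (induction S rule: infinite_finite_induct) (simp_all add: pconst_add)

lemma cpoly_induct [case_names zero single add]:
  fixes F :: cpoly
  assumes "P 0" "\<And>\<alpha> a. P (single \<alpha> a)" "\<And>F G. P F \<Longrightarrow> P G \<Longrightarrow> P (F + G)"
  shows "P F"
proof -
  have "P (\<Sum>\<alpha>\<in>S. single \<alpha> (lookup F \<alpha>))" for S
    by (induction S rule: infinite_finite_induct) (simp_all add: assms)
  then show ?thesis
    by (metis poly_mapping_sum_single)
qed

lemma nat_exponent_induct [consumes 1, case_names zero add]:
  fixes \<alpha> :: "nat \<Rightarrow>\<^sub>0 nat"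
  assumes "keys \<alpha> \<subseteq> I" "P 0"
    "\<And>\<alpha> j. keys \<alpha> \<subseteq> I \<Longrightarrow> j \<in> I \<Longrightarrow> P \<alpha> \<Longrightarrow> P (single j 1 + \<alpha>)"
  shows "P \<alpha>"
  using assms(1)
\<comment> \<open>The measure is the total degree, which drops when one occurrence of a variable is
  removed.\<close>
proof (induction "\<Sum>j\<in>keys \<alpha>. lookup \<alpha> j" arbitrary: \<alpha> rule: less_induct)
  case less
  show ?case
  proof (cases "\<alpha> = 0")
    case False
    then obtain j where j: "j \<in> keys \<alpha>" by (metis all_not_in_conv keys_eq_empty)
    define \<beta> where "\<beta> = \<alpha> - single j 1"
    have \<alpha>: "\<alpha> = single j 1 + \<beta>"
      using j by (intro poly_mapping_eqI)
        (auto simp: \<beta>_def lookup_add lookup_minus lookup_single when_def in_keys_iff)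
    have sub: "keys \<beta> \<subseteq> keys \<alpha>"
      by (auto simp: \<alpha> lookup_add in_keys_iff)
    have "(\<Sum>j\<in>keys \<beta>. lookup \<beta> j) = (\<Sum>j\<in>keys \<alpha>. lookup \<beta> j)"
      using sub by (intro sum.mono_neutral_left) (auto simp: in_keys_iff)
    also have "\<dots> < (\<Sum>j\<in>keys \<alpha>. lookup \<alpha> j)"
      using j by (intro sum_strict_mono_ex1) (auto simp: \<alpha> lookup_add lookup_single when_def)
    finally have "P \<beta>" using less sub by blast
    then show ?thesis using \<alpha> assms(3) [of \<beta> j] sub j less.prems by auto
  qed (simp add: assms)
qed

lemma pvar_mult_single:
  "pvar j * single \<alpha> a = single (single j 1 + \<alpha>) a"
  by (simp add: pvar_def mult_single)

lemma pvar_central: "F * pvar j = pvar j * F"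
  by (induction F rule: cpoly_induct) (simp_all add: algebra_simps pvar_def mult_single)

lemma pvar_left_commute: "F * (pvar j * G) = pvar j * (F * G)"
  by (simp add: pvar_central flip: mult.assoc)

lemma pconst_mult_single: "pconst a * single \<alpha> b = single \<alpha> (a * b)"
  by (simp add: pconst_def mult_single)

lemma pscale_mult_left: "pscale z F * G = pscale z (F * G)"
  by (simp add: pscale_def mult.assoc)

lemma pconst_scalar_central: "F * pconst (scalar z) = pconst (scalar z) * F"
  by (induction F rule: cpoly_induct) (simp_all add: algebra_simps pconst_def mult_single scalar_central)

lemma pscale_mult_right: "F * pscale z G = pscale z (F * G)"
  by (simp add: pscale_def pconst_scalar_central flip: mult.assoc)

lemma pscale_pconst: "pscale z (pconst a) = pconst (scalar z * a)"
  by (simp add: pscale_def pconst_mult)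

lemma lookup_pconst_mult: "lookup (pconst a * F) \<alpha> = a * lookup F \<alpha>"
  by (induction F rule: cpoly_induct)
    (simp_all add: algebra_simps pconst_mult_single lookup_add lookup_single when_def)

lemma lookup_pscale: "lookup (pscale z F) \<alpha> = scalar z * lookup F \<alpha>"
  by (simp add: pscale_def lookup_pconst_mult)

lemma pscale_minus_one: "pscale (-1) F = - F"
  by (metis cpoly.scale_minus_left cpoly.scale_one)

lemma pscale_of_nat_add: "pscale (of_nat (Suc n)) F = pscale (of_nat n) F + F"
  by (simp add: cpoly.scale_left_distrib)

lemma pscale_two: "pscale 2 F = F + F"
  by (metis cpoly.scale_left_distrib cpoly.scale_one one_add_one)

text \<open>The definition subtracts exponents in \<open>nat\<close>, where distinct exponents may
  be identified by truncation. Truncation only affects monomials free of \<open>j\<close>, and these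
  carry the factor 0; reading off coefficients makes this precise once and for all.\<close>

lemma lookup_partial_deriv:
  "lookup (partial_deriv j F) \<alpha> = of_nat (Suc (lookup \<alpha> j)) * lookup F (single j 1 + \<alpha>)"
proof -
  have "lookup (single (\<beta> - single j 1) (of_nat (lookup \<beta> j) * lookup F \<beta>)) \<alpha>
      = (if \<beta> = single j 1 + \<alpha> then
          of_nat (Suc (lookup \<alpha> j)) * lookup F (single j 1 + \<alpha>) else 0)" for \<beta>
  proof (cases "lookup \<beta> j = 0")
    case True
    then have "\<beta> \<noteq> single j 1 + \<alpha>" by (auto simp: lookup_add)
    then show ?thesis using True by (simp add: lookup_single when_def)
  next
    case False
    then have "\<beta> - single j 1 = \<alpha> \<longleftrightarrow> \<beta> = single j 1 + \<alpha>"
      by (auto simp: poly_mapping_eq_iff fun_eq_iff lookup_minus lookup_add lookup_single when_def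
          split: if_splits)
    then show ?thesis by (auto simp: lookup_single when_def lookup_add)
  qed
  then show ?thesis
    by (simp add: partial_deriv_def lookup_sum in_keys_iff)
qed

lemma partial_deriv_add: "partial_deriv j (F + G) = partial_deriv j F + partial_deriv j G"
  by (rule poly_mapping_eqI) (simp only: lookup_partial_deriv lookup_add distrib_left)

lemma partial_deriv_zero [simp]: "partial_deriv j 0 = 0"
  by (simp add: partial_deriv_def)

lemma partial_deriv_single:
  "partial_deriv j (single \<alpha> a) =
    single (\<alpha> - single j 1) (of_nat (lookup \<alpha> j) * a)"
  by (cases "a = 0") (simp_all add: partial_deriv_def)

text \<open>The coefficients do not commute, but differentiation only touches the variables, so the
  product rule holds with the order of the factors kept.\<close>

lemma partial_deriv_mult:
  "partial_deriv j (F * G) = partial_deriv j F * G + F * partial_deriv j G"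
proof (induction F rule: cpoly_induct)
  case (single \<alpha> a)
  show ?case
  proof (induction G rule: cpoly_induct)
    case (single \<beta> b)
    let ?e = "single j 1 :: nat \<Rightarrow>\<^sub>0 nat"
    have 1: "lookup \<alpha> j = 0 \<or> \<alpha> - ?e + \<beta> = \<alpha> + \<beta> - ?e"
      by (auto simp: poly_mapping_eq_iff fun_eq_iff lookup_minus lookup_add lookup_single when_def)
    have 2: "lookup \<beta> j = 0 \<or> \<alpha> + (\<beta> - ?e) = \<alpha> + \<beta> - ?e"
      by (auto simp: poly_mapping_eq_iff fun_eq_iff lookup_minus lookup_add lookup_single when_def)
    have 3: "a * (of_nat n * b) = of_nat n * (a * b)" for n
      by (metis mult.assoc mult_of_nat_commute)
    from 1 2 show ?case
      by (auto simp: mult_single partial_deriv_single lookup_add single_add distrib_right mult.assoc 3)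
  qed (simp_all add: partial_deriv_add algebra_simps)
qed (simp_all add: partial_deriv_add algebra_simps)

lemma partial_deriv_pconst [simp]: "partial_deriv j (pconst a) = 0"
  by (simp add: pconst_def partial_deriv_single)

lemma partial_deriv_pvar: "partial_deriv j (pvar i) = (if i = j then 1 else 0)"
  by (auto simp: pvar_def partial_deriv_single lookup_single when_def simp flip: single_one)

lemma partial_deriv_pconst_mult: "partial_deriv j (pconst a * F) = pconst a * partial_deriv j F"
  by (simp add: partial_deriv_mult)

lemma partial_deriv_mult_pconst: "partial_deriv j (F * pconst a) = partial_deriv j F * pconst a"
  by (simp add: partial_deriv_mult)

lemma partial_deriv_pvar_mult:
  "partial_deriv j (pvar i * F) = (if i = j then F else 0) + pvar i * partial_deriv j F"
  by (simp add: partial_deriv_mult partial_deriv_pvar)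

lemma partial_deriv_pscale: "partial_deriv j (pscale z F) = pscale z (partial_deriv j F)"
  by (simp add: pscale_def partial_deriv_pconst_mult)

lemma partial_deriv_uminus: "partial_deriv j (- F) = - partial_deriv j F"
  using partial_deriv_pscale [of j "-1" F] by (simp add: pscale_minus_one)

lemma partial_deriv_sum: "partial_deriv j (sum f S) = (\<Sum>x\<in>S. partial_deriv j (f x))"
  by (induction S rule: infinite_finite_induct) (simp_all add: partial_deriv_add)

lemma partial_deriv_commute: "partial_deriv i (partial_deriv j F) = partial_deriv j (partial_deriv i F)"
proof (rule poly_mapping_eqI)
  fix \<alpha>
  have "of_nat m * (of_nat n * a) = of_nat n * (of_nat m * a)" for m n and a :: clifford
    by (metis mult.assoc mult_of_nat_commute)
  then show "lookup (partial_deriv i (partial_deriv j F)) \<alpha> = lookup (partial_deriv j (partial_deriv i F)) \<alpha>"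
    by (cases "i = j")
      (simp_all add: lookup_partial_deriv lookup_add lookup_single add_ac del: of_nat_Suc)
qed

section \<open>Polynomials over a given set of indices\<close>

lemma polys_iff: "F \<in> polys I \<longleftrightarrow> (\<forall>\<alpha>. lookup F \<alpha> \<noteq> 0 \<longrightarrow> keys \<alpha> \<subseteq> I \<and> lookup F \<alpha> \<in> Cl I)"
  by (auto simp: polys_def in_keys_iff)

lemma polys_zero [simp]: "0 \<in> polys I"
  by (simp add: polys_def)

lemma polys_add: "F \<in> polys I \<Longrightarrow> G \<in> polys I \<Longrightarrow> F + G \<in> polys I"
  unfolding polys_iff lookup_add by (metis Cl_add Cl_zero add_0)

lemma polys_single: "keys \<alpha> \<subseteq> I \<Longrightarrow> a \<in> Cl I \<Longrightarrow> single \<alpha> a \<in> polys I"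
  by (auto simp: polys_iff lookup_single when_def)

lemma polys_sum: "(\<And>x. x \<in> S \<Longrightarrow> f x \<in> polys I) \<Longrightarrow> sum f S \<in> polys I"
  by (induction S rule: infinite_finite_induct) (auto intro: polys_add)

lemma polys_induct [consumes 1, case_names zero single add]:
  assumes "F \<in> polys I" "P 0" "\<And>\<alpha> a. keys \<alpha> \<subseteq> I \<Longrightarrow> a \<in> Cl I \<Longrightarrow> P (single \<alpha> a)"
    "\<And>F G. P F \<Longrightarrow> P G \<Longrightarrow> P (F + G)"
  shows "P F"
proof -
  have "P (\<Sum>\<alpha>\<in>S. single \<alpha> (lookup F \<alpha>))" if "S \<subseteq> keys F" "finite S" for S
    using that(2,1) assms by (induction S) (auto simp: polys_def)
  then show ?thesis
    by (metis poly_mapping_sum_single finite_keys order_refl)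
qed

lemma polys_mult: "F \<in> polys I \<Longrightarrow> G \<in> polys I \<Longrightarrow> F * G \<in> polys I"
proof (induction F rule: polys_induct)
  case (single \<alpha> a)
  from single(3,1,2) show ?case
  proof (induction G rule: polys_induct)
    case (single \<beta> b)
    then show ?case
      using keys_add [of \<alpha> \<beta>] by (auto simp: mult_single intro!: polys_single Cl_mult)
  qed (simp_all add: distrib_left polys_add)
qed (simp_all add: distrib_right polys_add)

lemma polys_pconst: "a \<in> Cl I \<Longrightarrow> pconst a \<in> polys I"
  by (simp add: pconst_def polys_single)

lemma polys_one [simp]: "1 \<in> polys I"
  using polys_pconst [of 1 I] by simp

lemma polys_pvar: "j \<in> I \<Longrightarrow> pvar j \<in> polys I"
  by (simp add: pvar_def polys_single)

lemma polys_pscale: "F \<in> polys I \<Longrightarrow> pscale z F \<in> polys I"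
  by (simp add: pscale_def polys_mult polys_pconst)

lemma polys_uminus: "F \<in> polys I \<Longrightarrow> - F \<in> polys I"
  using polys_pscale [of F I "-1"] by (simp add: pscale_minus_one)

lemma polys_diff: "F \<in> polys I \<Longrightarrow> G \<in> polys I \<Longrightarrow> F - G \<in> polys I"
  using polys_add [of F I "- G"] by (simp add: polys_uminus)

lemma polys_power: "F \<in> polys I \<Longrightarrow> F ^ n \<in> polys I"
  by (induction n) (simp_all add: polys_mult)

lemma polys_mono: "I \<subseteq> J \<Longrightarrow> F \<in> polys I \<Longrightarrow> F \<in> polys J"
  using Cl_mono [of I J] by (auto simp: polys_def)

lemma polys_partial_deriv: "F \<in> polys I \<Longrightarrow> partial_deriv j F \<in> polys I"
proof (induction F rule: polys_induct)
  case (single \<alpha> a)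
  have "keys (\<alpha> - single j 1) \<subseteq> keys \<alpha>"
    by (auto simp: in_keys_iff lookup_minus)
  with single show ?case by (auto simp: partial_deriv_single intro!: polys_single Cl_mult)
qed (simp_all add: partial_deriv_add polys_add)

text \<open>Builds polynomials from constants by multiplying with one variable at a time.
  Derivatives and substitutions are determined by their behaviour on such products.\<close>

lemma polys_var_induct [consumes 1, case_names const var add]:
  assumes "F \<in> polys I" "\<And>a. a \<in> Cl I \<Longrightarrow> P (pconst a)"
    "\<And>j F. j \<in> I \<Longrightarrow> F \<in> polys I \<Longrightarrow> P F \<Longrightarrow> P (pvar j * F)"
    "\<And>F G. P F \<Longrightarrow> P G \<Longrightarrow> P (F + G)"
  shows "P F"
  using assms(1)
proof (induction F rule: polys_induct)
  case zero
  show ?case using assms(2) [of 0] by simp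
next
  case (single \<alpha> a)
  from single show ?case
  proof (induction \<alpha> rule: nat_exponent_induct)
    case zero
    then show ?case using assms(2) [of a] by (simp add: pconst_def)
  next
    case (add \<alpha> j)
    then show ?case using assms(3) [of j "single \<alpha> a"]
      by (simp add: pvar_mult_single polys_single)
  qed
qed (rule assms)

lemma polys_UNIV [simp]: "F \<in> polys UNIV"
  by (simp add: polys_def)

lemma partial_deriv_outside: "F \<in> polys I \<Longrightarrow> j \<notin> I \<Longrightarrow> partial_deriv j F = 0"
  by (induction F rule: polys_var_induct) (auto simp: partial_deriv_pvar_mult partial_deriv_add)

section \<open>The Dirac operator, the vector variable and the Euler operator\<close>

lemma dirac_add: "dirac A (F + G) = dirac A F + dirac A G"
  by (simp add: dirac_def partial_deriv_add distrib_left sum.distrib)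

lemma dirac_zero [simp]: "dirac A 0 = 0"
  by (simp add: dirac_def)

lemma dirac_pscale: "dirac A (pscale z F) = pscale z (dirac A F)"
  by (simp add: dirac_def partial_deriv_pscale pscale_mult_right cpoly.scale_sum_right)

lemma dirac_uminus: "dirac A (- F) = - dirac A F"
  using dirac_pscale [of A "-1" F] by (simp add: pscale_minus_one)

lemma dirac_diff: "dirac A (F - G) = dirac A F - dirac A G"
  using dirac_add [of A F "- G"] by (simp add: dirac_uminus)

definition euler :: "nat set \<Rightarrow> cpoly \<Rightarrow> cpoly" where
  "euler A F = (\<Sum>j\<in>A. pvar j * partial_deriv j F)"

lemma euler_add: "euler A (F + G) = euler A F + euler A G"
  by (simp add: euler_def partial_deriv_add distrib_left sum.distrib)

lemma euler_zero [simp]: "euler A 0 = 0"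
  by (simp add: euler_def)

lemma euler_pscale: "euler A (pscale z F) = pscale z (euler A F)"
  by (simp add: euler_def partial_deriv_pscale pscale_mult_right cpoly.scale_sum_right)

lemma euler_uminus: "euler A (- F) = - euler A F"
  using euler_pscale [of A "-1" F] by (simp add: pscale_minus_one)

lemma euler_diff: "euler A (F - G) = euler A F - euler A G"
  using euler_add [of A F "- G"] by (simp add: euler_uminus)

lemma pgen_anti: "i \<noteq> j \<Longrightarrow> pconst (gen i) * pconst (gen j) = - (pconst (gen j) * pconst (gen i))"
  by (simp add: gen_anti [of i j] pconst_uminus flip: pconst_mult)

lemma pgen_anti_left:
  "i \<noteq> j \<Longrightarrow> pconst (gen i) * (pconst (gen j) * F) = - (pconst (gen j) * (pconst (gen i) * F))"
  by (simp add: pgen_anti [of i j] flip: mult.assoc)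

lemma pgen_anticomm: "i \<noteq> j \<Longrightarrow> pconst (gen i) * (pconst (gen j) * F) + pconst (gen j) * (pconst (gen i) * F) = 0"
  by (simp add: pgen_anti_left [of i j])

lemma pgen_sq: "pconst (gen j) * (pconst (gen j) * F) = - F"
  by (simp add: pconst_uminus flip: pconst_mult mult.assoc)

lemma pconst_pvar_commute: "pconst a * (pvar j * F) = pvar j * (pconst a * F)"
  by (rule pvar_left_commute)

lemma pvar_pvar_commute: "pvar i * (pvar j * F) = pvar j * (pvar i * F)"
  by (rule pvar_left_commute)

lemmas pvar_simps = pconst_pvar_commute pvar_pvar_commute

lemma vec_var_mult: "vec_var A * F = (\<Sum>j\<in>A. pconst (gen j) * (pvar j * F))"
  by (simp add: vec_var_def sum_distrib_right mult.assoc)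

lemma vec_var_dirac:
  "vec_var A * dirac B F =
    (\<Sum>j\<in>A. \<Sum>i\<in>B. pconst (gen j) * (pconst (gen i) * (pvar j * partial_deriv i F)))"
  by (subst vec_var_mult) (simp add: dirac_def sum_distrib_left pvar_simps)

text \<open>The common pattern of anticommutators of sums over generators: mixed terms cancel in
  pairs because distinct generators anticommute, and only the diagonal survives.\<close>

lemma sum_sum_diagonal:
  fixes f :: "'a \<Rightarrow> 'a \<Rightarrow> cpoly"
  assumes "finite A" "\<And>i j. i \<in> A \<Longrightarrow> j \<in> A \<Longrightarrow> i \<noteq> j \<Longrightarrow> f i j + g j i = 0"
  shows "(\<Sum>i\<in>A. \<Sum>j\<in>A. f i j) + (\<Sum>j\<in>A. \<Sum>i\<in>A. g j i) = (\<Sum>i\<in>A. f i i + g i i)"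
proof -
  have "(\<Sum>i\<in>A. \<Sum>j\<in>A. f i j) + (\<Sum>j\<in>A. \<Sum>i\<in>A. g j i) = (\<Sum>i\<in>A. \<Sum>j\<in>A. f i j + g j i)"
    by (subst (2) sum.swap) (simp add: sum.distrib)
  also have "\<dots> = (\<Sum>i\<in>A. \<Sum>j\<in>A. if i = j then f i i + g i i else 0)"
    using assms by (intro sum.cong) auto
  finally show ?thesis using assms by simp
qed

lemma dirac_vec_var_anticomm:
  assumes "finite A"
  shows "dirac A (vec_var A * F) + vec_var A * dirac A F =
    - (euler A F + euler A F + pscale (of_nat (card A)) F)"
proof -
  have "dirac A (vec_var A * F) = (\<Sum>i\<in>A. \<Sum>j\<in>A. pconst (gen i) * (pconst (gen j) *
      ((if j = i then F else 0) + pvar j * partial_deriv i F)))"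
    by (simp add: dirac_def vec_var_mult partial_deriv_sum partial_deriv_pconst_mult
        partial_deriv_pvar_mult sum_distrib_left)
  moreover note vec_var_dirac [of A A F]
  ultimately have "dirac A (vec_var A * F) + vec_var A * dirac A F =
      (\<Sum>i\<in>A. - (F + pvar i * partial_deriv i F) - pvar i * partial_deriv i F)"
    using assms by (simp only:) (subst sum_sum_diagonal; simp add: pgen_anticomm pgen_sq)
  also have "\<dots> = - (\<Sum>i\<in>A. (pvar i * partial_deriv i F + pvar i * partial_deriv i F) + F)"
    by (simp add: algebra_simps flip: sum_negf)
  also have "(\<Sum>i\<in>A. F) = pscale (of_nat (card A)) F" if "finite A"
    using that
    by (induction A) (simp_all del: sum_constant add: cpoly.scale_left_distrib)
  with assms have "- (\<Sum>i\<in>A. (pvar i * partial_deriv i F + pvar i * partial_deriv i F) + F) =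
      - (euler A F + euler A F + pscale (of_nat (card A)) F)"
    by (simp add: euler_def sum.distrib)
  finally show ?thesis .
qed

lemma sum_anticommute:
  fixes f :: "'a \<Rightarrow> 'b \<Rightarrow> cpoly"
  assumes "\<And>i j. i \<in> A \<Longrightarrow> j \<in> B \<Longrightarrow> f i j = - g j i"
  shows "(\<Sum>i\<in>A. \<Sum>j\<in>B. f i j) = - (\<Sum>j\<in>B. \<Sum>i\<in>A. g j i)"
  using assms by (subst sum.swap) (simp add: sum_negf)

lemma dirac_vec_var_disjoint:
  assumes "A \<inter> B = {}"
  shows "dirac A (vec_var B * F) = - (vec_var B * dirac A F)"
  unfolding vec_var_dirac
  unfolding dirac_def vec_var_mult partial_deriv_sum sum_distrib_left
proof (rule sum_anticommute)
  fix i j assume "i \<in> A" "j \<in> B"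
  then have "j \<noteq> i" using assms by auto
  then show "pconst (gen i) * partial_deriv i (pconst (gen j) * (pvar j * F)) =
    - (pconst (gen j) * (pconst (gen i) * (pvar j * partial_deriv i F)))"
    by (simp add: partial_deriv_pconst_mult partial_deriv_pvar_mult pgen_anti_left [of i j])
qed

lemma vec_var_vec_var:
  "vec_var A * (vec_var B * F) =
    (\<Sum>i\<in>A. \<Sum>j\<in>B. pconst (gen i) * (pvar i * (pconst (gen j) * (pvar j * F))))"
  by (subst vec_var_mult) (simp only: vec_var_mult [of B] sum_distrib_left)

lemma vec_var_disjoint:
  assumes "A \<inter> B = {}"
  shows "vec_var A * (vec_var B * F) = - (vec_var B * (vec_var A * F))"
  unfolding vec_var_vec_var
proof (rule sum_anticommute)
  fix i j assume "i \<in> A" "j \<in> B"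
  then have "j \<noteq> i" using assms by auto
  then show "pconst (gen i) * (pvar i * (pconst (gen j) * (pvar j * F))) =
    - (pconst (gen j) * (pvar j * (pconst (gen i) * (pvar i * F))))"
    by (simp add: pvar_simps pgen_anti_left [of i j])
qed

lemma dirac_dirac:
  "dirac A (dirac B F) =
    (\<Sum>i\<in>A. \<Sum>j\<in>B. pconst (gen i) * (pconst (gen j) * partial_deriv i (partial_deriv j F)))"
  by (simp add: dirac_def partial_deriv_sum partial_deriv_pconst_mult sum_distrib_left)

lemma dirac_disjoint:
  assumes "A \<inter> B = {}"
  shows "dirac A (dirac B F) = - dirac B (dirac A F)"
  unfolding dirac_dirac
proof (rule sum_anticommute)
  fix i j assume "i \<in> A" "j \<in> B"
  then have "j \<noteq> i" using assms by auto
  then show "pconst (gen i) * (pconst (gen j) * partial_deriv i (partial_deriv j F)) =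
    - (pconst (gen j) * (pconst (gen i) * partial_deriv j (partial_deriv i F)))"
    by (simp add: pgen_anti_left [of i j] partial_deriv_commute [of i j])
qed

lemma vec_var_sq: "finite A \<Longrightarrow> vec_var A * vec_var A = - norm_sq A"
proof -
  assume "finite A"
  \<comment> \<open>The square is computed twice, with the two summation indices interchanged, so
    that the mixed terms cancel; the factor 2 is divided out at the end.\<close>
  have "vec_var A * vec_var A + vec_var A * vec_var A =
      (\<Sum>i\<in>A. \<Sum>j\<in>A. pconst (gen i) * (pconst (gen j) * (pvar i * pvar j))) +
      (\<Sum>j\<in>A. \<Sum>i\<in>A. pconst (gen j) * (pconst (gen i) * (pvar i * pvar j)))"
  proof -
    have "vec_var A * vec_var A =
      (\<Sum>i\<in>A. \<Sum>j\<in>A. pconst (gen i) * (pconst (gen j) * (pvar i * pvar j)))"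
      by (subst vec_var_mult)
        (simp add: vec_var_def sum_distrib_left pvar_simps)
    moreover have "\<dots> = (\<Sum>j\<in>A. \<Sum>i\<in>A. pconst (gen j) * (pconst (gen i) * (pvar i * pvar j)))"
      by (simp add: pvar_central [of "pvar i" j for i j])
    ultimately show ?thesis by simp
  qed
  also have "\<dots> = (\<Sum>i\<in>A. - (pvar i * pvar i) - pvar i * pvar i)"
    using \<open>finite A\<close> by (subst sum_sum_diagonal) (simp_all add: pgen_anticomm pgen_sq)
  also have "\<dots> = - (norm_sq A + norm_sq A)"
    by (simp add: norm_sq_def power2_eq_square sum_subtractf sum_negf)
  finally have "pscale 2 (vec_var A * vec_var A) = pscale 2 (- norm_sq A)"
    by (simp add: pscale_two)
  then show ?thesis
    by (simp only: cpoly.scale_cancel_left) simp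
qed

lemma euler_vec_var:
  assumes "finite A"
  shows "euler A (vec_var A * F) = vec_var A * F + vec_var A * euler A F"
proof -
  have "euler A (vec_var A * F) = (\<Sum>i\<in>A. \<Sum>j\<in>A. pvar i * (pconst (gen j) *
      ((if j = i then F else 0) + pvar j * partial_deriv i F)))"
    by (simp add: euler_def vec_var_mult partial_deriv_sum partial_deriv_pconst_mult
        partial_deriv_pvar_mult sum_distrib_left)
  also have "\<dots> = (\<Sum>i\<in>A. \<Sum>j\<in>A. (if i = j then pconst (gen i) * (pvar i * F) else 0) +
      pconst (gen j) * (pvar j * (pvar i * partial_deriv i F)))"
    by (intro sum.cong refl)
      (auto simp: distrib_left pvar_simps)
  also have "\<dots> = vec_var A * F + (\<Sum>i\<in>A. \<Sum>j\<in>A. pconst (gen j) * (pvar j * (pvar i * partial_deriv i F)))"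
    using assms by (simp add: sum.distrib vec_var_mult)
  also have "(\<Sum>i\<in>A. \<Sum>j\<in>A. pconst (gen j) * (pvar j * (pvar i * partial_deriv i F))) = vec_var A * euler A F"
    by (subst sum.swap, subst vec_var_mult) (simp add: euler_def sum_distrib_left)
  finally show ?thesis .
qed

lemma dirac_euler:
  assumes "finite A"
  shows "dirac A (euler A F) = dirac A F + euler A (dirac A F)"
proof -
  have "dirac A (euler A F) = (\<Sum>i\<in>A. \<Sum>j\<in>A. pconst (gen i) *
      ((if j = i then partial_deriv j F else 0) + pvar j * partial_deriv i (partial_deriv j F)))"
    by (simp add: euler_def dirac_def partial_deriv_sum partial_deriv_pvar_mult sum_distrib_left)
  also have "\<dots> = (\<Sum>i\<in>A. \<Sum>j\<in>A. (if i = j then pconst (gen i) * partial_deriv i F else 0) +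
      pvar j * (pconst (gen i) * partial_deriv j (partial_deriv i F)))"
    by (intro sum.cong refl)
      (auto simp: distrib_left pvar_simps partial_deriv_commute)
  also have "\<dots> = dirac A F + (\<Sum>i\<in>A. \<Sum>j\<in>A. pvar j * (pconst (gen i) * partial_deriv j (partial_deriv i F)))"
    using assms by (simp add: sum.distrib dirac_def)
  also have "(\<Sum>i\<in>A. \<Sum>j\<in>A. pvar j * (pconst (gen i) * partial_deriv j (partial_deriv i F))) = euler A (dirac A F)"
    by (subst sum.swap) (simp add: dirac_def euler_def sum_distrib_left partial_deriv_sum partial_deriv_pconst_mult)
  finally show ?thesis .
qed

lemma dirac_vec_var:
  assumes "finite A"
  shows "dirac A (vec_var A * F) =
    - (euler A F + euler A F + pscale (of_nat (card A)) F) - vec_var A * dirac A F"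
  using dirac_vec_var_anticomm [OF assms, of F] by (simp add: eq_diff_eq)

text \<open>Anticommuting \<open>dirac A\<close> past \<open>vec_var A\<close> twice produces two
  Euler terms of opposite sign. By \<open>euler_vec_var\<close> they differ by
  \<open>2 * vec_var A\<close>, and the dimension cancels.\<close>

lemma dirac_vec_var_sq:
  assumes "finite A"
  shows "dirac A (vec_var A * (vec_var A * F)) =
    vec_var A * (vec_var A * dirac A F) - (vec_var A * F + vec_var A * F)"
  unfolding dirac_vec_var [OF assms] euler_vec_var [OF assms] right_diff_distrib distrib_left
    mult_minus_right pscale_mult_right
  by (simp add: add_ac)

lemma vec_var_dirac_sq:
  assumes "finite A"
  shows "dirac A (dirac A (vec_var A * F)) =
    vec_var A * dirac A (dirac A F) - (dirac A F + dirac A F)"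
  unfolding dirac_vec_var [OF assms] dirac_euler [OF assms] dirac_diff dirac_uminus dirac_add
    dirac_pscale
  by (simp add: add_ac)

section \<open>The shifted Gamma operators and their commutation rules\<close>

lemma shifted_Gamma_eq:
  "shifted_Gamma A F = pscale (1 / 2) (dirac A (vec_var A * F) - vec_var A * dirac A F + F)"
proof -
  have "pscale (of_nat (card A) / 2) F - pscale ((of_nat (card A) - 1) / 2) F = pscale (1/2) F"
    by (simp add: diff_divide_distrib flip: cpoly.scale_left_diff_distrib)
  then show ?thesis
    by (simp add: shifted_Gamma_def Gamma_def cpoly.scale_right_distrib
        cpoly.scale_right_diff_distrib algebra_simps)
qed

lemma shifted_Gamma_add: "shifted_Gamma A (F + G) = shifted_Gamma A F + shifted_Gamma A G"
  by (simp add: shifted_Gamma_eq dirac_add distrib_left cpoly.scale_right_distrib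
        cpoly.scale_right_diff_distrib)

lemma shifted_Gamma_pscale: "shifted_Gamma A (pscale z F) = pscale z (shifted_Gamma A F)"
  by (simp add: shifted_Gamma_eq dirac_pscale pscale_mult_right cpoly.scale_right_distrib
        cpoly.scale_right_diff_distrib mult.commute)

lemma shifted_Gamma_uminus: "shifted_Gamma A (- F) = - shifted_Gamma A F"
  using shifted_Gamma_pscale [of A "-1" F] by (simp add: pscale_minus_one)

lemma shifted_Gamma_diff: "shifted_Gamma A (F - G) = shifted_Gamma A F - shifted_Gamma A G"
  using shifted_Gamma_add [of A F "- G"] by (simp add: shifted_Gamma_uminus)

text \<open>After the shift the dimension is gone and only \<open>F / 2\<close> remains of the
  constants. This half is what absorbs the correction \<open>- 2 * vec_var A\<close> of
  \<open>dirac_vec_var_sq\<close> and turns the relation into exact anticommutation.\<close>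

lemma shifted_Gamma_vec_var:
  assumes "finite A"
  shows "shifted_Gamma A (vec_var A * F) = - (vec_var A * shifted_Gamma A F)"
  unfolding shifted_Gamma_eq dirac_vec_var_sq [OF assms] pscale_mult_right
    cpoly.scale_minus_right [symmetric]
  by (simp add: algebra_simps)

lemma shifted_Gamma_dirac:
  assumes "finite A"
  shows "shifted_Gamma A (dirac A F) = - dirac A (shifted_Gamma A F)"
  unfolding shifted_Gamma_eq dirac_pscale dirac_diff dirac_add vec_var_dirac_sq [OF assms]
    cpoly.scale_minus_right [symmetric]
  by (simp add: algebra_simps)

text \<open>Both \<open>vec_var A\<close> and \<open>dirac A\<close> anticommute with
  \<open>vec_var B\<close>, and \<open>shifted_Gamma A\<close> is made of products of the two and a
  constant, so the signs cancel.\<close>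

lemma shifted_Gamma_vec_var_disjoint:
  "A \<inter> B = {} \<Longrightarrow> shifted_Gamma A (vec_var B * F) = vec_var B * shifted_Gamma A F"
  by (simp add: shifted_Gamma_eq dirac_vec_var_disjoint vec_var_disjoint [of A B] dirac_uminus
      pscale_mult_right algebra_simps)

lemma shifted_Gamma_dirac_disjoint:
  assumes "A \<inter> B = {}"
  shows "shifted_Gamma A (dirac B F) = dirac B (shifted_Gamma A F)"
proof -
  have "B \<inter> A = {}" using assms by auto
  then show ?thesis
    by (simp add: shifted_Gamma_eq dirac_vec_var_disjoint [of B A] dirac_disjoint [of B A]
        dirac_pscale dirac_diff dirac_add dirac_uminus algebra_simps)
qed

lemma shifted_Gamma_commute:
  assumes "A \<inter> B = {}"
  shows "shifted_Gamma A (shifted_Gamma B F) = shifted_Gamma B (shifted_Gamma A F)"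
  unfolding shifted_Gamma_eq [of B] shifted_Gamma_pscale shifted_Gamma_add shifted_Gamma_diff
    shifted_Gamma_vec_var_disjoint [OF assms] shifted_Gamma_dirac_disjoint [OF assms] ..

section \<open>Constants that commute with the generators of a block up to a scalar\<close>

lemma pconst_vec_var:
  assumes "\<And>j. j \<in> A \<Longrightarrow> c * gen j = scalar z * (gen j * c)"
  shows "pconst c * (vec_var A * F) = pscale z (vec_var A * (pconst c * F))"
proof -
  have "pconst c * (pconst (gen j) * (pvar j * F)) = pscale z (pconst (gen j) * (pvar j * (pconst c * F)))"
    if "j \<in> A" for j
    using arg_cong [OF assms [OF that], of "\<lambda>a. pconst a * (pvar j * F)"]
    by (simp add: pscale_def pconst_mult mult.assoc pvar_simps)
  then show ?thesis
    by (simp add: vec_var_mult sum_distrib_left cpoly.scale_sum_right)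
qed

lemma pconst_dirac:
  assumes "\<And>j. j \<in> A \<Longrightarrow> c * gen j = scalar z * (gen j * c)"
  shows "pconst c * dirac A F = pscale z (dirac A (pconst c * F))"
proof -
  have "pconst c * (pconst (gen j) * partial_deriv j F) = pscale z (pconst (gen j) * (pconst c * partial_deriv j F))"
    if "j \<in> A" for j
    using arg_cong [OF assms [OF that], of "\<lambda>a. pconst a * partial_deriv j F"]
    by (simp add: pscale_def pconst_mult mult.assoc)
  then show ?thesis
    by (simp add: dirac_def sum_distrib_left cpoly.scale_sum_right partial_deriv_pconst_mult)
qed

lemma pconst_shifted_Gamma:
  assumes "\<And>j. j \<in> A \<Longrightarrow> c * gen j = scalar z * (gen j * c)" "z * z = 1"
  shows "pconst c * shifted_Gamma A F = shifted_Gamma A (pconst c * F)"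
  using assms(2)
  by (simp add: shifted_Gamma_eq pscale_mult_right distrib_left right_diff_distrib
      pconst_vec_var [OF assms(1)] pconst_dirac [OF assms(1)] dirac_pscale)

lemma vec_var_union: "finite A \<Longrightarrow> finite B \<Longrightarrow> A \<inter> B = {} \<Longrightarrow> vec_var (A \<union> B) = vec_var A + vec_var B"
  by (simp add: vec_var_def sum.union_disjoint)

lemma dirac_union: "finite A \<Longrightarrow> finite B \<Longrightarrow> A \<inter> B = {} \<Longrightarrow> dirac (A \<union> B) F = dirac A F + dirac B F"
  by (simp add: dirac_def sum.union_disjoint)

lemma polys_vec_var: "A \<subseteq> I \<Longrightarrow> vec_var A \<in> polys I"
  unfolding vec_var_def by (intro polys_sum polys_mult polys_pconst polys_pvar Cl_gen) auto

lemma polys_dirac: "A \<subseteq> I \<Longrightarrow> F \<in> polys I \<Longrightarrow> dirac A F \<in> polys I"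
  unfolding dirac_def by (intro polys_sum polys_mult polys_pconst polys_partial_deriv Cl_gen) auto

lemma polys_euler: "A \<subseteq> I \<Longrightarrow> F \<in> polys I \<Longrightarrow> euler A F \<in> polys I"
  unfolding euler_def by (intro polys_sum polys_mult polys_pvar polys_partial_deriv) auto

lemma polys_shifted_Gamma: "A \<subseteq> I \<Longrightarrow> F \<in> polys I \<Longrightarrow> shifted_Gamma A F \<in> polys I"
  unfolding shifted_Gamma_eq
  by (intro polys_pscale polys_add polys_diff polys_dirac polys_mult polys_vec_var)

section \<open>The Fischer inner product\<close>

text \<open>The multi-index factorial, which is the Fischer norm squared of the monomial with
  exponent \<open>\<alpha>\<close>.\<close>

definition mfact :: "(nat \<Rightarrow>\<^sub>0 nat) \<Rightarrow> nat" where
  "mfact \<alpha> = (\<Prod>j\<in>keys \<alpha>. fact (lookup \<alpha> j))"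

lemma mfact_superset: "finite S \<Longrightarrow> keys \<alpha> \<subseteq> S \<Longrightarrow> mfact \<alpha> = (\<Prod>j\<in>S. fact (lookup \<alpha> j))"
  unfolding mfact_def by (intro prod.mono_neutral_left) (auto simp: in_keys_iff)

lemma mfact_pos: "mfact \<alpha> > 0"
  by (simp add: mfact_def prod_pos)

lemma mfact_add_single: "mfact (single j 1 + \<alpha>) = Suc (lookup \<alpha> j) * mfact \<alpha>"
proof -
  let ?S = "insert j (keys \<alpha>)"
  have "keys (single j 1 + \<alpha>) \<subseteq> ?S"
    using keys_add [of "single j (1::nat)" \<alpha>] by auto
  then have "mfact (single j 1 + \<alpha>) =
      (\<Prod>i\<in>?S. fact (lookup (single j 1 + \<alpha>) i))"
    by (intro mfact_superset) auto
  also have "\<dots> = fact (Suc (lookup \<alpha> j)) * (\<Prod>i\<in>?S - {j}. fact (lookup \<alpha> i))"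
    by (subst prod.remove [of _ j]) (auto simp: lookup_add lookup_single when_def intro!: prod.cong)
  also have "\<dots> = Suc (lookup \<alpha> j) * (\<Prod>i\<in>?S. fact (lookup \<alpha> i))"
    by (subst (2) prod.remove [of _ j]) (auto simp: algebra_simps)
  also have "(\<Prod>i\<in>?S. fact (lookup \<alpha> i)) = mfact \<alpha>"
    by (intro mfact_superset [symmetric]) auto
  finally show ?thesis .
qed

lemma lookup_partial_deriv_funpow:
  "lookup \<beta> j = 0 \<Longrightarrow>
    lookup ((partial_deriv j ^^ n) F) \<beta> = of_nat (fact n) * lookup F (single j n + \<beta>)"
proof (induction n arbitrary: F)
  case (Suc n)
  have "lookup ((partial_deriv j ^^ Suc n) F) \<beta> =
      of_nat (fact n) * (of_nat (Suc n) *
        lookup F (single j 1 + (single j n + \<beta>)))"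
    using Suc by (simp only: funpow_Suc_right o_apply) (simp add: lookup_partial_deriv lookup_add)
  also have "single j 1 + (single j n + \<beta>) = single j (Suc n) + \<beta>"
    by (simp flip: single_add add.assoc)
  also have "of_nat (fact n) * (of_nat (Suc n) * a) = of_nat (fact (Suc n)) * a" for a :: clifford
    by (simp add: mult.commute flip: mult.assoc of_nat_Suc of_nat_mult)
  finally show ?case .
qed simp

text \<open>Each variable taken off the list moves its exponent into \<open>\<beta>\<close>, hence
  the generalisation over \<open>\<beta>\<close>. The variables still in the list have exponent 0
  there, so every factor is a full factorial.\<close>

lemma lookup_foldr_partial_deriv:
  "distinct xs \<Longrightarrow> (\<And>j. j \<in> set xs \<Longrightarrow> lookup \<beta> j = 0) \<Longrightarrow>
    lookup (foldr (\<lambda>j. partial_deriv j ^^ lookup \<alpha> j) xs G) \<beta> =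
    of_nat (\<Prod>j\<in>set xs. fact (lookup \<alpha> j)) *
      lookup G ((\<Sum>j\<in>set xs. single j (lookup \<alpha> j)) + \<beta>)"
proof (induction xs arbitrary: \<beta>)
  case (Cons x xs)
  have "lookup (foldr (\<lambda>j. partial_deriv j ^^ lookup \<alpha> j) (x # xs) G) \<beta> =
      of_nat (fact (lookup \<alpha> x)) * lookup (foldr (\<lambda>j. partial_deriv j ^^ lookup \<alpha> j) xs G)
        (single x (lookup \<alpha> x) + \<beta>)"
    using Cons.prems by (simp add: lookup_partial_deriv_funpow)
  also have "\<dots> = of_nat (fact (lookup \<alpha> x)) * (of_nat (\<Prod>j\<in>set xs. fact (lookup \<alpha> j)) *
      lookup G ((\<Sum>j\<in>set xs. single j (lookup \<alpha> j)) +
        (single x (lookup \<alpha> x) + \<beta>)))"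
    using Cons.prems by (subst Cons.IH) (auto simp: lookup_add lookup_single when_def)
  finally show ?case
    using Cons.prems by (simp add: mult.assoc add_ac)
qed simp

lemma lookup_multi_deriv_zero: "lookup (multi_deriv \<alpha> G) 0 = of_nat (mfact \<alpha>) * lookup G \<alpha>"
  by (simp add: multi_deriv_def lookup_foldr_partial_deriv mfact_def flip: poly_mapping_sum_single)

lemma scalar_part_sum: "scalar_part (sum f S) = (\<Sum>x\<in>S. scalar_part (f x))"
  by (induction S rule: infinite_finite_induct) (simp_all add: scalar_part_add)

lemma scalar_part_of_nat_mult: "scalar_part (of_nat n * a) = of_nat n * scalar_part a"
  by (metis scalar_of_nat scalar_part_scalar_mult)

lemma fischer_eq:
  "fischer F G = (\<Sum>\<alpha>\<in>keys F. of_nat (mfact \<alpha>) * scalar_part (cbar (lookup F \<alpha>) * lookup G \<alpha>))"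
proof -
  have "scalar_part (cbar a * (of_nat n * b)) = of_nat n * scalar_part (cbar a * b)" for a b n
    by (metis mult.assoc mult_of_nat_commute scalar_part_of_nat_mult)
  then show ?thesis
    by (simp add: fischer_def lookup_sum scalar_part_sum lookup_pconst_mult lookup_multi_deriv_zero)
qed

lemma fischer_superset:
  "finite S \<Longrightarrow> keys F \<subseteq> S \<Longrightarrow>
    fischer F G = (\<Sum>\<alpha>\<in>S. of_nat (mfact \<alpha>) * scalar_part (cbar (lookup F \<alpha>) * lookup G \<alpha>))"
  unfolding fischer_eq by (intro sum.mono_neutral_left) (auto simp: in_keys_iff)

lemma fischer_add_left: "fischer (F + G) H = fischer F H + fischer G H"
  using fischer_superset [of "keys F \<union> keys G" "F + G" H]
    fischer_superset [of "keys F \<union> keys G" F H] fischer_superset [of "keys F \<union> keys G" G H]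
    keys_add [of F G]
  by (simp add: lookup_add cbar_add distrib_right distrib_left scalar_part_add sum.distrib)

lemma fischer_add_right: "fischer F (G + H) = fischer F G + fischer F H"
  by (simp add: fischer_eq lookup_add distrib_left scalar_part_add sum.distrib)

lemma fischer_zero [simp]: "fischer 0 F = 0" "fischer F 0 = 0"
  by (simp_all add: fischer_eq)

lemma fischer_single:
  "fischer (single \<alpha> a) G = of_nat (mfact \<alpha>) * scalar_part (cbar a * lookup G \<alpha>)"
  using fischer_superset [of "{\<alpha>}" "single \<alpha> a" G] by simp

lemma scalar_part_cbar: "scalar_part (cbar a) = cnj (scalar_part a)"
proof (induction a rule: clifford_induct)
  case (blade z B)
  have "cbar (scalar z * blade B) = scalar (cnj z * blade_sign B B) * blade B"
    by (simp only: cbar_mult cbar_scalar cbar_blade)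
      (simp only: scalar_central [of "cnj z", symmetric] scalar_scalar_mult)
  then show ?case
    by (auto simp: scalar_part.rep_eq coeffs_scalar_blade lookup_single when_def)
qed (simp_all add: cbar_add scalar_part_add)

lemma fischer_cnj: "cnj (fischer F G) = fischer G F"
proof -
  let ?S = "keys F \<union> keys G"
  have "cnj (scalar_part (cbar a * b)) = scalar_part (cbar b * a)" for a b
    by (simp add: cbar_mult flip: scalar_part_cbar)
  then show ?thesis
    using fischer_superset [of ?S F G] fischer_superset [of ?S G F] by simp
qed

lemma fischer_pscale_right: "fischer F (pscale z G) = z * fischer F G"
proof -
  have "scalar_part (cbar a * (scalar z * b)) = z * scalar_part (cbar a * b)" for a b
    by (simp add: scalar_left_commute [of "cbar a"] scalar_part_scalar_mult)
  then show ?thesis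
    by (simp add: fischer_eq lookup_pscale sum_distrib_left mult_ac)
qed

lemma fischer_pscale_left: "fischer (pscale z F) G = cnj z * fischer F G"
  by (metis complex_cnj_mult fischer_cnj fischer_pscale_right)

lemma fischer_uminus: "fischer (- F) G = - fischer F G" "fischer F (- G) = - fischer F G"
  using fischer_pscale_left [of "-1" F G] fischer_pscale_right [of F "-1" G]
  by (simp_all add: pscale_minus_one)

lemma fischer_diff: "fischer (F - G) H = fischer F H - fischer G H"
    "fischer F (G - H) = fischer F G - fischer F H"
  using fischer_add_left [of F "- G" H] fischer_add_right [of F G "- H"]
  by (simp_all add: fischer_uminus)

lemma fischer_sum: "fischer (sum f S) G = (\<Sum>x\<in>S. fischer (f x) G)"
    "fischer G (sum f S) = (\<Sum>x\<in>S. fischer G (f x))"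
  by (induction S rule: infinite_finite_induct) (simp_all add: fischer_add_left fischer_add_right)

text \<open>In the orthogonal basis of monomials times blades the form is a sum of squared moduli
  with the positive weights \<open>mfact\<close>.\<close>

lemma fischer_eq_0:
  assumes "fischer F F = 0" shows "F = 0"
proof -
  define N where "N a = (\<Sum>B\<in>keys (coeffs a). (cmod (lookup (coeffs a) B))\<^sup>2)" for a
  have N: "scalar_part (cbar a * a) = of_real (N a)" for a
    unfolding scalar_part_cbar_mult N_def of_real_sum complex_norm_square
    by (simp add: mult.commute)
  have N_nonneg: "N a \<ge> 0" for a
    by (simp add: N_def sum_nonneg)
  have N_0: "a = 0" if "N a = 0" for a
  proof -
    have "keys (coeffs a) = {}"
      using that by (auto simp: N_def sum_nonneg_eq_0_iff in_keys_iff intro!: poly_mapping_eqI)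
    then show ?thesis by (metis coeffs_simps(1) coeffs_eqI keys_eq_empty)
  qed
  have "fischer F F = of_real (\<Sum>\<alpha>\<in>keys F. of_nat (mfact \<alpha>) * N (lookup F \<alpha>))"
    by (simp add: fischer_eq N)
  with assms have "(\<Sum>\<alpha>\<in>keys F. of_nat (mfact \<alpha>) * N (lookup F \<alpha>)) = 0"
    by (metis of_real_eq_0_iff)
  then have "\<forall>\<alpha>\<in>keys F. of_nat (mfact \<alpha>) * N (lookup F \<alpha>) = 0"
    by (subst (asm) sum_nonneg_eq_0_iff) (auto simp: N_nonneg)
  then have "\<forall>\<alpha>\<in>keys F. lookup F \<alpha> = 0"
    using N_0 mfact_pos by (metis mult_eq_0_iff of_nat_eq_0_iff less_numeral_extra(3))
  then show ?thesis
    by (metis in_keys_iff keys_eq_empty all_not_in_conv)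
qed

lemma fischer_pconst_mult: "fischer (pconst a * F) G = fischer F (pconst (cbar a) * G)"
proof -
  have "keys (pconst a * F) \<subseteq> keys F"
    by (auto simp: in_keys_iff lookup_pconst_mult)
  then show ?thesis
    using fischer_superset [of "keys F" "pconst a * F" G]
    by (simp add: fischer_eq [of F] lookup_pconst_mult cbar_mult mult.assoc)
qed

text \<open>The weights \<open>mfact\<close> are made for this: raising the exponent of
  \<open>j\<close> by one multiplies the weight by the factor that the derivative produces.\<close>

lemma fischer_pvar_mult: "fischer (pvar j * F) G = fischer F (partial_deriv j G)"
proof (induction F rule: cpoly_induct)
  case (single \<alpha> a)
  have *: "scalar_part (cbar a * (of_nat n * b)) = of_nat n * scalar_part (cbar a * b)" for b n
    by (metis mult.assoc mult_of_nat_commute scalar_part_of_nat_mult)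
  show ?case
    by (simp only: pvar_mult_single fischer_single lookup_partial_deriv mfact_add_single * of_nat_mult)
      (simp only: mult_ac)
qed (simp_all add: distrib_left fischer_add_left)

lemma fischer_vec_var: "fischer (vec_var A * F) G = - fischer F (dirac A G)"
  by (simp add: vec_var_mult dirac_def fischer_sum fischer_pconst_mult fischer_pvar_mult
      cbar_gen pconst_uminus fischer_uminus sum_negf partial_deriv_uminus partial_deriv_pconst_mult)

lemma fischer_dirac: "fischer (dirac A F) G = - fischer F (vec_var A * G)"
  using arg_cong [OF fischer_vec_var [of A G F], of cnj] by (simp add: fischer_cnj)

text \<open>Up to a minus sign \<open>vec_var A\<close> and \<open>dirac A\<close> are adjoint to
  each other. Adjoints reverse products and the two signs cancel, so each of the two products is
  self-adjoint.\<close>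

lemma fischer_shifted_Gamma: "fischer (shifted_Gamma A F) G = fischer F (shifted_Gamma A G)"
  by (simp add: shifted_Gamma_eq fischer_pscale_left fischer_pscale_right fischer_add_left
      fischer_add_right fischer_diff fischer_vec_var fischer_dirac)

section \<open>The Fischer decomposition and the projection onto monogenics\<close>

lemma lookup_euler:
  "finite A \<Longrightarrow> lookup (euler A F) \<alpha> = of_nat (\<Sum>j\<in>A. lookup \<alpha> j) * lookup F \<alpha>"
proof (induction F rule: cpoly_induct)
  case (single \<beta> a)
  have "pvar j * partial_deriv j (single \<beta> a) =
      single \<beta> (of_nat (lookup \<beta> j) * a)" for j
  proof (cases "lookup \<beta> j = 0")
    case False
    then have "single j 1 + (\<beta> - single j 1) = \<beta>"
      by (intro poly_mapping_eqI) (auto simp: lookup_add lookup_minus lookup_single when_def)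
    then show ?thesis by (simp add: partial_deriv_single pvar_mult_single)
  qed (simp add: partial_deriv_single)
  then show ?case
    by (simp add: euler_def lookup_sum lookup_single when_def sum_distrib_right)
qed (simp_all add: euler_add lookup_add distrib_left)

lemma scalar_diff: "scalar (a - b) = scalar a - scalar b"
  using scalar_add [of a "- b"] by (simp add: scalar_uminus)

lemma of_nat_mult_clifford_cancel:
  "of_nat n * a = of_nat k * a \<longleftrightarrow> n = k \<or> a = 0" for a :: clifford
proof -
  have "of_nat n * a = of_nat k * a \<longleftrightarrow> scalar (of_nat n - of_nat k) * a = 0"
    by (simp add: scalar_diff scalar_of_nat left_diff_distrib)
  then show ?thesis by (auto simp: scalar_mult_eq_0_iff)
qed

lemma homogeneous_iff_euler:
  assumes "finite A" "F \<in> polys A"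
  shows "homogeneous k F \<longleftrightarrow> euler A F = pscale (of_nat k) F"
proof -
  have 1: "(\<Sum>j\<in>A. lookup \<alpha> j) = (\<Sum>j\<in>keys \<alpha>. lookup \<alpha> j)" if "\<alpha> \<in> keys F" for \<alpha>
    using that assms by (intro sum.mono_neutral_right) (auto simp: polys_def in_keys_iff)
  have "euler A F = pscale (of_nat k) F \<longleftrightarrow>
      (\<forall>\<alpha>. of_nat (\<Sum>j\<in>A. lookup \<alpha> j) * lookup F \<alpha> = of_nat k * lookup F \<alpha>)"
    by (simp add: poly_mapping_eq_iff fun_eq_iff lookup_euler [OF assms(1)] lookup_pscale scalar_of_nat
        del: of_nat_sum)
  also have "\<dots> \<longleftrightarrow> (\<forall>\<alpha>\<in>keys F. (\<Sum>j\<in>A. lookup \<alpha> j) = k)"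
    unfolding of_nat_mult_clifford_cancel by (auto simp: in_keys_iff)
  also have "\<dots> \<longleftrightarrow> homogeneous k F"
    using 1 by (auto simp: homogeneous_def)
  finally show ?thesis by simp
qed

text \<open>On a monomial the operator is multiplication by twice its degree in \<open>A\<close>
  plus \<open>n\<close>, a positive number.\<close>

lemma euler_positive:
  assumes "finite A" "n > 0" "euler A F + euler A F + pscale (of_nat n) F = 0"
  shows "F = 0"
proof (rule poly_mapping_eqI)
  fix \<alpha>
  have "of_nat ((\<Sum>j\<in>A. lookup \<alpha> j) + (\<Sum>j\<in>A. lookup \<alpha> j) + n) * lookup F \<alpha> = 0"
    using arg_cong [OF assms(3), of "\<lambda>G. lookup G \<alpha>"]
    by (simp add: lookup_add lookup_euler [OF assms(1)] lookup_pscale scalar_of_nat distrib_right)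
  then show "lookup F \<alpha> = lookup 0 \<alpha>"
    using assms(2) by (simp add: of_nat_mult_clifford_eq_0_iff del: of_nat_add)
qed

lemma monogenic_degD:
  assumes "finite A" "G \<in> monogenic_deg A k"
  shows "G \<in> polys A" "dirac A G = 0" "euler A G = pscale (of_nat k) G"
  using assms homogeneous_iff_euler by (auto simp: monogenic_deg_def monogenic_def)

lemma monogenic_degI:
  "finite A \<Longrightarrow> G \<in> polys A \<Longrightarrow> dirac A G = 0 \<Longrightarrow> euler A G = pscale (of_nat k) G \<Longrightarrow>
    G \<in> monogenic_deg A k"
  using homogeneous_iff_euler by (auto simp: monogenic_deg_def monogenic_def)

text \<open>The factor by which \<open>dirac\<close> turns \<open>x^n G\<close> into
  \<open>x^(n-1) G\<close> for a monogenic \<open>G\<close> of degree \<open>k\<close> in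
  \<open>d\<close> variables. The subtraction occurs only for odd \<open>n\<close>, where it is not
  truncated.\<close>

definition fischer_const :: "nat \<Rightarrow> nat \<Rightarrow> nat \<Rightarrow> complex" where
  "fischer_const d k n = - of_nat (if even n then n else n - 1 + 2 * k + d)"

lemma fischer_const_nz: "d > 0 \<Longrightarrow> n > 0 \<Longrightarrow> fischer_const d k n \<noteq> 0"
  by (auto simp: fischer_const_def simp del: of_nat_add)

text \<open>The recursion has step two because \<open>dirac_vec_var_sq\<close> lowers the constant
  by 2 without involving degree or dimension. At \<open>n = 0\<close> the constant vanishes, so the
  truncated exponent \<open>n - 1\<close> is harmless.\<close>

lemma dirac_vec_var_power:
  assumes "finite A" "dirac A G = 0" "euler A G = pscale (of_nat k) G"
  shows "dirac A (vec_var A ^ n * G) = pscale (fischer_const (card A) k n) (vec_var A ^ (n - 1) * G)"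
proof (induction n rule: induct_nat_012)
  case 0
  show ?case using assms by (simp add: fischer_const_def)
next
  case 1
  have "pscale (- of_nat (2 * k + card A)) G = - pscale (of_nat k + of_nat k + of_nat (card A)) G"
    by (simp only: cpoly.scale_minus_left of_nat_add mult_2)
  then have "- (pscale (of_nat k) G + pscale (of_nat k) G + pscale (of_nat (card A)) G) =
      pscale (- of_nat (2 * k + card A)) G"
    by (simp only: cpoly.scale_left_distrib)
  then show ?case using assms by (simp add: dirac_vec_var fischer_const_def)
next
  case (ge2 n)
  let ?x = "vec_var A"
  have "dirac A (?x ^ Suc (Suc n) * G) = dirac A (?x * (?x * (?x ^ n * G)))"
    by (simp add: mult.assoc)
  also have "\<dots> = pscale (fischer_const (card A) k n) (?x * (?x * (?x ^ (n - 1) * G)))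
      - pscale 2 (?x ^ Suc n * G)"
    by (simp add: dirac_vec_var_sq [OF assms(1)] ge2 pscale_mult_right pscale_two mult.assoc)
  also have "pscale (fischer_const (card A) k n) (?x * (?x * (?x ^ (n - 1) * G))) =
      pscale (fischer_const (card A) k n) (?x ^ Suc n * G)"
    by (cases n) (simp_all add: fischer_const_def mult.assoc)
  also have "\<dots> - pscale 2 (?x ^ Suc n * G) = pscale (fischer_const (card A) k n - 2) (?x ^ Suc n * G)"
    by (simp add: cpoly.scale_left_diff_distrib)
  also have "fischer_const (card A) k n - 2 = fischer_const (card A) k (Suc (Suc n))"
    by (cases n) (auto simp: fischer_const_def)
  finally show ?case by simp
qed

lemma euler_vec_var_power:
  assumes "finite A" "euler A G = pscale (of_nat k) G"
  shows "euler A (vec_var A ^ n * G) = pscale (of_nat (n + k)) (vec_var A ^ n * G)"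
  by (induction n) (simp_all add: assms mult.assoc euler_vec_var pscale_mult_right
      cpoly.scale_left_distrib distrib_left)

lemma subspace_image:
  assumes "\<And>F G. T (F + G) = T F + T G" "\<And>z F. T (pscale z F) = pscale z (T F)" "cpoly.subspace W"
  shows "cpoly.subspace (T ` W)"
proof -
  have "T 0 = 0" using assms(1) [of 0 0] by simp
  then show ?thesis
    using assms(3) unfolding cpoly.subspace_def
    by (auto simp: image_iff simp flip: assms(1,2))
qed

lemma subspace_monogenic: "cpoly.subspace (monogenic A)"
  by (rule cpoly.subspaceI)
    (auto simp: monogenic_def dirac_add dirac_pscale intro: polys_add polys_pscale)

section \<open>The Fischer decomposition in a fixed degree\<close>

definition fischer_pieces :: "nat set \<Rightarrow> nat \<Rightarrow> cpoly set" where
  "fischer_pieces A k = {vec_var A ^ s * G | s l G. G \<in> monogenic_deg A l \<and> s + l = k}"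

lemma fischer_pieces_span:
  assumes "finite A" "H \<in> cpoly.span (fischer_pieces A k)"
  shows "H \<in> polys A" "euler A H = pscale (of_nat k) H"
proof -
  have "cpoly.span (fischer_pieces A k) \<subseteq> {H \<in> polys A. euler A H = pscale (of_nat k) H}"
  proof (rule cpoly.span_minimal)
    show "cpoly.subspace {H \<in> polys A. euler A H = pscale (of_nat k) H}"
      by (rule cpoly.subspaceI)
        (auto simp: euler_add euler_pscale cpoly.scale_right_distrib mult.commute
          intro: polys_add polys_pscale)
  next
    show "fischer_pieces A k \<subseteq> {H \<in> polys A. euler A H = pscale (of_nat k) H}"
      using monogenic_degD [OF assms(1)]
      by (auto simp: fischer_pieces_def euler_vec_var_power [OF assms(1)] simp del: of_nat_add
          intro!: polys_mult polys_power polys_vec_var)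
  qed
  then show "H \<in> polys A" "euler A H = pscale (of_nat k) H" using assms(2) by auto
qed

text \<open>One more factor \<open>vec_var A\<close>, divided by the nonzero constant of
  \<open>dirac_vec_var_power\<close>, is an explicit antiderivative of a piece.\<close>

lemma fischer_pieces_antiderivative:
  assumes "finite A" "A \<noteq> {}" "H \<in> cpoly.span (fischer_pieces A k)"
  shows "\<exists>F \<in> cpoly.span (fischer_pieces A (Suc k)). dirac A F = H"
proof -
  have "cpoly.span (fischer_pieces A k) \<subseteq> dirac A ` cpoly.span (fischer_pieces A (Suc k))"
  proof (intro cpoly.span_minimal subsetI subspace_image cpoly.subspace_span dirac_add dirac_pscale)
    fix H assume "H \<in> fischer_pieces A k"
    then obtain s l G where H: "H = vec_var A ^ s * G" "G \<in> monogenic_deg A l" "s + l = k"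
      by (auto simp: fischer_pieces_def)
    define c where "c = fischer_const (card A) l (Suc s)"
    have c: "c \<noteq> 0" using assms(1,2) by (simp add: c_def fischer_const_nz card_gt_0_iff)
    have "vec_var A ^ Suc s * G \<in> fischer_pieces A (Suc k)"
      using H unfolding fischer_pieces_def by (metis (mono_tags, lifting) add_Suc mem_Collect_eq)
    then have "pscale (1 / c) (vec_var A ^ Suc s * G) \<in> cpoly.span (fischer_pieces A (Suc k))"
      by (intro cpoly.span_scale cpoly.span_base)
    moreover have "dirac A (pscale (1 / c) (vec_var A ^ Suc s * G)) = H"
      using c H(1) unfolding dirac_pscale
      by (subst dirac_vec_var_power [OF assms(1) monogenic_degD(2,3) [OF assms(1) H(2)]])
        (simp flip: c_def)
    ultimately show "H \<in> dirac A ` cpoly.span (fischer_pieces A (Suc k))"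
      by blast
  qed
  then show ?thesis using assms(3) by blast
qed

text \<open>The derivative would be homogeneous of degree -1, so \<open>2 E + 2\<close> annihilates
  it, which positivity forbids unless it is 0.\<close>

lemma euler_0_imp_dirac_0:
  assumes "finite A" "euler A F = 0" shows "dirac A F = 0"
proof (rule euler_positive [OF assms(1), of 2])
  have "euler A (dirac A F) = - dirac A F"
    using dirac_euler [OF assms(1), of F] assms(2) by (simp add: eq_neg_iff_add_eq_0 add.commute)
  then show "euler A (dirac A F) + euler A (dirac A F) + pscale (of_nat 2) (dirac A F) = 0"
    by (simp add: pscale_two)
qed simp

text \<open>Induction on the degree: \<open>dirac A F\<close> is covered by the induction hypothesis
  and has an antiderivative in the span; subtracting that from \<open>F\<close> leaves a monogenic
  polynomial, which is itself a piece with \<open>s = 0\<close>.\<close>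

lemma homogeneous_in_span_fischer_pieces:
  assumes "finite A" "A \<noteq> {}"
  shows "F \<in> polys A \<Longrightarrow> euler A F = pscale (of_nat k) F \<Longrightarrow> F \<in> cpoly.span (fischer_pieces A k)"
proof (induction k arbitrary: F)
  case 0
  then have "F \<in> monogenic_deg A 0"
    by (intro monogenic_degI euler_0_imp_dirac_0 assms) auto
  then have "vec_var A ^ 0 * F \<in> fischer_pieces A 0"
    unfolding fischer_pieces_def by blast
  then show ?case by (auto intro: cpoly.span_base)
next
  case (Suc k)
  have "dirac A F + euler A (dirac A F) = dirac A (pscale (of_nat (Suc k)) F)"
    by (metis Suc.prems(2) dirac_euler [OF assms(1)])
  then have "dirac A F + euler A (dirac A F) = pscale (of_nat k) (dirac A F) + dirac A F"
    by (simp only: dirac_pscale dirac_add pscale_of_nat_add)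
  then have "dirac A F \<in> cpoly.span (fischer_pieces A k)"
    using Suc.prems by (intro Suc.IH polys_dirac) (simp_all add: add.commute)
  then obtain F' where F': "F' \<in> cpoly.span (fischer_pieces A (Suc k))" "dirac A F' = dirac A F"
    using fischer_pieces_antiderivative [OF assms] by blast
  have "F - F' \<in> monogenic_deg A (Suc k)"
    using F' Suc.prems fischer_pieces_span [OF assms(1) F'(1)]
    by (intro monogenic_degI assms polys_diff)
      (simp_all add: dirac_diff euler_diff cpoly.scale_right_diff_distrib)
  then have "vec_var A ^ 0 * (F - F') \<in> fischer_pieces A (Suc k)"
    unfolding fischer_pieces_def by (metis (mono_tags, lifting) add_0 mem_Collect_eq)
  then have "F - F' + F' \<in> cpoly.span (fischer_pieces A (Suc k))"
    by (intro cpoly.span_add F') (auto intro: cpoly.span_base)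
  then show ?case by simp
qed

lemma polys_in_span_fischer_pieces:
  assumes "finite A" "A \<noteq> {}" "F \<in> polys A"
  shows "F \<in> cpoly.span {vec_var A ^ s * G | s l G. G \<in> monogenic_deg A l}"
  using assms(3)
proof (induction F rule: polys_induct)
  case (single \<alpha> a)
  let ?F = "single \<alpha> a"
  have "homogeneous (\<Sum>j\<in>keys \<alpha>. lookup \<alpha> j) ?F"
    by (auto simp: homogeneous_def)
  then have "?F \<in> cpoly.span (fischer_pieces A (\<Sum>j\<in>keys \<alpha>. lookup \<alpha> j))"
    using single assms by (intro homogeneous_in_span_fischer_pieces)
      (auto simp: homogeneous_iff_euler polys_single)
  moreover have "fischer_pieces A k \<subseteq> {vec_var A ^ s * G | s l G. G \<in> monogenic_deg A l}" for k
    by (auto simp: fischer_pieces_def)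
  ultimately show ?case
    using cpoly.span_mono by blast
qed (auto intro: cpoly.span_zero cpoly.span_add)

section \<open>Direct sums from spanning and orthogonality\<close>

lemma decomposes_component:
  assumes "\<And>i. cpoly.subspace (W i)" "F \<in> W i"
  shows "decomposes W F (\<lambda>j. if j = i then F else 0)"
  using assms cpoly.subspace_0
  by (auto simp: decomposes_def sum.If_cases intro!: finite_subset [of _ "{i}"])

lemma decomposes_exists:
  assumes W: "\<And>i. cpoly.subspace (W i)" and F: "F \<in> cpoly.span (\<Union>i. W i)"
  shows "\<exists>H. decomposes W F H"
proof -
  have "cpoly.span (\<Union>i. W i) \<subseteq> {F. \<exists>H. decomposes W F H}"
  proof (intro cpoly.span_minimal subsetI)
    show "cpoly.subspace {F. \<exists>H. decomposes W F H}"
    proof (rule cpoly.subspaceI; clarsimp)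
      show "\<exists>H. decomposes W 0 H"
        using W cpoly.subspace_0 by (intro exI [of _ "\<lambda>i. 0"]) (auto simp: decomposes_def)
    next
      fix F G H K assume HK: "decomposes W F H" "decomposes W G K"
      let ?S = "{i. H i \<noteq> 0} \<union> {i. K i \<noteq> 0}"
      have fin: "finite ?S" using HK by (auto simp: decomposes_def)
      have "F = sum H ?S" "G = sum K ?S"
        using HK fin by (auto simp: decomposes_def intro!: sum.mono_neutral_left)
      then have "F + G = (\<Sum>i\<in>?S. H i + K i)" by (simp add: sum.distrib)
      also have "\<dots> = (\<Sum>i | H i + K i \<noteq> 0. H i + K i)"
        using fin by (intro sum.mono_neutral_right) auto
      finally have "F + G = (\<Sum>i | H i + K i \<noteq> 0. H i + K i)" .
      moreover have "finite {i. H i + K i \<noteq> 0}"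
        by (rule finite_subset [OF _ fin]) auto
      ultimately show "\<exists>H. decomposes W (F + G) H"
        using HK W cpoly.subspace_add
        by (intro exI [of _ "\<lambda>i. H i + K i"]) (auto simp: decomposes_def)
    next
      fix z F H assume H: "decomposes W F H"
      show "\<exists>H. decomposes W (pscale z F) H"
      \<comment> \<open>The sum runs over the support of \<open>H\<close>; scaling preserves the
        support except by 0, which empties it.\<close>
      proof (cases "z = 0")
        case True
        then show ?thesis
          using W cpoly.subspace_0 by (intro exI [of _ "\<lambda>i. 0"]) (auto simp: decomposes_def)
      next
        case False
        then show ?thesis
          using H W cpoly.subspace_scale
          by (intro exI [of _ "\<lambda>i. pscale z (H i)"]) (auto simp: decomposes_def cpoly.scale_sum_right)
      qed
    qed
  next
    fix G assume "G \<in> (\<Union>i. W i)"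
    then obtain i where "G \<in> W i" by auto
    from decomposes_component [of W, OF W this] show "G \<in> {F. \<exists>H. decomposes W F H}" by blast
  qed
  then show ?thesis using F by blast
qed

text \<open>The differences of corresponding components sum to 0. Pairing this sum with the
  difference at \<open>i\<close> leaves only the Fischer norm of that difference.\<close>

lemma decomposes_unique:
  assumes W: "\<And>i. cpoly.subspace (W i)"
    and orth: "\<And>i j F G. i \<noteq> j \<Longrightarrow> F \<in> W i \<Longrightarrow> G \<in> W j \<Longrightarrow> fischer F G = 0"
    and HK: "decomposes W F H" "decomposes W F K"
  shows "H = K"
proof
  fix i
  let ?S = "insert i ({i. H i \<noteq> 0} \<union> {i. K i \<noteq> 0})"
  have fin: "finite ?S" using HK by (auto simp: decomposes_def)
  have D: "H j - K j \<in> W j" for j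
    using HK W cpoly.subspace_diff by (auto simp: decomposes_def)
  have "F = sum M ?S" if "decomposes W F M" "M = H \<or> M = K" for M
  proof -
    have "F = (\<Sum>i | M i \<noteq> 0. M i)" using that by (simp add: decomposes_def)
    also have "\<dots> = sum M ?S" using fin that(2) by (intro sum.mono_neutral_left) auto
    finally show ?thesis .
  qed
  then have "F = sum H ?S" "F = sum K ?S" using HK by blast+
  then have "0 = (\<Sum>j\<in>?S. H j - K j)" by (simp only: sum_subtractf diff_self)
  then have "0 = fischer (H i - K i) (\<Sum>j\<in>?S. H j - K j)" by simp
  also have "\<dots> = (\<Sum>j\<in>?S. fischer (H i - K i) (H j - K j))" by (simp only: fischer_sum)
  also have "\<dots> = (\<Sum>j\<in>?S. if j = i then fischer (H i - K i) (H i - K i) else 0)"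
    using orth D by (intro sum.cong refl) (metis D)
  also have "\<dots> = fischer (H i - K i) (H i - K i)"
    using fin by (subst sum.delta) auto
  finally show "H i = K i" using fischer_eq_0 by (metis eq_iff_diff_eq_0)
qed

text \<open>For an inhomogeneous \<open>G\<close> there is no single constant as in
  \<open>dirac_vec_var_power\<close>. The Euler operator takes its place, and since it preserves
  monogenic polynomials it can be hidden in \<open>G'\<close>.\<close>

lemma dirac_vec_var_power_monogenic:
  assumes "finite A"
  shows "G \<in> monogenic A \<Longrightarrow>
    \<exists>G'\<in>monogenic A. dirac A (vec_var A ^ Suc n * G) = vec_var A ^ n * G'"
proof (induction n arbitrary: G rule: induct_nat_012)
  case 0
  have "- (euler A G + euler A G + pscale (of_nat (card A)) G) \<in> polys A"
    using 0 by (intro polys_uminus polys_add polys_pscale polys_euler) (auto simp: monogenic_def)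
  moreover have "dirac A (- (euler A G + euler A G + pscale (of_nat (card A)) G)) = 0"
    using 0 assms by (simp only: dirac_uminus dirac_add dirac_pscale dirac_euler)
      (simp add: monogenic_def)
  ultimately have "- (euler A G + euler A G + pscale (of_nat (card A)) G) \<in> monogenic A"
    by (simp only: monogenic_def mem_Collect_eq)
  with 0 show ?case
    using assms by (auto simp: dirac_vec_var monogenic_def)
next
  case 1
  have "dirac A (vec_var A ^ Suc (Suc 0) * G) = vec_var A ^ Suc 0 * pscale (-2) G"
    using 1 assms dirac_vec_var_sq [OF assms, of G]
    by (simp add: monogenic_def mult.assoc pscale_mult_right flip: pscale_two)
  then show ?case
    using 1 cpoly.subspace_scale [OF subspace_monogenic] by blast
next
  case (ge2 n)
  let ?x = "vec_var A"
  obtain G' where G': "G' \<in> monogenic A" "dirac A (?x ^ Suc n * G) = ?x ^ n * G'"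
    using ge2 by blast
  have "dirac A (?x ^ Suc (Suc (Suc n)) * G) = ?x * (?x * (?x ^ n * G')) - pscale 2 (?x * (?x ^ Suc n * G))"
    using dirac_vec_var_sq [OF assms, of "?x ^ Suc n * G"] G'(2)
    by (simp add: mult.assoc pscale_two)
  also have "\<dots> = ?x ^ Suc (Suc n) * (G' - pscale 2 G)"
    by (simp add: mult.assoc right_diff_distrib pscale_mult_right)
  finally show ?case
    using G'(1) ge2.prems cpoly.subspace_scale [OF subspace_monogenic]
      cpoly.subspace_diff [OF subspace_monogenic] by blast
qed

text \<open>Factors \<open>vec_var A\<close> are moved from the larger power to the other side,
  where each becomes \<open>- dirac A\<close> and lowers the smaller power. Once that power is
  exhausted, the next one meets a monogenic polynomial.\<close>

lemma fischer_vec_var_power_orthogonal: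
  assumes "finite A" "G \<in> monogenic A" "H \<in> monogenic A" "s \<noteq> t"
  shows "fischer (vec_var A ^ s * G) (vec_var A ^ t * H) = 0"
proof -
  have *: "fischer (vec_var A ^ s * G) (vec_var A ^ t * H) = 0"
    if "s < t" "G \<in> monogenic A" "H \<in> monogenic A" for s t G H
    using that
  proof (induction s arbitrary: t G)
    case 0
    then obtain t' where "t = Suc t'" by (cases t) auto
    with 0 show ?case
      using fischer_dirac [of A G "vec_var A ^ t' * H"] by (simp add: monogenic_def mult.assoc)
  next
    case (Suc s)
    then obtain t' where t: "t = Suc t'" by (cases t) auto
    obtain G' where G': "G' \<in> monogenic A" "dirac A (vec_var A ^ Suc s * G) = vec_var A ^ s * G'"
      using dirac_vec_var_power_monogenic [OF assms(1)] Suc by blast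
    show ?case
      using fischer_dirac [of A "vec_var A ^ Suc s * G" "vec_var A ^ t' * H"] G' Suc t
      by (simp add: mult.assoc)
  qed
  show ?thesis
    using * [of s t G H] * [of t s H G] assms
    by (metis complex_cnj_zero fischer_cnj linorder_neqE_nat)
qed

lemma P_M_decomposes:
  assumes "finite I" "I \<noteq> {}" "F \<in> polys I"
  obtains H where "decomposes (\<lambda>s. (\<lambda>G. vec_var I ^ s * G) ` monogenic I) F H" "P_M I F = H 0"
proof -
  let ?W = "\<lambda>s. (\<lambda>G. vec_var I ^ s * G) ` monogenic I"
  have W: "cpoly.subspace (?W s)" for s
    by (intro subspace_image subspace_monogenic distrib_left pscale_mult_right)
  have "{vec_var I ^ s * G | s l G. G \<in> monogenic_deg I l} \<subseteq> (\<Union>s. ?W s)"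
    by (auto simp: monogenic_deg_def)
  then have "F \<in> cpoly.span (\<Union>s. ?W s)"
    using polys_in_span_fischer_pieces [OF assms] cpoly.span_mono by blast
  then obtain H where H: "decomposes ?W F H"
    using decomposes_exists [of ?W] W by blast
  moreover have "K = H" if "decomposes ?W F K" for K
    using decomposes_unique [of ?W, OF W _ that H] fischer_vec_var_power_orthogonal [OF assms(1)]
    by blast
  \<comment> \<open>Existence comes from spanning and uniqueness from orthogonality, so the
    description in \<open>P_M\<close> really denotes.\<close>
  ultimately have "(THE H. decomposes ?W F H) = H"
    by blast
  with H show ?thesis using that by (simp add: P_M_def)
qed

lemma
  assumes "finite I" "I \<noteq> {}" "F \<in> polys I"
  shows P_M_monogenic: "P_M I F \<in> monogenic I"
    and P_M_diff: "\<exists>K\<in>polys I. F = P_M I F + vec_var I * K"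
proof -
  obtain H where H: "decomposes (\<lambda>s. (\<lambda>G. vec_var I ^ s * G) ` monogenic I) F H" "P_M I F = H 0"
    by (rule P_M_decomposes [OF assms])
  have "\<forall>s. \<exists>G\<in>monogenic I. H s = vec_var I ^ s * G"
    using H(1) by (auto simp: decomposes_def)
  then obtain G where G: "\<And>s. G s \<in> monogenic I" "\<And>s. H s = vec_var I ^ s * G s" by metis
  show "P_M I F \<in> monogenic I" using G [of 0] H(2) by simp
  let ?S = "{s. H s \<noteq> 0}"
  let ?K = "\<Sum>s\<in>?S - {0}. vec_var I ^ (s - 1) * G s"
  have fin: "finite ?S" using H by (auto simp: decomposes_def)
  have "F = (\<Sum>s\<in>insert 0 ?S. H s)"
    using H fin by (auto simp: decomposes_def intro!: sum.mono_neutral_left)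
  also have "\<dots> = P_M I F + (\<Sum>s\<in>?S - {0}. H s)"
    using fin H(2) by (simp add: sum.insert_remove)
  also have "(\<Sum>s\<in>?S - {0}. H s) = vec_var I * ?K"
    unfolding sum_distrib_left
  proof (intro sum.cong refl)
    fix s assume "s \<in> ?S - {0}"
    then have "s = Suc (s - 1)" by simp
    then show "H s = vec_var I * (vec_var I ^ (s - 1) * G s)"
      by (metis G(2) mult.assoc power_Suc)
  qed
  finally have "F = P_M I F + vec_var I * ?K" .
  moreover have "?K \<in> polys I"
    using G by (intro polys_sum polys_mult polys_power polys_vec_var) (auto simp: monogenic_def)
  ultimately show "\<exists>K\<in>polys I. F = P_M I F + vec_var I * K" by blast
qed

text \<open>Monogenic polynomials are orthogonal to multiples of \<open>vec_var I\<close>, so the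
  two parts of the splitting are unique. This characterisation replaces the whole decomposition in
  the sequel.\<close>

lemma P_M_eqI:
  assumes "finite I" "I \<noteq> {}" "F \<in> polys I" "G \<in> monogenic I" "K \<in> polys I" "F = G + vec_var I * K"
  shows "P_M I F = G"
proof -
  obtain K' where K': "K' \<in> polys I" "F = P_M I F + vec_var I * K'"
    using P_M_diff assms by blast
  define D where "D = P_M I F - G"
  have D: "D \<in> monogenic I"
    unfolding D_def using P_M_monogenic assms cpoly.subspace_diff [OF subspace_monogenic] by blast
  have "D = vec_var I * (K - K')"
  proof -
    have "D = (P_M I F + vec_var I * K') - vec_var I * K' - G"
      by (simp add: D_def)
    also have "\<dots> = (G + vec_var I * K) - vec_var I * K' - G"
      by (simp only: K'(2) [symmetric] assms(6) [symmetric])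
    finally show ?thesis by (simp add: right_diff_distrib)
  qed
  then have "fischer D D = - fischer (K - K') (dirac I D)"
    by (metis fischer_vec_var)
  then have "D = 0" using D by (intro fischer_eq_0) (simp add: monogenic_def)
  then show ?thesis by (simp add: D_def)
qed

lemma P_M_add:
  assumes "finite I" "I \<noteq> {}" "F \<in> polys I" "G \<in> polys I"
  shows "P_M I (F + G) = P_M I F + P_M I G"
proof -
  obtain K where K: "K \<in> polys I" "F = P_M I F + vec_var I * K"
    using P_M_diff assms by blast
  obtain K' where K': "K' \<in> polys I" "G = P_M I G + vec_var I * K'"
    using P_M_diff assms by blast
  have "F + G = (P_M I F + P_M I G) + vec_var I * (K + K')"
    by (subst K(2), subst K'(2)) (simp add: distrib_left add_ac)
  then show ?thesis
    using assms K(1) K'(1) P_M_monogenic cpoly.subspace_add [OF subspace_monogenic]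
    by (intro P_M_eqI [where K = "K + K'"] polys_add) auto
qed

lemma P_M_pscale:
  assumes "finite I" "I \<noteq> {}" "F \<in> polys I"
  shows "P_M I (pscale z F) = pscale z (P_M I F)"
proof -
  obtain K where K: "K \<in> polys I" "F = P_M I F + vec_var I * K"
    using P_M_diff assms by blast
  have "pscale z F = pscale z (P_M I F) + vec_var I * (pscale z K)"
    by (subst K(2)) (simp add: cpoly.scale_right_distrib pscale_mult_right)
  then show ?thesis
    using assms K(1) P_M_monogenic cpoly.subspace_scale [OF subspace_monogenic]
    by (intro P_M_eqI [where K = "pscale z K"] polys_pscale) auto
qed

lemma P_M_vec_var:
  assumes "finite I" "I \<noteq> {}" "F \<in> polys I"
  shows "P_M I (vec_var I * F) = 0"
  using assms cpoly.subspace_0 [OF subspace_monogenic]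
  by (intro P_M_eqI [where K = F] polys_mult polys_vec_var) auto

lemma P_M_id: "finite I \<Longrightarrow> I \<noteq> {} \<Longrightarrow> F \<in> monogenic I \<Longrightarrow> P_M I F = F"
  by (rule P_M_eqI [where K = 0]) (auto simp: monogenic_def)

text \<open>Such a \<open>T\<close> preserves the monogenic polynomials as well as the multiples of
  \<open>vec_var I\<close>, hence the splitting that characterises \<open>P_M\<close>.\<close>

lemma P_M_intertwine:
  assumes "finite I" "I \<noteq> {}" "F \<in> polys I"
    and T: "\<And>F G. T (F + G) = T F + T G" "\<And>F. F \<in> polys I \<Longrightarrow> T F \<in> polys I"
    and T': "\<And>F. F \<in> polys I \<Longrightarrow> T (vec_var I * F) = pscale a (vec_var I * T F)"
       "\<And>F. F \<in> polys I \<Longrightarrow> dirac I (T F) = pscale b (T (dirac I F))"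
  shows "T (P_M I F) = P_M I (T F)"
proof -
  obtain K where K: "K \<in> polys I" "F = P_M I F + vec_var I * K"
    using P_M_diff [OF assms(1-3)] by blast
  have M: "P_M I F \<in> polys I" "dirac I (P_M I F) = 0"
    using P_M_monogenic [OF assms(1-3)] by (auto simp: monogenic_def)
  have "T F = T (P_M I F) + vec_var I * pscale a (T K)"
    by (subst K(2)) (simp only: T(1) T'(1) [OF K(1)] pscale_mult_right)
  moreover have "T 0 = 0" using T(1) [of 0 0] by simp
  then have "T (P_M I F) \<in> monogenic I"
    using T(2) [OF M(1)] T'(2) [OF M(1)] by (simp add: monogenic_def M)
  ultimately have "P_M I (T F) = T (P_M I F)"
    using T(2) [OF assms(3)] T(2) [OF K(1)]
    by (intro P_M_eqI [OF assms(1,2), where K = "pscale a (T K)"] polys_pscale)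
  then show ?thesis by simp
qed

section \<open>Products over disjoint blocks of variables\<close>

lemma dirac_funpow_add: "(dirac A ^^ n) (F + G) = (dirac A ^^ n) F + (dirac A ^^ n) G"
  by (induction n) (simp_all add: dirac_add)

lemma dirac_funpow_pscale: "(dirac A ^^ n) (pscale z F) = pscale z ((dirac A ^^ n) F)"
  by (induction n) (simp_all add: dirac_pscale)

lemma dirac_funpow_diff: "(dirac A ^^ n) (F - G) = (dirac A ^^ n) F - (dirac A ^^ n) G"
  by (induction n) (simp_all add: dirac_diff)

lemma dirac_funpow_zero [simp]: "(dirac A ^^ n) 0 = 0"
  by (induction n) simp_all

lemma dirac_funpow_homogeneous:
  assumes "finite A"
  shows "euler A F = pscale (of_nat n) F \<Longrightarrow> (dirac A ^^ Suc n) F = 0"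
proof (induction n arbitrary: F)
  case 0
  then show ?case using euler_0_imp_dirac_0 [OF assms] by simp
next
  case (Suc n)
  have "dirac A F + euler A (dirac A F) = dirac A (pscale (of_nat (Suc n)) F)"
    by (metis Suc.prems dirac_euler [OF assms])
  then have "euler A (dirac A F) = pscale (of_nat n) (dirac A F)"
    by (simp only: dirac_pscale dirac_add pscale_of_nat_add) (simp add: add.commute)
  from Suc.IH [OF this] show ?case
    by (simp only: funpow_Suc_right o_apply)
qed

lemma dirac_nilpotent:
  assumes "finite A" shows "\<exists>N. (dirac A ^^ N) F = 0"
proof (induction F rule: cpoly_induct)
  case (single \<alpha> a)
  have "euler A (single \<alpha> a) =
      pscale (of_nat (\<Sum>j\<in>A. lookup \<alpha> j)) (single \<alpha> a)"
    by (rule poly_mapping_eqI)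
      (simp add: lookup_euler [OF assms] lookup_pscale scalar_of_nat lookup_single when_def del: of_nat_sum)
  then show ?case using dirac_funpow_homogeneous [OF assms] by blast
next
  case (add F G)
  then obtain M N where "(dirac A ^^ M) F = 0" "(dirac A ^^ N) G = 0" by blast
  then have "(dirac A ^^ (N + M)) (F + G) = 0"
    unfolding dirac_funpow_add by (subst (2) add.commute) (simp add: funpow_add)
  then show ?case by blast
qed auto

text \<open>The square of \<open>dirac A\<close> commutes with \<open>vec_var A\<close> up to
  \<open>- 2 * dirac A\<close>, so even powers give one lower-order correction each and no Euler
  operator.\<close>

lemma dirac_funpow_vec_var:
  assumes "finite A"
  shows "(dirac A ^^ (2 * n)) (vec_var A * F) =
    vec_var A * (dirac A ^^ (2 * n)) F - pscale (of_nat (2 * n)) ((dirac A ^^ (2 * n - 1)) F)"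
proof (induction n arbitrary: F)
  case (Suc n)
  have "(dirac A ^^ (2 * Suc n)) (vec_var A * F) = (dirac A ^^ (2 * n)) (dirac A (dirac A (vec_var A * F)))"
    by (simp add: funpow_swap1)
  also have "\<dots> = (dirac A ^^ (2 * n)) (vec_var A * dirac A (dirac A F)) - pscale 2 ((dirac A ^^ (2 * n)) (dirac A F))"
    by (simp add: vec_var_dirac_sq [OF assms] dirac_funpow_diff dirac_funpow_pscale flip: pscale_two)
  also have "(dirac A ^^ (2 * n)) (vec_var A * dirac A (dirac A F)) = vec_var A * (dirac A ^^ (2 * n)) (dirac A (dirac A F))
      - pscale (of_nat (2 * n)) ((dirac A ^^ (2 * n)) (dirac A F))"
  \<comment> \<open>At \<open>n = 0\<close> the exponent \<open>2 * n - 1\<close> is truncated, but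
    its coefficient vanishes.\<close>
  proof (cases n)
    case (Suc k)
    then have "(dirac A ^^ (2 * n - 1)) (dirac A (dirac A F)) = (dirac A ^^ (2 * n)) (dirac A F)"
      by (simp add: funpow_swap1)
    then show ?thesis by (simp only: Suc.IH)
  qed simp
  also have "vec_var A * (dirac A ^^ (2 * n)) (dirac A (dirac A F)) = vec_var A * (dirac A ^^ (2 * Suc n)) F"
    by (simp add: funpow_swap1)
  also have "(dirac A ^^ (2 * n)) (dirac A F) = (dirac A ^^ (2 * Suc n - 1)) F"
    by (simp add: funpow_swap1)
  finally show ?case
    by (simp add: cpoly.scale_left_distrib)
qed simp

lemma dirac_funpow_vec_var_disjoint:
  assumes "A \<inter> B = {}"
  shows "(dirac B ^^ n) (vec_var A * F) = pscale ((-1) ^ n) (vec_var A * (dirac B ^^ n) F)"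
proof -
  have "B \<inter> A = {}" using assms by auto
  then show ?thesis
    by (induction n) (simp_all add: dirac_pscale dirac_vec_var_disjoint cpoly.scale_minus_left)
qed

text \<open>With \<open>N\<close> minimal such that \<open>\<partial>\<^sub>v\<^sup>N H = 0\<close>, the equation \<open>\<partial>\<^sub>v\<^sup>N (x H) = 0\<close> reduces to
  \<open>\<partial>\<^sub>v\<^sup>N (v H) = 0\<close>, and commuting \<open>v\<close> past \<open>\<partial>\<^sub>v\<^sup>N\<close> forces \<open>\<partial>\<^sub>v\<^sup>N\<^sup>-\<^sup>1 H = 0\<close>.\<close>

lemma vec_var_mult_in_kernel:
  assumes fin: "finite A" "finite B" "A \<inter> B = {}" "B \<noteq> {}"
    and ker: "dirac B (vec_var (A \<union> B) * H) = 0"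
  shows "H = 0"
proof (rule ccontr)
  assume "H \<noteq> 0"
  define N where "N = (LEAST N. (dirac B ^^ N) H = 0)"
  have N: "(dirac B ^^ N) H = 0"
    unfolding N_def using dirac_nilpotent [OF fin(2)] by (rule LeastI_ex)
  with \<open>H \<noteq> 0\<close> obtain n where n: "N = Suc n" by (cases N) auto
  define W where "W = (dirac B ^^ n) H"
  have W0: "W \<noteq> 0"
    using not_less_Least [of n "\<lambda>N. (dirac B ^^ N) H = 0"] n by (auto simp: W_def N_def)
  have DW: "dirac B W = 0" using N n by (simp add: W_def)
  have "(dirac B ^^ N) (vec_var (A \<union> B) * H) = 0"
    using ker n by (simp only: funpow_Suc_right o_apply dirac_funpow_zero)
  \<comment> \<open>The summand with \<open>vec_var A\<close> drops out: the powers of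
    \<open>dirac B\<close> pass it up to sign and annihilate \<open>H\<close>.\<close>
  then have 0: "(dirac B ^^ N) (vec_var B * H) = 0"
    using N by (simp add: vec_var_union fin distrib_right dirac_funpow_add dirac_funpow_vec_var_disjoint)
  show False
  \<comment> \<open>For even \<open>N\<close> the correction term is a nonzero multiple of
    \<open>W\<close>. For odd \<open>N\<close> one more anticommutator gives
    \<open>2 E + card B + (N - 1)\<close> applied to \<open>W\<close>, up to sign, and positivity
    applies.\<close>
  proof (cases "even N")
    case True
    then obtain k where k: "N = 2 * k" by blast
    have "2 * k - 1 = n" using k n by simp
    then have "(dirac B ^^ (2 * k - 1)) H = W" by (simp only: W_def)
    then have "pscale (of_nat (2 * k)) W = 0"
      using 0 N dirac_funpow_vec_var [OF fin(2), of k H] unfolding k by simp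
    then show False using W0 k n by simp
  next
    case False
    then obtain k where k: "N = Suc (2 * k)" by (metis oddE Suc_eq_plus1)
    then have nk: "n = 2 * k" using n by simp
    have "(dirac B ^^ N) (vec_var B * H) =
        dirac B (vec_var B * W - pscale (of_nat (2 * k)) ((dirac B ^^ (2 * k - 1)) H))"
      unfolding W_def nk k using dirac_funpow_vec_var [OF fin(2), of k H] by simp
    also have "\<dots> = dirac B (vec_var B * W) - pscale (of_nat (2 * k)) W"
    proof (cases k)
      case (Suc j)
      then have "dirac B ((dirac B ^^ (2 * k - 1)) H) = W" by (simp add: W_def nk)
      then show ?thesis by (simp add: dirac_diff dirac_pscale)
    qed (simp add: dirac_diff)
    also have "\<dots> = - (euler B W + euler B W + pscale (of_nat (card B + 2 * k)) W)"
      using DW by (simp add: dirac_vec_var [OF fin(2)] cpoly.scale_left_distrib)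
    finally have "euler B W + euler B W + pscale (of_nat (card B + 2 * k)) W = 0"
      using 0 by (metis neg_equal_0_iff_equal)
    moreover have "card B + 2 * k > 0" using fin by (simp add: card_gt_0_iff)
    ultimately have "W = 0" by (rule euler_positive [OF fin(2), rotated])
    with W0 show False ..
  qed
qed

text \<open>If the projection vanished, \<open>F\<close> would be a multiple of \<open>x\<close> in
  the kernel of \<open>dirac B\<close>.\<close>

lemma P_M_nonzero:
  assumes "finite A" "finite B" "A \<inter> B = {}" "B \<noteq> {}" "F \<in> polys (A \<union> B)" "dirac B F = 0" "F \<noteq> 0"
  shows "P_M (A \<union> B) F \<noteq> 0"
proof
  assume "P_M (A \<union> B) F = 0"
  then obtain K where "F = vec_var (A \<union> B) * K"
    using P_M_diff [of "A \<union> B" F] assms by auto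
  then show False using vec_var_mult_in_kernel [OF assms(1-4), of K] assms(6,7) by auto
qed

section \<open>Products of elements over disjoint index sets\<close>

lemma lookup_coeffs_mult_disjoint:
  assumes "a \<in> Cl A" "b \<in> Cl B" "A \<inter> B = {}" "fset S \<subseteq> A" "fset T \<subseteq> B"
  shows "lookup (coeffs (a * b)) (S |\<union>| T) = blade_sign S T * lookup (coeffs a) S * lookup (coeffs b) T"
  using assms(1)
proof (induction a rule: Cl_induct)
  case (blade z S')
  from assms(2) show ?case
  proof (induction b rule: Cl_induct)
    case (blade w T')
    have "symdiff S' T' = S' |\<union>| T'"
      using blade \<open>fset S' \<subseteq> A\<close> assms(3) by (auto simp: symdiff_def)
    moreover have "S' |\<union>| T' = S |\<union>| T \<longleftrightarrow> S' = S \<and> T' = T"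
    proof
      assume *: "S' |\<union>| T' = S |\<union>| T"
      have "fset S' = fset (S' |\<union>| T') \<inter> A" "fset S = fset (S |\<union>| T) \<inter> A"
        "fset T' = fset (S' |\<union>| T') \<inter> B" "fset T = fset (S |\<union>| T) \<inter> B"
        using blade \<open>fset S' \<subseteq> A\<close> assms by auto
      then show "S' = S \<and> T' = T" using * by (metis fset_inject)
    qed simp
    ultimately show ?case
      by (auto simp: scalar_blade_mult coeffs_scalar_blade lookup_single when_def)
  qed (simp_all add: lookup_add algebra_simps)
qed (simp_all add: lookup_add algebra_simps)

lemma lookup_mult_disjoint:
  assumes "F \<in> polys A" "G \<in> polys B" "A \<inter> B = {}" "keys \<alpha> \<subseteq> A" "keys \<beta> \<subseteq> B"
  shows "lookup (F * G) (\<alpha> + \<beta>) = lookup F \<alpha> * lookup G \<beta>"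
  using assms(1)
proof (induction F rule: polys_induct)
  case (single \<alpha>' a)
  from assms(2) show ?case
  proof (induction G rule: polys_induct)
    case (single \<beta>' b)
    have "\<alpha>' + \<beta>' = \<alpha> + \<beta> \<longleftrightarrow> \<alpha>' = \<alpha> \<and> \<beta>' = \<beta>"
    proof
      assume *: "\<alpha>' + \<beta>' = \<alpha> + \<beta>"
      have "lookup \<alpha>' j = lookup \<alpha> j \<and> lookup \<beta>' j = lookup \<beta> j" for j
      proof -
        have "lookup \<alpha>' j + lookup \<beta>' j = lookup \<alpha> j + lookup \<beta> j"
          using * by (metis lookup_add)
        moreover have "j \<notin> A \<Longrightarrow> lookup \<alpha>' j = 0 \<and> lookup \<alpha> j = 0"
            "j \<notin> B \<Longrightarrow> lookup \<beta>' j = 0 \<and> lookup \<beta> j = 0"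
          using single \<open>keys \<alpha>' \<subseteq> A\<close> assms(4,5) by (auto simp: in_keys_iff subset_iff)
        moreover have "j \<notin> A \<or> j \<notin> B" using assms(3) by auto
        ultimately show ?thesis by auto
      qed
      then show "\<alpha>' = \<alpha> \<and> \<beta>' = \<beta>" by (auto intro: poly_mapping_eqI)
    qed simp
    then show ?case by (auto simp: mult_single lookup_single when_def)
  qed (simp_all add: distrib_left lookup_add)
qed (simp_all add: distrib_right lookup_add)

text \<open>The Clifford algebra has zero divisors, but factors over disjoint sets of generators and
  variables multiply like a tensor product: a coefficient of the product is, up to sign, the product
  of two coefficients.\<close>

lemma mult_disjoint_nonzero:
  assumes "F \<in> polys A" "G \<in> polys B" "A \<inter> B = {}" "F \<noteq> 0" "G \<noteq> 0"
  shows "F * G \<noteq> 0"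
proof
  assume FG: "F * G = 0"
  obtain \<alpha> \<beta> where \<alpha>\<beta>: "\<alpha> \<in> keys F" "\<beta> \<in> keys G"
    using assms(4,5) by (metis all_not_in_conv keys_eq_empty)
  let ?a = "lookup F \<alpha>" and ?b = "lookup G \<beta>"
  have 1: "?a \<in> Cl A" "?b \<in> Cl B" "keys \<alpha> \<subseteq> A" "keys \<beta> \<subseteq> B"
    using assms \<alpha>\<beta> by (auto simp: polys_def)
  have "coeffs ?a \<noteq> 0" "coeffs ?b \<noteq> 0"
    using \<alpha>\<beta> coeffs_eqI [of _ 0] by (auto simp: in_keys_iff)
  then obtain S T where ST: "S \<in> keys (coeffs ?a)" "T \<in> keys (coeffs ?b)"
    by (metis all_not_in_conv keys_eq_empty)
  have "?a * ?b = 0"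
    using lookup_mult_disjoint [OF assms(1-3) 1(3,4)] FG by simp
  moreover have "fset S \<subseteq> A" "fset T \<subseteq> B"
    using ST 1(1,2) by (auto simp: Cl_def)
  ultimately have "blade_sign S T * lookup (coeffs ?a) S * lookup (coeffs ?b) T = 0"
    using lookup_coeffs_mult_disjoint [OF 1(1,2) assms(3)] by (metis coeffs_simps(1) lookup_zero)
  moreover have "blade_sign S T \<noteq> 0" using blade_sign_sq [of S T] by auto
  ultimately show False using ST by (simp add: in_keys_iff)
qed

text \<open>The index \<open>0\<close> is outside \<open>{1..m}\<close>, so conjugation by the spare generator \<open>e\<^sub>0\<close> is the
  main involution on the polynomials in use.\<close>

definition main_inv :: "cpoly \<Rightarrow> cpoly" where
  "main_inv F = - (pconst (gen 0) * F * pconst (gen 0))"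

lemma main_inv_add: "main_inv (F + G) = main_inv F + main_inv G"
  by (simp add: main_inv_def algebra_simps)

lemma main_inv_main_inv [simp]: "main_inv (main_inv F) = F"
proof -
  have "main_inv (main_inv F) = pconst (gen 0 * gen 0) * F * pconst (gen 0 * gen 0)"
    by (simp only: main_inv_def pconst_mult mult.assoc mult_minus_left mult_minus_right minus_minus)
  then show ?thesis by (simp add: pconst_uminus)
qed

lemma main_inv_blade:
  assumes "0 \<notin> fset B"
  shows "- (gen 0 * blade B * gen 0) = scalar ((-1) ^ card (fset B)) * blade B"
  using assms
  by (simp add: mult.assoc blade_gen scalar_left_commute [of "gen 0"] mult_minus_right)

text \<open>All generators outside \<open>A\<close> pass a blade over \<open>A\<close> with the same
  sign, given by its number of factors, so \<open>gen 0\<close> can represent them all.\<close>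

lemma gen_mult_Cl:
  assumes "a \<in> Cl A" "0 \<notin> A" "j \<notin> A"
  shows "gen j * a = - (gen 0 * a * gen 0) * gen j"
  using assms(1)
proof (induction a rule: Cl_induct)
  case (blade z B)
  have B: "0 \<notin> fset B" "j \<notin> fset B" using blade assms by auto
  have "- (gen 0 * blade B * gen 0) * gen j = scalar ((-1) ^ card (fset B)) * (blade B * gen j)"
    unfolding main_inv_blade [OF B(1)] by (rule mult.assoc)
  also have "\<dots> = scalar ((-1) ^ card (fset B) * (-1) ^ card (fset B)) * (gen j * blade B)"
    using B(2) by (simp add: blade_gen scalar_scalar_mult)
  also have "(-1) ^ card (fset B) * (-1) ^ card (fset B) = (1 :: complex)"
    by (simp flip: power_mult_distrib)
  finally have *: "gen j * blade B = - (gen 0 * blade B * gen 0) * gen j"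
    by (simp add: scalar_one)
  have "gen j * (scalar z * blade B) = scalar z * (gen j * blade B)"
    by (rule scalar_left_commute)
  also have "\<dots> = - (gen 0 * (scalar z * blade B) * gen 0) * gen j"
    unfolding * by (simp add: mult.assoc scalar_left_commute [of "gen 0"])
  finally show ?case .
qed (simp_all add: algebra_simps)

lemma gen_mult_polys:
  assumes "F \<in> polys A" "0 \<notin> A" "j \<notin> A"
  shows "pconst (gen j) * F = main_inv F * pconst (gen j)"
  using assms(1)
proof (induction F rule: polys_induct)
  case (single \<alpha> a)
  then show ?case
    using gen_mult_Cl [OF single(2) assms(2,3)]
    by (simp add: main_inv_def pconst_def mult_single flip: single_uminus)
qed (simp_all add: main_inv_add algebra_simps, simp add: main_inv_def)

lemma main_inv_polys:
  assumes "F \<in> polys A" "0 \<notin> A" shows "main_inv F \<in> polys A"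
  using assms(1)
proof (induction F rule: polys_induct)
  case zero
  show ?case by (simp add: main_inv_def)
next
  case (single \<alpha> a)
  from single(2) have "- (gen 0 * a * gen 0) \<in> Cl A"
  proof (induction a rule: Cl_induct)
    case (blade z B)
    then have "0 \<notin> fset B" using assms by auto
    then have "- (gen 0 * (scalar z * blade B) * gen 0) = scalar z * (scalar ((-1) ^ card (fset B)) * blade B)"
      by (simp add: mult.assoc scalar_left_commute [of "gen 0"] flip: main_inv_blade)
    moreover have "scalar z * (scalar ((-1) ^ card (fset B)) * blade B) \<in> Cl A"
      using blade by (intro Cl_mult Cl_scalar Cl_blade)
    ultimately show ?case by simp
  next
    case (add a b)
    then show ?case using Cl_add by (fastforce simp: algebra_simps)
  qed simp
  then show ?case
    using single by (simp add: main_inv_def pconst_def mult_single polys_single flip: single_uminus)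
qed (simp_all add: main_inv_add polys_add)

lemma dirac_mult_pconst: "dirac A (F * pconst a) = dirac A F * pconst a"
  by (simp add: dirac_def partial_deriv_mult_pconst sum_distrib_right mult.assoc)

lemma euler_pconst_mult: "euler A (pconst a * F) = pconst a * euler A F"
  by (simp add: euler_def partial_deriv_pconst_mult sum_distrib_left pvar_simps)

lemma euler_mult_pconst: "euler A (F * pconst a) = euler A F * pconst a"
  by (simp add: euler_def partial_deriv_mult_pconst sum_distrib_right mult.assoc)

lemma main_inv_monogenic_deg:
  assumes "finite A" "0 \<notin> A" "F \<in> monogenic_deg A k"
  shows "main_inv F \<in> monogenic_deg A k"
proof (rule monogenic_degI [OF assms(1)])
  note F = monogenic_degD [OF assms(1,3)]
  show "main_inv F \<in> polys A" using F assms by (intro main_inv_polys)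
  have "gen 0 * gen j = scalar (-1) * (gen j * gen 0)" if "j \<in> A" for j
    using that assms(2) gen_anti [of 0 j] by (auto simp: scalar_uminus scalar_one)
  from pconst_dirac [OF this, where A = A and F = F] have "dirac A (pconst (gen 0) * F) = 0"
    using F by (simp add: cpoly.scale_minus_left)
  then show "dirac A (main_inv F) = 0"
    by (simp add: main_inv_def dirac_uminus dirac_mult_pconst)
  show "euler A (main_inv F) = pscale (of_nat k) (main_inv F)"
    by (simp add: main_inv_def euler_uminus euler_mult_pconst euler_pconst_mult F pscale_mult_right
        pscale_mult_left)
qed

section \<open>Dirac operator, Euler operator and vector variable on products over two
  blocks\<close>

context
  fixes A B :: "nat set"
  assumes disj: "A \<inter> B = {}" and nz: "0 \<notin> A"
begin

lemma dirac_left_mult: "G \<in> polys B \<Longrightarrow> dirac A (F * G) = dirac A F * G"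
proof -
  assume G: "G \<in> polys B"
  have "partial_deriv j G = 0" if "j \<in> A" for j
    using that disj by (intro partial_deriv_outside [OF G]) auto
  then show ?thesis
    by (simp add: dirac_def partial_deriv_mult sum_distrib_right mult.assoc)
qed

lemma euler_left_mult: "G \<in> polys B \<Longrightarrow> euler A (F * G) = euler A F * G"
proof -
  assume G: "G \<in> polys B"
  have "partial_deriv j G = 0" if "j \<in> A" for j
    using that disj by (intro partial_deriv_outside [OF G]) auto
  then show ?thesis
    by (simp add: euler_def partial_deriv_mult sum_distrib_right mult.assoc)
qed

lemma dirac_right_mult: "F \<in> polys A \<Longrightarrow> dirac B (F * G) = main_inv F * dirac B G"
proof -
  assume F: "F \<in> polys A"
  have "pconst (gen j) * partial_deriv j (F * G) = main_inv F * (pconst (gen j) * partial_deriv j G)"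
    if "j \<in> B" for j
  proof -
    have j: "j \<notin> A" using that disj by auto
    then have "pconst (gen j) * partial_deriv j (F * G) = pconst (gen j) * F * partial_deriv j G"
      using partial_deriv_outside [OF F j] by (simp add: partial_deriv_mult mult.assoc)
    then show ?thesis
      by (simp add: gen_mult_polys [OF F nz j] mult.assoc)
  qed
  then show ?thesis by (simp add: dirac_def sum_distrib_left)
qed

lemma euler_right_mult: "F \<in> polys A \<Longrightarrow> euler B (F * G) = F * euler B G"
proof -
  assume F: "F \<in> polys A"
  have "partial_deriv j F = 0" if "j \<in> B" for j
    using that disj by (intro partial_deriv_outside [OF F]) auto
  then show ?thesis
    by (simp add: euler_def partial_deriv_mult sum_distrib_left pvar_left_commute [of F])
qed

lemma mult_vec_var: "F \<in> polys A \<Longrightarrow> F * (vec_var B * G) = vec_var B * (main_inv F * G)"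
proof -
  assume F: "F \<in> polys A"
  have "F * (pconst (gen j) * (pvar j * G)) = pconst (gen j) * (pvar j * (main_inv F * G))"
    if "j \<in> B" for j
  proof -
    have j: "j \<notin> A" using that disj by auto
    have "pconst (gen j) * main_inv F = F * pconst (gen j)"
      using gen_mult_polys [OF main_inv_polys [OF F nz] nz j] by simp
    then have "F * (pconst (gen j) * (pvar j * G)) = pconst (gen j) * (main_inv F * (pvar j * G))"
      by (simp flip: mult.assoc)
    then show ?thesis by (simp only: pvar_left_commute [of "main_inv F"])
  qed
  then show ?thesis by (simp add: vec_var_mult sum_distrib_left)
qed

text \<open>Each factor \<open>vec_var B\<close> applies the main involution to \<open>F\<close>
  once. Only that the result is again monogenic of degree \<open>k\<close> matters, so its form is
  left existential.\<close>

lemma mult_vec_var_power: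
  assumes "finite A" "F \<in> monogenic_deg A k"
  shows "\<exists>F'\<in>monogenic_deg A k. F * (vec_var B ^ n * G) = vec_var B ^ n * (F' * G)"
  using assms(2)
proof (induction n arbitrary: F)
  case 0
  then show ?case by auto
next
  case (Suc n)
  have "F * (vec_var B ^ Suc n * G) = vec_var B * (main_inv F * (vec_var B ^ n * G))"
    using mult_vec_var [OF monogenic_degD(1) [OF assms(1) Suc.prems]] by (simp add: mult.assoc)
  moreover obtain F' where "F' \<in> monogenic_deg A k"
      "main_inv F * (vec_var B ^ n * G) = vec_var B ^ n * (F' * G)"
    using Suc.IH main_inv_monogenic_deg [OF assms(1) nz Suc.prems] by blast
  ultimately show ?case by (auto simp: mult.assoc)
qed

end

section \<open>Splitting a polynomial along the two blocks\<close>

lemma Cl_split: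
  assumes "a \<in> Cl (A \<union> B)" "A \<inter> B = {}"
  shows "pconst a \<in> cpoly.span {F * G | F G. F \<in> polys A \<and> G \<in> polys B}"
  using assms(1)
proof (induction a rule: Cl_induct)
  case (blade z S)
  define S1 where "S1 = ffilter (\<lambda>j. j \<in> A) S"
  define S2 where "S2 = ffilter (\<lambda>j. j \<in> B) S"
  have S: "symdiff S1 S2 = S" "fset S1 \<subseteq> A" "fset S2 \<subseteq> B"
    using blade assms(2) by (auto simp: S1_def S2_def symdiff_def)
  have "scalar z * blade S = scalar (z * blade_sign S1 S2) * (blade S1 * blade S2)"
    using blade_sign_sq [of S1 S2] by (simp add: blade_mult S scalar_scalar_mult mult.assoc)
  then have "pconst (scalar z * blade S) = pscale (z * blade_sign S1 S2) (pconst (blade S1) * pconst (blade S2))"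
    by (simp only: pscale_def pconst_mult)
  moreover have "pconst (blade S1) \<in> polys A" "pconst (blade S2) \<in> polys B"
    using S by (auto intro!: polys_pconst Cl_blade)
  then have "pconst (blade S1) * pconst (blade S2) \<in> {F * G | F G. F \<in> polys A \<and> G \<in> polys B}"
    by blast
  ultimately show ?case
    by (simp only: cpoly.span_scale cpoly.span_base)
qed (auto simp: pconst_add intro: cpoly.span_zero cpoly.span_add)

lemma polys_split:
  assumes "F \<in> polys (A \<union> B)" "A \<inter> B = {}"
  shows "F \<in> cpoly.span {F * G | F G. F \<in> polys A \<and> G \<in> polys B}" (is "_ \<in> cpoly.span ?S")
  using assms(1)
proof (induction F rule: polys_var_induct)
  case (const a)
  then show ?case using Cl_split assms(2) by blast
next
  case (var j F)
  have "cpoly.span ?S \<subseteq> {F. pvar j * F \<in> cpoly.span ?S}"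
  proof (rule cpoly.span_minimal)
    show "cpoly.subspace {F. pvar j * F \<in> cpoly.span ?S}"
      by (rule cpoly.subspaceI)
        (auto simp: distrib_left pscale_mult_right intro: cpoly.span_zero cpoly.span_add cpoly.span_scale)
    show "?S \<subseteq> {F. pvar j * F \<in> cpoly.span ?S}"
    proof safe
      fix F G assume FG: "F \<in> polys A" "G \<in> polys B"
      show "pvar j * (F * G) \<in> cpoly.span ?S"
      proof (cases "j \<in> A")
        case True
        then have "pvar j * F \<in> polys A" by (intro polys_mult polys_pvar FG)
        with FG have "(pvar j * F) * G \<in> ?S" by blast
        then have "(pvar j * F) * G \<in> cpoly.span ?S" by (rule cpoly.span_base)
        then show ?thesis by (simp only: mult.assoc)
      next
        case False
        then have "pvar j * G \<in> polys B" using var(1) by (intro polys_mult polys_pvar FG) simp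
        with FG have "F * (pvar j * G) \<in> ?S" by blast
        then have "F * (pvar j * G) \<in> cpoly.span ?S" by (rule cpoly.span_base)
        then show ?thesis by (simp only: pvar_left_commute [of F j G])
      qed
    qed
  qed
  with var show ?case by blast
qed (rule cpoly.span_add)

section \<open>Substitutions, reflections and versors\<close>

text \<open>The condition on the substituted polynomials under which substitution is multiplicative
  although the coefficients do not commute.\<close>

definition central :: "cpoly \<Rightarrow> bool" where
  "central F \<longleftrightarrow> (\<forall>G. F * G = G * F)"

lemma centralD: "central F \<Longrightarrow> F * G = G * F"
  by (simp add: central_def)

lemma central_one [simp]: "central 1"
  by (simp add: central_def)

lemma central_zero [simp]: "central 0"
  by (simp add: central_def)

lemma central_pvar [simp]: "central (pvar j)"
  by (simp add: central_def pvar_central)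

lemma central_mult: "central F \<Longrightarrow> central G \<Longrightarrow> central (F * G)"
  unfolding central_def by (metis mult.assoc)

lemma central_power: "central F \<Longrightarrow> central (F ^ n)"
  by (induction n) (simp_all add: central_mult)

lemma central_add: "central F \<Longrightarrow> central G \<Longrightarrow> central (F + G)"
  by (simp add: central_def algebra_simps)

lemma central_sum: "(\<And>x. x \<in> S \<Longrightarrow> central (f x)) \<Longrightarrow> central (sum f S)"
  by (induction S rule: infinite_finite_induct) (auto intro: central_add)

lemma central_pscale: "central F \<Longrightarrow> central (pscale z F)"
  by (simp add: central_def pscale_mult_left pscale_mult_right)

lemma central_uminus: "central F \<Longrightarrow> central (- F)"
  by (simp add: central_def)

lemma central_prod_list: "(\<And>F. F \<in> set Fs \<Longrightarrow> central F) \<Longrightarrow> central (prod_list Fs)"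
  by (induction Fs) (auto intro: central_mult)

lemma central_left_commute: "central G \<Longrightarrow> F * (G * H) = G * (F * H)"
  by (metis centralD mult.assoc)

section \<open>Substitution as a ring homomorphism, and the chain rule\<close>

definition psubst_monom :: "(nat \<Rightarrow> cpoly) \<Rightarrow> (nat \<Rightarrow>\<^sub>0 nat) \<Rightarrow> cpoly" where
  "psubst_monom \<phi> \<alpha> = prod_list (map (\<lambda>i. \<phi> i ^ lookup \<alpha> i) (sorted_list_of_set (keys \<alpha>)))"

lemma psubst_monom_superset:
  assumes "finite S" "keys \<alpha> \<subseteq> S"
  shows "psubst_monom \<phi> \<alpha> = prod_list (map (\<lambda>i. \<phi> i ^ lookup \<alpha> i) (sorted_list_of_set S))"
proof -
  have "sorted_list_of_set (keys \<alpha>) = filter (\<lambda>i. i \<in> keys \<alpha>) (sorted_list_of_set S)"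
    using assms by (intro sorted_distinct_set_unique) (auto intro: sorted_wrt_filter)
  moreover have "prod_list (map (\<lambda>i. \<phi> i ^ lookup \<alpha> i) (filter (\<lambda>i. i \<in> keys \<alpha>) xs)) =
      prod_list (map (\<lambda>i. \<phi> i ^ lookup \<alpha> i) xs)" for xs
    by (induction xs) (auto simp: in_keys_iff)
  ultimately show ?thesis by (simp add: psubst_monom_def)
qed

lemma psubst_superset:
  assumes "finite S" "keys F \<subseteq> S"
  shows "psubst \<phi> F = (\<Sum>\<alpha>\<in>S. pconst (lookup F \<alpha>) * psubst_monom \<phi> \<alpha>)"
  unfolding psubst_def psubst_monom_def using assms
  by (intro sum.mono_neutral_left) (auto simp: in_keys_iff)

lemma psubst_add: "psubst \<phi> (F + G) = psubst \<phi> F + psubst \<phi> G"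
  using psubst_superset [of "keys F \<union> keys G" "F + G" \<phi>] psubst_superset [of "keys F \<union> keys G" F \<phi>]
    psubst_superset [of "keys F \<union> keys G" G \<phi>] keys_add [of F G]
  by (simp add: lookup_add pconst_add distrib_right sum.distrib)

lemma psubst_single: "psubst \<phi> (single \<alpha> a) = pconst a * psubst_monom \<phi> \<alpha>"
  using psubst_superset [of "{\<alpha>}" "single \<alpha> a" \<phi>] by simp

lemma psubst_zero [simp]: "psubst \<phi> 0 = 0"
  by (simp add: psubst_def)

lemma psubst_pconst [simp]: "psubst \<phi> (pconst a) = pconst a"
  by (simp add: pconst_def psubst_single) (simp add: psubst_monom_def flip: pconst_def)

lemma psubst_pvar [simp]: "psubst \<phi> (pvar j) = \<phi> j"
  by (simp add: pvar_def psubst_single) (simp add: psubst_monom_def)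

context
  fixes \<phi> :: "nat \<Rightarrow> cpoly"
  assumes central: "\<And>i. central (\<phi> i)"
begin

lemma central_psubst_monom: "central (psubst_monom \<phi> \<alpha>)"
  unfolding psubst_monom_def by (intro central_prod_list) (auto intro: central_power central)

lemma psubst_monom_add: "psubst_monom \<phi> (\<alpha> + \<beta>) = psubst_monom \<phi> \<alpha> * psubst_monom \<phi> \<beta>"
proof -
  let ?S = "keys \<alpha> \<union> keys \<beta>"
  let ?m = "\<lambda>\<alpha> xs. prod_list (map (\<lambda>i. \<phi> i ^ lookup \<alpha> i) xs)"
  have "?m (\<alpha> + \<beta>) xs = ?m \<alpha> xs * ?m \<beta> xs" for xs
  proof (induction xs)
    case (Cons x xs)
    have "\<phi> x ^ lookup \<beta> x * (?m \<alpha> xs * ?m \<beta> xs) = ?m \<alpha> xs * (\<phi> x ^ lookup \<beta> x * ?m \<beta> xs)"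
      by (rule central_left_commute [symmetric]) (intro central_power central)
    then show ?case
      using Cons by (simp add: lookup_add power_add mult.assoc)
  qed simp
  then show ?thesis
    using keys_add [of \<alpha> \<beta>]
    by (simp add: psubst_monom_superset [of ?S])
qed

lemma psubst_mult: "psubst \<phi> (F * G) = psubst \<phi> F * psubst \<phi> G"
proof (induction F rule: cpoly_induct)
  case (single \<alpha> a)
  show ?case
  proof (induction G rule: cpoly_induct)
    case (single \<beta> b)
    have "pconst a * (pconst b * (psubst_monom \<phi> \<alpha> * psubst_monom \<phi> \<beta>)) =
        pconst a * (psubst_monom \<phi> \<alpha> * (pconst b * psubst_monom \<phi> \<beta>))"
      by (subst central_left_commute [OF central_psubst_monom [of \<alpha>]]) simp
    then show ?case
      by (simp add: mult_single psubst_single psubst_monom_add pconst_mult mult.assoc)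
  qed (simp_all add: psubst_add distrib_left)
qed (simp_all add: psubst_add distrib_right)

lemma psubst_pscale: "psubst \<phi> (pscale z F) = pscale z (psubst \<phi> F)"
  by (simp add: pscale_def psubst_mult)

lemma psubst_uminus: "psubst \<phi> (- F) = - psubst \<phi> F"
  using psubst_pscale [of "-1" F] by (simp add: pscale_minus_one)

lemma psubst_sum: "psubst \<phi> (sum f S) = (\<Sum>x\<in>S. psubst \<phi> (f x))"
  by (induction S rule: infinite_finite_induct) (simp_all add: psubst_add)

lemma partial_deriv_psubst:
  assumes "finite I" "F \<in> polys I"
  shows "partial_deriv j (psubst \<phi> F) = (\<Sum>i\<in>I. partial_deriv j (\<phi> i) * psubst \<phi> (partial_deriv i F))"
  using assms(2)
proof (induction F rule: polys_var_induct)
  case (var k F)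
  have "(\<Sum>i\<in>I. partial_deriv j (\<phi> i) * psubst \<phi> (partial_deriv i (pvar k * F))) =
      (\<Sum>i\<in>I. (if k = i then partial_deriv j (\<phi> k) * psubst \<phi> F else 0) +
        \<phi> k * (partial_deriv j (\<phi> i) * psubst \<phi> (partial_deriv i F)))"
    by (intro sum.cong refl)
      (auto simp: partial_deriv_pvar_mult psubst_add psubst_mult distrib_left
        central_left_commute [OF central])
  also have "\<dots> = partial_deriv j (\<phi> k) * psubst \<phi> F + \<phi> k * partial_deriv j (psubst \<phi> F)"
    using var assms(1) by (simp add: sum.distrib sum_distrib_left)
  finally show ?case
    by (simp add: psubst_mult partial_deriv_mult)
qed (simp_all add: psubst_add partial_deriv_add distrib_left sum.distrib)

lemma polys_psubst:
  assumes "\<And>i. i \<in> I \<Longrightarrow> \<phi> i \<in> polys I" "F \<in> polys I"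
  shows "psubst \<phi> F \<in> polys I"
  using assms(2)
  by (induction F rule: polys_var_induct)
    (auto simp: psubst_mult psubst_add assms(1) intro!: polys_mult polys_pconst polys_add)

end

section \<open>The sign change of one block of variables\<close>

definition reflect :: "nat set \<Rightarrow> cpoly \<Rightarrow> cpoly" where
  "reflect A = psubst (\<lambda>j. if j \<in> A then - pvar j else pvar j)"

lemma central_reflect: "central (if j \<in> A then - pvar j else pvar j)"
  by (simp add: central_uminus)

lemma reflect_add: "reflect A (F + G) = reflect A F + reflect A G"
  by (simp add: reflect_def psubst_add)

lemma reflect_zero [simp]: "reflect A 0 = 0"
  by (simp add: reflect_def)

lemma reflect_mult: "reflect A (F * G) = reflect A F * reflect A G"
  unfolding reflect_def by (rule psubst_mult [OF central_reflect])

lemma reflect_pconst [simp]: "reflect A (pconst a) = pconst a"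
  by (simp add: reflect_def)

lemma reflect_pvar: "reflect A (pvar j) = (if j \<in> A then - pvar j else pvar j)"
  by (simp add: reflect_def)

lemma reflect_pscale: "reflect A (pscale z F) = pscale z (reflect A F)"
  unfolding reflect_def by (rule psubst_pscale [OF central_reflect])

lemma reflect_sum: "reflect A (sum f S) = (\<Sum>x\<in>S. reflect A (f x))"
  unfolding reflect_def by (rule psubst_sum [OF central_reflect])

lemma reflect_polys: "F \<in> polys I \<Longrightarrow> reflect A F \<in> polys I"
  unfolding reflect_def by (rule polys_psubst [OF central_reflect]) (auto intro: polys_uminus polys_pvar)

lemma partial_deriv_reflect:
  "partial_deriv j (reflect A F) = pscale (if j \<in> A then -1 else 1) (reflect A (partial_deriv j F))"
  using polys_UNIV [of F]
proof (induction F rule: polys_var_induct)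
  case (const a)
  then show ?case by (simp add: reflect_def)
next
  case (var i F)
  then show ?case
    by (auto simp: reflect_mult reflect_pvar reflect_add partial_deriv_pvar_mult partial_deriv_uminus
        pscale_mult_right pscale_minus_one)
next
  case (add F G)
  then show ?case by (simp add: partial_deriv_add reflect_add cpoly.scale_right_distrib)
qed

lemma reflect_vec_var: "reflect A (vec_var A) = - vec_var A"
  by (simp add: vec_var_def reflect_sum reflect_mult reflect_pvar sum_negf)

lemma reflect_vec_var_disjoint: "A \<inter> B = {} \<Longrightarrow> reflect A (vec_var B) = vec_var B"
  by (auto simp: vec_var_def reflect_sum reflect_mult reflect_pvar intro!: sum.cong)

lemma dirac_reflect: "dirac A (reflect A F) = - reflect A (dirac A F)"
  by (simp add: dirac_def partial_deriv_reflect reflect_sum reflect_mult pscale_minus_one sum_negf)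

lemma dirac_reflect_disjoint: "A \<inter> B = {} \<Longrightarrow> dirac B (reflect A F) = reflect A (dirac B F)"
  by (auto simp: dirac_def partial_deriv_reflect reflect_sum reflect_mult intro!: sum.cong)

text \<open>The reflection is diagonal on monomials with real eigenvalues; this gives both its
  self-adjointness and its value on homogeneous polynomials.\<close>

lemma lookup_reflect:
  assumes "finite A"
  shows "lookup (reflect A F) \<alpha> = scalar ((-1) ^ (\<Sum>j\<in>A. lookup \<alpha> j)) * lookup F \<alpha>"
proof (induction F rule: cpoly_induct)
  case (single \<beta> a)
  have "reflect A (single \<beta> a) = pscale ((-1) ^ (\<Sum>j\<in>A. lookup \<beta> j)) (single \<beta> a)"
    using subset_UNIV [of "keys \<beta>"]
  proof (induction \<beta> rule: nat_exponent_induct)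
    case zero
    show ?case using reflect_pconst [of A a] by (simp add: pconst_def)
  next
    case (add \<beta> j)
    have "(\<Sum>i\<in>A. lookup (single j 1 + \<beta>) i) =
        (\<Sum>i\<in>A. (if j = i then 1 else 0)) + (\<Sum>i\<in>A. lookup \<beta> i)"
      by (simp only: lookup_add lookup_single when_def sum.distrib)
    also have "(\<Sum>i\<in>A. (if j = i then 1 else 0)) = (if j \<in> A then 1 else (0::nat))"
      using assms by simp
    finally have e: "(\<Sum>i\<in>A. lookup (single j 1 + \<beta>) i) =
        (if j \<in> A then 1 else 0) + (\<Sum>i\<in>A. lookup \<beta> i)" .
    show ?case
      unfolding pvar_mult_single [symmetric] e
      by (simp add: reflect_mult reflect_pvar add pscale_mult_right cpoly.scale_minus_left)
  qed
  then show ?case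
    by (simp add: lookup_pscale lookup_single when_def)
qed (simp_all add: reflect_add lookup_add distrib_left)

lemma reflect_homogeneous:
  assumes "finite A" "euler A F = pscale (of_nat k) F"
  shows "reflect A F = pscale ((-1) ^ k) F"
proof (rule poly_mapping_eqI)
  fix \<alpha>
  have "of_nat (\<Sum>j\<in>A. lookup \<alpha> j) * lookup F \<alpha> = of_nat k * lookup F \<alpha>"
    using arg_cong [OF assms(2), of "\<lambda>G. lookup G \<alpha>"]
    by (simp add: lookup_euler [OF assms(1)] lookup_pscale scalar_of_nat del: of_nat_sum)
  then have "(\<Sum>j\<in>A. lookup \<alpha> j) = k \<or> lookup F \<alpha> = 0"
    by (simp only: of_nat_mult_clifford_cancel)
  then show "lookup (reflect A F) \<alpha> = lookup (pscale ((-1) ^ k) F) \<alpha>"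
    by (auto simp: lookup_reflect [OF assms(1)] lookup_pscale)
qed

lemma fischer_reflect:
  assumes "finite A" shows "fischer (reflect A F) G = fischer F (reflect A G)"
proof -
  have "keys (reflect A F) \<subseteq> keys F"
    by (auto simp: in_keys_iff lookup_reflect [OF assms])
  moreover have "cbar (scalar ((-1) ^ n) * a) * b = cbar a * (scalar ((-1) ^ n) * b)" for n a b
    by (simp add: cbar_mult cbar_scalar mult.assoc)
  ultimately show ?thesis
    using fischer_superset [of "keys F" "reflect A F" G]
    by (simp add: fischer_eq [of F] lookup_reflect [OF assms])
qed

section \<open>Vectors, their coordinates and versors\<close>

definition gen_span :: "nat set \<Rightarrow> clifford set" where
  "gen_span A = {\<Sum>i\<in>A. scalar (c i) * gen i | c. True}"

lemma gen_span_zero [simp]: "0 \<in> gen_span A"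
  unfolding gen_span_def by (simp, rule exI [of _ "\<lambda>_. 0"]) simp

lemma gen_span_add: "a \<in> gen_span A \<Longrightarrow> b \<in> gen_span A \<Longrightarrow> a + b \<in> gen_span A"
proof -
  assume "a \<in> gen_span A" "b \<in> gen_span A"
  then obtain c d where "a = (\<Sum>i\<in>A. scalar (c i) * gen i)" "b = (\<Sum>i\<in>A. scalar (d i) * gen i)"
    by (auto simp: gen_span_def)
  then have "a + b = (\<Sum>i\<in>A. scalar (c i + d i) * gen i)"
    by (simp add: scalar_add distrib_right sum.distrib)
  then show ?thesis unfolding gen_span_def by (intro CollectI exI [of _ "\<lambda>i. c i + d i"]) simp
qed

lemma gen_span_scalar: "a \<in> gen_span A \<Longrightarrow> scalar z * a \<in> gen_span A"
proof -
  assume "a \<in> gen_span A"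
  then obtain c where "a = (\<Sum>i\<in>A. scalar (c i) * gen i)"
    by (auto simp: gen_span_def)
  then have "scalar z * a = (\<Sum>i\<in>A. scalar (z * c i) * gen i)"
    by (simp add: scalar_mult sum_distrib_left mult.assoc)
  then show ?thesis unfolding gen_span_def by (intro CollectI exI [of _ "\<lambda>i. z * c i"]) simp
qed

lemma gen_span_uminus: "a \<in> gen_span A \<Longrightarrow> - a \<in> gen_span A"
  using gen_span_scalar [of a A "-1"] by (simp add: scalar_uminus scalar_one)

lemma gen_span_gen: "finite A \<Longrightarrow> j \<in> A \<Longrightarrow> gen j \<in> gen_span A"
proof -
  assume "finite A" "j \<in> A"
  then have "gen j = (\<Sum>i\<in>A. scalar (if i = j then 1 else 0) * gen i)"
    by (simp add: if_distrib [of scalar] if_distrib [of "\<lambda>a. a * b" for b] scalar_one cong: if_cong)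
  then show ?thesis unfolding gen_span_def by (intro CollectI exI [of _ "\<lambda>i. if i = j then 1 else 0"]) simp
qed

lemma gen_span_induct [consumes 1, case_names zero gen add]:
  assumes "a \<in> gen_span A" "P 0" "\<And>z i. i \<in> A \<Longrightarrow> P (scalar z * gen i)" "\<And>a b. P a \<Longrightarrow> P b \<Longrightarrow> P (a + b)"
  shows "P a"
proof -
  have "P (\<Sum>i\<in>S. scalar (c i) * gen i)" if "S \<subseteq> A" for S and c :: "nat \<Rightarrow> complex"
    using that by (induction S rule: infinite_finite_induct) (auto intro: assms)
  then show ?thesis using assms(1) by (auto simp: gen_span_def)
qed

definition coord :: "nat \<Rightarrow> clifford \<Rightarrow> complex" where
  "coord i a = lookup (coeffs a) {|i|}"

text \<open>Written as a scalar part, a coordinate becomes accessible to the trace property.\<close>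

lemma coord_scalar_part: "coord i a = - scalar_part (gen i * a)"
proof -
  have "coord i a = scalar_part (cbar (gen i) * a)"
    by (simp add: scalar_part_cbar_mult gen_def coord_def)
  also have "\<dots> = scalar_part (scalar (-1) * (gen i * a))"
    by (simp add: cbar_gen scalar_uminus scalar_one)
  finally show ?thesis by (simp add: scalar_part_scalar_mult)
qed

lemma coord_gen: "coord i (scalar z * gen j) = (if i = j then z else 0)"
  by (simp add: coord_def gen_def coeffs_scalar_blade lookup_single when_def)

lemma coord_add: "coord i (a + b) = coord i a + coord i b"
  by (simp add: coord_def lookup_add)

lemma coord_zero [simp]: "coord i 0 = 0"
  by (simp add: coord_def)

lemma gen_span_expand:
  assumes "finite A" "a \<in> gen_span A" shows "(\<Sum>i\<in>A. scalar (coord i a) * gen i) = a"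
  using assms(2)
proof (induction a rule: gen_span_induct)
  case (gen z i)
  have "(\<Sum>k\<in>A. scalar (coord k (scalar z * gen i)) * gen k) = (\<Sum>k\<in>A. if k = i then scalar z * gen i else 0)"
    by (intro sum.cong) (auto simp: coord_gen)
  with gen assms(1) show ?case by simp
qed (simp_all add: coord_add scalar_add distrib_right sum.distrib)

lemma coord_outside: "a \<in> gen_span A \<Longrightarrow> i \<notin> A \<Longrightarrow> coord i a = 0"
  by (induction a rule: gen_span_induct) (auto simp: coord_gen coord_add)

text \<open>A common setting for the elements of both spin groups and their products: it is closed
  under multiplication and symmetric in the blocks, and unit vectors of either block belong to it.
  Both directions of conjugation are recorded because the action on the variables uses one and the
  Dirac operator the other.\<close>

definition versor :: "nat set \<Rightarrow> nat set \<Rightarrow> clifford \<Rightarrow> bool" where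
  "versor A B s \<longleftrightarrow> s * cbar s = 1 \<and> cbar s * s = 1 \<and>
    (\<forall>C\<in>{A, B}. \<forall>y\<in>gen_span C. cbar s * y * s \<in> gen_span C \<and> s * y * cbar s \<in> gen_span C)"

lemma versor_one: "versor A B 1"
  by (simp add: versor_def)

lemma versor_mult:
  assumes "versor A B s" "versor A B t" shows "versor A B (s * t)"
proof -
  have "s * t * cbar (s * t) = s * (t * cbar t) * cbar s" "cbar (s * t) * (s * t) = cbar t * (cbar s * s) * t"
    by (simp_all add: cbar_mult mult.assoc)
  moreover have "cbar (s * t) * y * (s * t) = cbar t * (cbar s * y * s) * t"
      "s * t * y * cbar (s * t) = s * (t * y * cbar t) * cbar s" for y
    by (simp_all add: cbar_mult mult.assoc)
  ultimately show ?thesis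
    using assms by (simp add: versor_def)
qed

lemma versor_sym: "versor A B s \<Longrightarrow> versor B A s"
  by (auto simp: versor_def)

lemma unit_vectors_in_gen_span: "w \<in> unit_vectors A \<Longrightarrow> w \<in> gen_span A"
  by (auto simp: unit_vectors_def gen_span_def)

lemma unit_vector_sq:
  assumes "w \<in> unit_vectors A" "finite A"
  shows "w * w = -1" "cbar w = - w"
    and "i \<in> A \<Longrightarrow> \<exists>z. w * gen i = scalar z - gen i * w"
proof -
  obtain a :: "nat \<Rightarrow> real" where w: "w = (\<Sum>j\<in>A. scalar (of_real (a j)) * gen j)" "(\<Sum>j\<in>A. (a j)\<^sup>2) = 1"
    using assms by (auto simp: unit_vectors_def)
  have "cbar (scalar (of_real r) * gen j) = - (scalar (of_real r) * gen j)" for r j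
    by (simp add: cbar_mult cbar_scalar cbar_gen scalar_central [of _ "gen j"])
  then show "cbar w = - w"
    by (simp add: w(1) cbar_sum sum_negf)
  have anti: "w * gen i + gen i * w = scalar (-2 * of_real (a i))" if "i \<in> A" for i
  proof -
    have "w * gen i + gen i * w = (\<Sum>j\<in>A. scalar (of_real (a j)) * (gen j * gen i + gen i * gen j))"
      by (simp add: w sum_distrib_left sum_distrib_right distrib_left sum.distrib mult.assoc
          scalar_left_commute [of "gen i"])
    also have "\<dots> = (\<Sum>j\<in>A. if j = i then scalar (-2 * of_real (a i)) else 0)"
      by (intro sum.cong refl) (auto simp: gen_anticommute mult.commute simp flip: scalar_mult)
    finally show ?thesis using that assms(2) by simp
  qed
  then show "i \<in> A \<Longrightarrow> \<exists>z. w * gen i = scalar z - gen i * w"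
    by (metis add_diff_cancel_right')
  \<comment> \<open>One copy of the square is expanded in its left factor and one in its right
    factor, so that the known anticommutators with the generators appear.\<close>
  have "w * w + w * w = (\<Sum>i\<in>A. scalar (of_real (a i)) * (w * gen i + gen i * w))"
  proof -
    have "w * w = (\<Sum>i\<in>A. scalar (of_real (a i)) * (w * gen i))"
      by (subst (2) w(1)) (simp add: sum_distrib_left scalar_left_commute [of w])
    moreover have "w * w = (\<Sum>i\<in>A. scalar (of_real (a i)) * (gen i * w))"
      by (subst (1) w(1)) (simp add: sum_distrib_right mult.assoc)
    ultimately show ?thesis by (simp add: distrib_left sum.distrib)
  qed
  also have "\<dots> = (\<Sum>i\<in>A. scalar (of_real (-2 * (a i)\<^sup>2)))"
    by (intro sum.cong refl) (simp add: anti power2_eq_square mult_ac flip: scalar_mult)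
  also have "\<dots> = scalar (of_real (-2 * (\<Sum>i\<in>A. (a i)\<^sup>2)))"
  proof -
    have "scalar (of_real (sum f A)) = (\<Sum>i\<in>A. scalar (of_real (f i)))" for f :: "nat \<Rightarrow> real"
      by (induction A rule: infinite_finite_induct) (simp_all add: scalar_add)
    then show ?thesis by (simp only: sum_distrib_left)
  qed
  finally have "w * w + w * w = scalar (-2)" using w(2) by simp
  moreover have two: "scalar 2 = 1 + 1" by (metis one_add_one scalar_add scalar_one)
  moreover have "scalar (- 2) = - scalar 2" by (rule scalar_uminus)
  ultimately have "scalar 2 * (w * w + 1) = 0"
    by (simp only: two distrib_right distrib_left mult_1_left mult_1_right) simp
  then show "w * w = -1"
    by (simp add: scalar_mult_eq_0_iff eq_neg_iff_add_eq_0)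
qed

text \<open>On its own block a unit vector acts by a reflection up to sign:
  \<open>w * gen i * w\<close> is \<open>gen i\<close> plus a multiple of \<open>w\<close>. With the
  generators of the other block it anticommutes, which gives
  \<open>w * gen i * w = gen i\<close>.\<close>

lemma versor_unit_vector:
  assumes "w \<in> unit_vectors A" "finite A" "finite B" "A \<inter> B = {}"
  shows "versor A B w"
proof -
  note w = unit_vector_sq [OF assms(1,2)]
  have A: "w * y * w \<in> gen_span A" if "y \<in> gen_span A" for y
    using that
  proof (induction y rule: gen_span_induct)
    case (gen z i)
    obtain c where "w * gen i = scalar c - gen i * w" using w(3) gen by blast
    then have "w * gen i * w = scalar c * w + gen i"
      by (simp add: left_diff_distrib mult.assoc w(1))
    moreover have "w * (scalar z * gen i) * w = scalar z * (w * gen i * w)"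
      by (simp add: mult.assoc scalar_left_commute [of w])
    ultimately show ?case
      using gen assms by (simp add: gen_span_scalar gen_span_add gen_span_gen unit_vectors_in_gen_span)
  qed (simp_all add: algebra_simps gen_span_add)
  have B: "w * y * w \<in> gen_span B" if "y \<in> gen_span B" for y
    using that
  proof (induction y rule: gen_span_induct)
    case (gen z i)
    have "v * gen i = - (gen i * v)" if "v \<in> gen_span A" for v
      using that
    proof (induction v rule: gen_span_induct)
      case (gen z' j)
      then have "j \<noteq> i" using \<open>i \<in> B\<close> assms(4) by auto
      then show ?case
        by (simp add: mult.assoc scalar_left_commute [of "gen i"] gen_anti [of j i])
    qed (simp_all add: algebra_simps)
    then have "w * gen i * w = gen i"
      using unit_vectors_in_gen_span [OF assms(1)] by (simp add: mult.assoc w(1))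
    moreover have "w * (scalar z * gen i) * w = scalar z * (w * gen i * w)"
      by (simp add: mult.assoc scalar_left_commute [of w])
    ultimately show ?case
      using gen assms by (simp add: gen_span_scalar gen_span_gen)
  qed (simp_all add: algebra_simps gen_span_add)
  show ?thesis
    using A B by (auto simp: versor_def w intro: gen_span_uminus)
qed

lemma versor_prod_list:
  "set vs \<subseteq> unit_vectors A \<Longrightarrow> finite A \<Longrightarrow> finite B \<Longrightarrow> A \<inter> B = {} \<Longrightarrow> versor A B (prod_list vs)"
  by (induction vs) (auto intro: versor_mult versor_one versor_unit_vector)

lemma cinv_versor: "versor A B s \<Longrightarrow> cinv s = cbar s"
  unfolding cinv_def versor_def
  by (rule the_equality) (blast, metis mult.assoc mult.left_neutral mult.right_neutral)

text \<open>Each factor contributes the sign \<open>\<sigma>\<close>, and there is an even number of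
  factors. Hence the spin groups of both blocks commute with \<open>c_e_P\<close>, although single
  vectors of the two blocks pass it with opposite signs.\<close>

lemma even_prod_list_commute:
  assumes "\<And>w. w \<in> gen_span A \<Longrightarrow> c * w = scalar \<sigma> * (w * c)" "\<sigma> * \<sigma> = 1" "set vs \<subseteq> gen_span A" "even (length vs)"
  shows "c * prod_list vs = prod_list vs * c"
proof -
  have "c * prod_list vs = scalar (\<sigma> ^ length vs) * (prod_list vs * c)"
    using assms(3)
  proof (induction vs)
    case (Cons w vs)
    have "c * prod_list (w # vs) = scalar \<sigma> * (w * (c * prod_list vs))"
      using assms(1) [of w] Cons.prems by (simp flip: mult.assoc)
    with Cons show ?case
      by (simp add: scalar_left_commute [of w] scalar_scalar_mult mult.assoc)
  qed (simp add: scalar_one)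
  moreover have "\<sigma> ^ length vs = 1"
    using assms(2,4) by (metis dvd_def power2_eq_square power_mult power_one)
  ultimately show ?thesis by (simp add: scalar_one)
qed

lemma c_e_P_commute_Spin:
  assumes "s \<in> Spin {1..p} \<or> s \<in> Spin {p + 1..p + q}"
  shows "c_e_P p * s = s * c_e_P p"
proof -
  have *: "c_e_P p * s = s * c_e_P p"
    if "s \<in> Spin C" and c: "\<And>j. j \<in> C \<Longrightarrow> c_e_P p * gen j = scalar \<sigma> * (gen j * c_e_P p)" and "\<sigma> * \<sigma> = 1" for C \<sigma>
  proof -
    have "c_e_P p * w = scalar \<sigma> * (w * c_e_P p)" if "w \<in> gen_span C" for w
      using that
    proof (induction w rule: gen_span_induct)
      case (gen z i)
      have "c_e_P p * (scalar z * gen i) = scalar z * (c_e_P p * gen i)"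
        by (rule scalar_left_commute)
      with \<open>i \<in> C\<close> show ?case
        by (simp add: c mult.assoc scalar_scalar_mult mult.commute)
    qed (simp_all add: algebra_simps)
    moreover obtain vs where "s = prod_list vs" "even (length vs)" "set vs \<subseteq> unit_vectors C"
      using \<open>s \<in> Spin C\<close> by (auto simp: Spin_def)
    ultimately show ?thesis
      using even_prod_list_commute [of C "c_e_P p" \<sigma> vs] \<open>\<sigma> * \<sigma> = 1\<close> unit_vectors_in_gen_span by blast
  qed
  have "(- ((-1) ^ p)) * (- ((-1) ^ p)) = (1 :: complex)" "(-1) ^ p * (-1) ^ p = (1 :: complex)"
    by (simp_all flip: power_mult_distrib)
  then show ?thesis
    using assms * [of "{1..p}" "- ((-1) ^ p)"] * [of "{p + 1..p + q}" "(-1) ^ p"]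
      c_e_P_gen [of _ p] by auto
qed

section \<open>The spin action and symmetric operators\<close>

lemma L_add: "L I s (F + G) = L I s F + L I s G"
  by (simp add: L_def psubst_add distrib_left)

context
  fixes A B I :: "nat set" and s :: clifford
  assumes fin: "finite A" "finite B" and disj: "A \<inter> B = {}" and I: "I = A \<union> B"
    and versor: "versor A B s"
begin

lemma conj_coord_eq: "conj_coord I s i = (\<Sum>j\<in>I. pscale (coord i (cbar s * gen j * s)) (pvar j))"
  by (simp add: conj_coord_def coord_def cinv_versor [OF versor])

lemma central_conj_coord: "central (conj_coord I s i)"
  unfolding conj_coord_eq by (intro central_sum central_pscale central_pvar)

text \<open>The trace property says that the matrices of the two conjugations are transposes of each
  other. The chain rule produces the transposed matrix, and this lemma converts it back into a
  conjugated generator.\<close>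

lemma coord_conj_commute: "coord i (cbar s * gen j * s) = coord j (s * gen i * cbar s)"
proof -
  have "scalar_part (gen i * (cbar s * gen j * s)) = scalar_part (gen i * cbar s * (gen j * s))"
    by (simp only: mult.assoc)
  also have "\<dots> = scalar_part ((gen j * s) * (gen i * cbar s))"
    by (rule scalar_part_mult_commute)
  finally show ?thesis by (simp add: coord_scalar_part mult.assoc)
qed

lemma conj_in_gen_span: "j \<in> A \<Longrightarrow> cbar s * gen j * s \<in> gen_span A" "j \<in> A \<Longrightarrow> s * gen j * cbar s \<in> gen_span A"
    "j \<in> B \<Longrightarrow> cbar s * gen j * s \<in> gen_span B" "j \<in> B \<Longrightarrow> s * gen j * cbar s \<in> gen_span B"
  using versor gen_span_gen fin by (auto simp: versor_def)

lemma psubst_conj_mult: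
  "psubst (conj_coord I s) (F * G) = psubst (conj_coord I s) F * psubst (conj_coord I s) G"
  by (rule psubst_mult [OF central_conj_coord])

lemma L_pscale: "L I s (pscale z F) = pscale z (L I s F)"
  by (simp add: L_def psubst_pscale [OF central_conj_coord] pscale_mult_right)

lemma conj_coord_block:
  assumes "i \<in> A"
  shows "conj_coord I s i = (\<Sum>j\<in>A. pscale (coord i (cbar s * gen j * s)) (pvar j))"
  unfolding conj_coord_eq
proof (rule sum.mono_neutral_right)
  show "\<forall>j\<in>I - A. pscale (coord i (cbar s * gen j * s)) (pvar j) = 0"
  proof
    fix j assume "j \<in> I - A"
    then have "cbar s * gen j * s \<in> gen_span B" using I conj_in_gen_span by auto
    moreover have "i \<notin> B" using assms disj by auto
    ultimately show "pscale (coord i (cbar s * gen j * s)) (pvar j) = 0"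
      using coord_outside by simp
  qed
qed (use I fin in auto)

text \<open>The substitution turns the vector variable into \<open>cbar s * x * s\<close>, and the
  left factor \<open>s\<close> cancels \<open>cbar s\<close>.\<close>

lemma psubst_conj_vec_var:
  "pconst s * psubst (conj_coord I s) (vec_var A) = vec_var A * pconst s"
proof -
  have "psubst (conj_coord I s) (vec_var A) = (\<Sum>i\<in>A. pconst (gen i) * conj_coord I s i)"
    unfolding vec_var_def psubst_sum [OF central_conj_coord] by (simp add: psubst_conj_mult)
  also have "\<dots> = (\<Sum>i\<in>A. \<Sum>j\<in>A. pconst (scalar (coord i (cbar s * gen j * s)) * gen i) * pvar j)"
    by (intro sum.cong refl)
      (simp add: conj_coord_block sum_distrib_left pscale_mult_right pscale_mult_left flip: pscale_pconst)
  also have "\<dots> = (\<Sum>j\<in>A. pconst (\<Sum>i\<in>A. scalar (coord i (cbar s * gen j * s)) * gen i) * pvar j)"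
    by (subst sum.swap) (simp add: pconst_sum sum_distrib_right)
  also have "\<dots> = (\<Sum>j\<in>A. pconst (cbar s * gen j * s) * pvar j)"
    using gen_span_expand [OF fin(1)] conj_in_gen_span(1) by simp
  finally have "pconst s * psubst (conj_coord I s) (vec_var A) =
      (\<Sum>j\<in>A. pconst (s * cbar s * gen j * s) * pvar j)"
    by (simp add: sum_distrib_left pconst_mult mult.assoc)
  also have "\<dots> = vec_var A * pconst s"
    using versor by (simp add: versor_def vec_var_def sum_distrib_right pconst_mult mult.assoc pvar_central)
  finally show ?thesis .
qed

lemma L_vec_var: "L I s (vec_var A * F) = vec_var A * L I s F"
  using psubst_conj_vec_var by (simp add: L_def psubst_conj_mult flip: mult.assoc)

lemma partial_deriv_conj_coord:
  assumes "j \<in> I"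
  shows "partial_deriv j (conj_coord I s i) = pconst (scalar (coord i (cbar s * gen j * s)))"
proof -
  have "partial_deriv j (conj_coord I s i) =
      (\<Sum>k\<in>I. if k = j then pscale (coord i (cbar s * gen j * s)) 1 else 0)"
    unfolding conj_coord_eq partial_deriv_sum partial_deriv_pscale partial_deriv_pvar
    by (intro sum.cong) auto
  then show ?thesis using assms fin I by (simp add: pscale_def)
qed

text \<open>By the chain rule each derivative comes with the vector
  \<open>s * gen i * cbar s\<close>, and multiplication by the \<open>s\<close> that follows leaves
  \<open>s * gen i\<close>.\<close>

lemma L_dirac:
  assumes "F \<in> polys I"
  shows "dirac A (L I s F) = L I s (dirac A F)"
proof -
  let ?\<psi> = "psubst (conj_coord I s)"
  have fI: "finite I" using fin I by simp
  have AI: "j \<in> I" if "j \<in> A" for j using that I by simp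
  have "dirac A (L I s F) = (\<Sum>j\<in>A. \<Sum>i\<in>I. pconst (scalar (coord j (s * gen i * cbar s)) * gen j) *
      (pconst s * ?\<psi> (partial_deriv i F)))"
    unfolding dirac_def L_def partial_deriv_pconst_mult
      partial_deriv_psubst [of "conj_coord I s", OF central_conj_coord fI assms]
  proof (intro sum.cong refl)
    fix j assume j: "j \<in> A"
    have "pconst (gen j) * (pconst s * (pconst (scalar z) * G)) = pconst (scalar z * gen j) * (pconst s * G)"
      for z G
      by (simp add: pscale_mult_right pscale_mult_left flip: pscale_def pscale_pconst)
    then show "pconst (gen j) * (pconst s * (\<Sum>i\<in>I. partial_deriv j (conj_coord I s i) * ?\<psi> (partial_deriv i F)))
      = (\<Sum>i\<in>I. pconst (scalar (coord j (s * gen i * cbar s)) * gen j) * (pconst s * ?\<psi> (partial_deriv i F)))"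
      by (simp add: sum_distrib_left partial_deriv_conj_coord [OF AI [OF j]] coord_conj_commute)
  qed
  also have "\<dots> = (\<Sum>i\<in>I. pconst (\<Sum>j\<in>A. scalar (coord j (s * gen i * cbar s)) * gen j) *
      (pconst s * ?\<psi> (partial_deriv i F)))"
    by (subst sum.swap) (simp add: pconst_sum sum_distrib_right)
  also have "\<dots> = (\<Sum>i\<in>A. pconst (\<Sum>j\<in>A. scalar (coord j (s * gen i * cbar s)) * gen j) *
      (pconst s * ?\<psi> (partial_deriv i F)))"
  \<comment> \<open>A generator of the other block is conjugated into that block, so it has no
    coordinates in \<open>A\<close>.\<close>
  proof (rule sum.mono_neutral_right [OF fI], use I in blast, rule ballI)
    fix i assume "i \<in> I - A"
    then have "s * gen i * cbar s \<in> gen_span B" using I conj_in_gen_span by auto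
    then have "coord j (s * gen i * cbar s) = 0" if "j \<in> A" for j
      using disj that by (intro coord_outside) auto
    then have "(\<Sum>j\<in>A. scalar (coord j (s * gen i * cbar s)) * gen j) = 0"
      by (intro sum.neutral) simp
    then show "pconst (\<Sum>j\<in>A. scalar (coord j (s * gen i * cbar s)) * gen j) *
      (pconst s * ?\<psi> (partial_deriv i F)) = 0" by simp
  qed
  also have "\<dots> = (\<Sum>i\<in>A. pconst (s * gen i * cbar s) * (pconst s * ?\<psi> (partial_deriv i F)))"
    using gen_span_expand [OF fin(1)] conj_in_gen_span(2) by simp
  also have "\<dots> = (\<Sum>i\<in>A. pconst s * (pconst (gen i) * ?\<psi> (partial_deriv i F)))"
  proof (intro sum.cong refl)
    fix i
    have "pconst (s * gen i * cbar s) * (pconst s * G) = pconst (s * gen i * (cbar s * s)) * G" for G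
      by (simp add: pconst_mult mult.assoc)
    also have "pconst (s * gen i * (cbar s * s)) * G = pconst s * (pconst (gen i) * G)" for G
      using versor by (simp add: versor_def) (simp add: pconst_mult mult.assoc)
    finally show "pconst (s * gen i * cbar s) * (pconst s * ?\<psi> (partial_deriv i F)) =
        pconst s * (pconst (gen i) * ?\<psi> (partial_deriv i F))" .
  qed
  also have "\<dots> = L I s (dirac A F)"
    by (simp add: L_def dirac_def psubst_sum [OF central_conj_coord] psubst_conj_mult sum_distrib_left)
  finally show ?thesis .
qed

lemma reflect_conj_coord:
  assumes "i \<in> I"
  shows "reflect A (conj_coord I s i) = (if i \<in> A then - conj_coord I s i else conj_coord I s i)"
proof (cases "i \<in> A")
  case True
  then show ?thesis
    by (simp add: conj_coord_block reflect_sum reflect_pscale reflect_pvar sum_negf)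
next
  case False
  have *: "pscale (coord i (cbar s * gen j * s)) (reflect A (pvar j)) =
      pscale (coord i (cbar s * gen j * s)) (pvar j)" if "j \<in> I" for j
    using that conj_in_gen_span(1) [of j] coord_outside [OF _ False] by (auto simp: reflect_pvar)
  have "reflect A (conj_coord I s i) = conj_coord I s i"
    unfolding conj_coord_eq reflect_sum reflect_pscale by (intro sum.cong refl *)
  with False show ?thesis by simp
qed

lemma L_reflect:
  assumes "F \<in> polys I"
  shows "reflect A (L I s F) = L I s (reflect A F)"
proof -
  let ?\<psi> = "psubst (conj_coord I s)"
  have "reflect A (?\<psi> F) = ?\<psi> (reflect A F)"
    using assms
  proof (induction F rule: polys_var_induct)
    case (var i F)
    have "?\<psi> (- pvar i) = - conj_coord I s i"
      by (simp add: psubst_uminus [OF central_conj_coord])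
    with var show ?case
      by (simp add: psubst_uminus [OF central_conj_coord] reflect_mult psubst_conj_mult reflect_conj_coord reflect_pvar)
  qed (simp_all add: psubst_add reflect_add)
  then show ?thesis by (simp add: L_def reflect_mult)
qed

lemma L_polys:
  assumes "s \<in> Cl I" "F \<in> polys I"
  shows "L I s F \<in> polys I"
  unfolding L_def conj_coord_eq
  by (intro polys_mult polys_pconst assms polys_psubst central_sum central_pscale central_pvar
      polys_sum polys_pscale polys_pvar)

text \<open>The intertwining rules are hypotheses on \<open>C\<close> so that the lemma serves for
  either block and for their union.\<close>

lemma L_shifted_Gamma:
  assumes "C \<subseteq> I" "\<And>F. L I s (vec_var C * F) = vec_var C * L I s F"
    "\<And>F. F \<in> polys I \<Longrightarrow> dirac C (L I s F) = L I s (dirac C F)" "F \<in> polys I"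
  shows "shifted_Gamma C (L I s F) = L I s (shifted_Gamma C F)"
proof -
  have "L I s (G - H) = L I s G - L I s H" for G H
    using L_add [of I s "G - H" H] by simp
  then show ?thesis
    by (simp add: shifted_Gamma_eq L_pscale L_add assms polys_mult polys_vec_var flip: assms(2))
qed

end

section \<open>Monogenic eigenfunctions and operators compatible with \<open>P_M\<close>\<close>

lemma shifted_Gamma_eigen:
  assumes "finite A" "dirac A X = 0" "euler A X = pscale (of_nat k) X"
  shows "shifted_Gamma A X = pscale (- (of_nat k + (of_nat (card A) - 1) / 2)) X"
proof -
  \<comment> \<open>Since \<open>dirac A X = 0\<close>, only the anticommutator
    \<open>- (2 E + d)\<close> and the constant 1 remain.\<close>
  have "dirac A (vec_var A * X) - vec_var A * dirac A X + X =
      pscale (- (of_nat k + of_nat k + of_nat (card A)) + 1) X"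
    by (simp only: dirac_vec_var [OF assms(1)] assms(2,3) cpoly.scale_left_distrib
        cpoly.scale_minus_left) simp
  moreover have "1 / 2 * (- (of_nat k + of_nat k + of_nat (card A)) + 1) =
      - (of_nat k + (of_nat (card A) - 1) / 2 :: complex)"
    by (simp add: field_simps)
  ultimately show ?thesis
    by (simp only: shifted_Gamma_eq cpoly.scale_scale)
qed

text \<open>Applying \<open>dirac A\<close> removes one factor \<open>vec_var A\<close> and leaves a
  nonzero constant.\<close>

lemma vec_var_power_nonzero:
  assumes "finite A" "A \<noteq> {}" "dirac A X = 0" "euler A X = pscale (of_nat k) X" "X \<noteq> 0"
  shows "vec_var A ^ n * X \<noteq> 0"
proof (induction n)
  case (Suc n)
  have "fischer_const (card A) k (Suc n) \<noteq> 0"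
    using assms by (intro fischer_const_nz) (auto simp: card_gt_0_iff)
  then have "dirac A (vec_var A ^ Suc n * X) \<noteq> 0"
    using Suc by (simp only: dirac_vec_var_power [OF assms(1,3,4)]) simp
  then show ?case by auto
qed (simp add: assms)

text \<open>\<open>P_M_intertwine\<close> does not cover the Euler operator, which passes
  \<open>vec_var I\<close> with an additive correction instead of a scalar. The correction is again
  a multiple of \<open>vec_var I\<close>, so the splitting is still preserved.\<close>

lemma P_M_euler:
  assumes "finite I" "I \<noteq> {}" "F \<in> polys I" "euler I F = pscale z F"
  shows "euler I (P_M I F) = pscale z (P_M I F)"
proof -
  obtain K where K: "K \<in> polys I" "F = P_M I F + vec_var I * K"
    using P_M_diff assms by blast
  have M: "P_M I F \<in> polys I" "dirac I (P_M I F) = 0"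
    using P_M_monogenic [OF assms(1-3)] by (auto simp: monogenic_def)
  have "euler I F = euler I (P_M I F) + vec_var I * (K + euler I K)"
    by (subst K(2)) (simp add: euler_add euler_vec_var [OF assms(1)] distrib_left)
  moreover have "euler I (P_M I F) \<in> monogenic I"
    using M by (auto simp: monogenic_def dirac_euler [OF assms(1)] intro: polys_euler)
  ultimately have "P_M I (euler I F) = euler I (P_M I F)"
    using assms(3) K(1)
    by (intro P_M_eqI [OF assms(1,2), where K = "K + euler I K"] polys_add polys_euler subset_refl)
  then show ?thesis
    using P_M_pscale [OF assms(1-3)] assms(4) by simp
qed

text \<open>The common features of \<open>S\<^sub>u\<close>, \<open>S\<^sub>v\<close>, \<open>\<Gamma>\<^sub>x - (m - 1) / 2\<close> and of the operator
  \<open>reflection\<close> below: they are self-adjoint and commute with \<open>x\<close> and \<open>\<partial>\<^sub>x\<close> up to the same sign.\<close>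

definition sym_op :: "nat set \<Rightarrow> complex \<Rightarrow> (cpoly \<Rightarrow> cpoly) \<Rightarrow> bool" where
  "sym_op I \<sigma> T \<longleftrightarrow>
    (\<forall>F G. T (F + G) = T F + T G) \<and> (\<forall>z F. T (pscale z F) = pscale z (T F)) \<and>
    (\<forall>F\<in>polys I. T F \<in> polys I) \<and> \<sigma> * \<sigma> = 1 \<and>
    (\<forall>F. T (vec_var I * F) = pscale \<sigma> (vec_var I * T F)) \<and>
    (\<forall>F. dirac I (T F) = pscale \<sigma> (T (dirac I F))) \<and>
    (\<forall>F G. fischer (T F) G = fischer F (T G))"

lemma sym_op_P_M_eigen:
  assumes "sym_op I \<sigma> T" "finite I" "I \<noteq> {}" "F \<in> polys I" "T F = pscale z F"
  shows "T (P_M I F) = pscale z (P_M I F)"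
proof -
  have "T (P_M I F) = P_M I (T F)"
    using assms(1) by (intro P_M_intertwine [OF assms(2-4), where a = \<sigma> and b = \<sigma>]) (auto simp: sym_op_def)
  then show ?thesis using P_M_pscale [OF assms(2-4)] assms(5) by simp
qed

text \<open>Up to a constant term the operator \<open>shifted_Gamma I\<close> is made of products of
  \<open>vec_var I\<close> and \<open>dirac I\<close>, and \<open>\<sigma>\<close> enters
  twice.\<close>

lemma sym_op_shifted_Gamma:
  assumes "sym_op I \<sigma> T"
  shows "T (shifted_Gamma I F) = shifted_Gamma I (T F)"
proof -
  have T: "T (F + G) = T F + T G" "T (pscale z F) = pscale z (T F)"
    "T (vec_var I * F) = pscale \<sigma> (vec_var I * T F)" "dirac I (T F) = pscale \<sigma> (T (dirac I F))"
    "\<sigma> * \<sigma> = 1" for F G z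
    using assms by (auto simp: sym_op_def)
  have "T (dirac I F) = pscale \<sigma> (dirac I (T F))" for F
    by (simp add: T(4,5))
  moreover have "T (F - G) = T F - T G" for F G
    using T(1) [of "F - G" G] by simp
  ultimately show ?thesis
    by (simp add: shifted_Gamma_eq T(1-3,5) dirac_pscale pscale_mult_right)
qed

lemma sym_op_orthogonal:
  assumes "sym_op I \<sigma> T" "T F = pscale a F" "T G = pscale b G" "cnj a \<noteq> b"
  shows "fischer F G = 0"
proof -
  have "fischer (T F) G = fischer F (T G)" using assms(1) by (simp add: sym_op_def)
  then show ?thesis
    using assms(2-4) by (simp add: fischer_pscale_left fischer_pscale_right)
qed

lemma power_vec_var_eigen:
  assumes "\<And>F. T (vec_var A * F) = pscale \<tau> (vec_var A * T F)" "T X = pscale z X"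
  shows "T (vec_var A ^ n * X) = pscale (\<tau> ^ n * z) (vec_var A ^ n * X)"
  by (induction n) (simp_all add: assms mult.assoc pscale_mult_right)

section \<open>Joint eigenspaces\<close>

lemma euler_union: "finite A \<Longrightarrow> finite B \<Longrightarrow> A \<inter> B = {} \<Longrightarrow> euler (A \<union> B) F = euler A F + euler B F"
  by (simp add: euler_def sum.union_disjoint)

definition reflection :: "nat \<Rightarrow> cpoly \<Rightarrow> cpoly" where
  "reflection p F = pconst (c_e_P p) * reflect {1..p} F"

text \<open>In this and the following definitions \<open>s\<close> is the full exponent of
  \<open>u\<close>: for \<open>spec_u\<close>, \<open>spec_v\<close> and
  \<open>spec_reflection\<close> the value on \<open>P Q\<close> is multiplied by one sign for each
  factor \<open>u\<close>. The two families of building blocks are then the even and the odd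
  exponents.\<close>

definition spec_u :: "nat \<Rightarrow> nat \<Rightarrow> nat \<Rightarrow> pm \<Rightarrow> complex" where
  "spec_u p s k \<epsilon> = ((-1) ^ p) ^ s * (pm_value \<epsilon> * (- (of_nat k + (of_nat p - 1) / 2)))"

definition spec_v :: "nat \<Rightarrow> nat \<Rightarrow> nat \<Rightarrow> nat \<Rightarrow> pm \<Rightarrow> complex" where
  "spec_v p q s i \<epsilon> = (- ((-1) ^ p)) ^ s * (pm_value \<epsilon> * (- (of_nat i + (of_nat q - 1) / 2)))"

definition spec_x :: "nat \<Rightarrow> nat \<Rightarrow> nat \<Rightarrow> nat \<Rightarrow> nat \<Rightarrow> complex" where
  "spec_x p q s k i = - (of_nat (s + k + i) + (of_nat (p + q) - 1) / 2)"

definition spec_reflection :: "nat \<Rightarrow> nat \<Rightarrow> nat \<Rightarrow> pm \<Rightarrow> complex" where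
  "spec_reflection p s k \<epsilon> = ((-1) ^ p) ^ s * (pm_value \<epsilon> * (-1) ^ k)"

lemma cnj_pm_value [simp]: "cnj (pm_value \<epsilon>) = pm_value \<epsilon>"
  by (cases \<epsilon>) auto

lemma norm_pm_value [simp]: "cmod (pm_value \<epsilon>) = 1"
  by (cases \<epsilon>) auto

lemma pm_value_inject: "pm_value \<epsilon> = pm_value \<epsilon>' \<longleftrightarrow> \<epsilon> = \<epsilon>'"
  by (cases \<epsilon>; cases \<epsilon>') auto

lemma spec_cnj:
  "cnj (spec_u p s k \<epsilon>) = spec_u p s k \<epsilon>" "cnj (spec_v p q s i \<epsilon>) = spec_v p q s i \<epsilon>"
  "cnj (spec_x p q s k i) = spec_x p q s k i" "cnj (spec_reflection p s k \<epsilon>) = spec_reflection p s k \<epsilon>"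
  by (simp_all add: spec_u_def spec_v_def spec_x_def spec_reflection_def)

lemma norm_shifted_degree:
  assumes "d \<ge> 1" shows "cmod (- (of_nat k + (of_nat d - 1) / 2)) = of_nat k + (of_nat d - 1) / 2"
proof -
  have "of_nat k + (of_nat d - 1) / 2 = (of_real (of_nat k + (of_nat d - 1) / 2) :: complex)"
    by simp
  then show ?thesis
    using assms by (simp only: norm_minus_cancel norm_of_real) simp
qed

lemma norm_spec:
  "p \<ge> 1 \<Longrightarrow> cmod (spec_u p s k \<epsilon>) = of_nat k + (of_nat p - 1) / 2"
  "q \<ge> 1 \<Longrightarrow> cmod (spec_v p q s i \<epsilon>) = of_nat i + (of_nat q - 1) / 2"
  unfolding spec_u_def spec_v_def norm_mult norm_power norm_shifted_degree
  by (simp_all add: norm_mult norm_power)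

text \<open>The signs depend on \<open>s\<close> and \<open>\<epsilon>\<close>, but the moduli of
  the first two eigenvalues already give \<open>k\<close> and \<open>i\<close>; the third one then
  gives \<open>s\<close>.\<close>

lemma spec_determines_labels:
  assumes "p \<ge> 1" "q \<ge> 1" "spec_u p s k \<epsilon> = spec_u p s' k' \<epsilon>'"
    "spec_v p q s i \<epsilon> = spec_v p q s' i' \<epsilon>'" "spec_x p q s k i = spec_x p q s' k' i'"
  shows "s = s' \<and> k = k' \<and> i = i'"
proof -
  have "k = k'"
    using arg_cong [OF assms(3), of cmod] by (simp add: norm_spec(1) [OF assms(1)])
  moreover have "i = i'"
    using arg_cong [OF assms(4), of cmod] by (simp add: norm_spec(2) [OF assms(2)])
  moreover have "(of_nat (s + k + i) :: complex) = of_nat (s' + k' + i')"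
    using assms(5) unfolding spec_x_def by (simp del: of_nat_add)
  then have "s + k + i = s' + k' + i'" by (simp only: of_nat_eq_iff)
  ultimately show ?thesis by simp
qed

lemma eigenvalues_eq_spec:
  "eigenvalues p q b \<epsilon> s k i =
    (spec_u p (2 * s + of_bool b) k \<epsilon>, spec_v p q (2 * s + of_bool b) i \<epsilon>,
     spec_x p q (2 * s + of_bool b) k i)"
proof -
  have sq: "((-1) ^ p) ^ (2 * s) = (1 :: complex)" "(- ((-1) ^ p)) ^ (2 * s) = (1 :: complex)" for p s
    by (simp_all add: power_mult power2_eq_square flip: power_mult_distrib)
  have pow: "((-1) ^ p) ^ (2 * s + of_bool b) = (if b then (-1) ^ p else 1 :: complex)"
    "(- ((-1) ^ p)) ^ (2 * s + of_bool b) = (if b then - ((-1) ^ p) else 1 :: complex)"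
    by (cases b; simp only: power_add sq of_bool_eq if_True if_False power_one_right power_0 mult_1_left mult_1_right)+
  show ?thesis
    unfolding spec_u_def spec_v_def spec_x_def pow by (cases b; cases \<epsilon>) (simp_all add: field_simps)
qed

lemma c_e_P_vec_var:
  "pconst (c_e_P p) * (vec_var {1..p} * F) = pscale (- ((-1) ^ p)) (vec_var {1..p} * (pconst (c_e_P p) * F))"
  "pconst (c_e_P p) * (vec_var {p + 1..p + q} * F) =
    pscale ((-1) ^ p) (vec_var {p + 1..p + q} * (pconst (c_e_P p) * F))"
  by (rule pconst_vec_var; simp add: c_e_P_gen)+

lemma c_e_P_dirac:
  "pconst (c_e_P p) * dirac {1..p} F = pscale (- ((-1) ^ p)) (dirac {1..p} (pconst (c_e_P p) * F))"
  "pconst (c_e_P p) * dirac {p + 1..p + q} F =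
    pscale ((-1) ^ p) (dirac {p + 1..p + q} (pconst (c_e_P p) * F))"
  by (rule pconst_dirac; simp add: c_e_P_gen)+

lemma minus_one_power_sq: "(-1) ^ p * (-1) ^ p = (1 :: complex)"
  by (simp flip: power_mult_distrib)

lemma c_e_P_shifted_Gamma:
  "pconst (c_e_P p) * shifted_Gamma {1..p} F = shifted_Gamma {1..p} (pconst (c_e_P p) * F)"
  "pconst (c_e_P p) * shifted_Gamma {p + 1..p + q} F = shifted_Gamma {p + 1..p + q} (pconst (c_e_P p) * F)"
  by (rule pconst_shifted_Gamma [where z = "- ((-1) ^ p)"]; simp add: c_e_P_gen minus_one_power_sq)
    (rule pconst_shifted_Gamma [where z = "(-1) ^ p"]; simp add: c_e_P_gen minus_one_power_sq)

section \<open>The blocks of \<open>u\<close> and \<open>v\<close> and the four operators on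
  them\<close>

context
  fixes p q :: nat
  assumes p: "p \<ge> 1" and q: "q \<ge> 1"
begin

declare One_nat_def [simp del]

private abbreviation (input) "U \<equiv> {1..p}"
private abbreviation (input) "W \<equiv> {p + 1..p + q}"
private abbreviation (input) "X \<equiv> {1..p + q}"

lemma blocks: "X = U \<union> W" "U \<inter> W = {}" "W \<inter> U = {}" "finite U" "finite W" "finite X" "W \<noteq> {}" "X \<noteq> {}"
  "0 \<notin> U" "U \<subseteq> X" "W \<subseteq> X" "U \<noteq> {}"
  using p q by auto

lemma vec_var_X: "vec_var X = vec_var U + vec_var W"
  unfolding blocks(1) by (rule vec_var_union [OF blocks(4,5,2)])

lemma dirac_X: "dirac X F = dirac U F + dirac W F"
  unfolding blocks(1) by (rule dirac_union [OF blocks(4,5,2)])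

text \<open>The sign must be the same for both blocks; only then do the rules add up to rules for
  \<open>vec_var X\<close> and \<open>dirac X\<close>.\<close>

lemma sym_opI:
  assumes "\<And>F G. T (F + G) = T F + T G" "\<And>z F. T (pscale z F) = pscale z (T F)"
    "\<And>F. F \<in> polys X \<Longrightarrow> T F \<in> polys X" "\<sigma> * \<sigma> = 1"
    "\<And>F. T (vec_var U * F) = pscale \<sigma> (vec_var U * T F)" "\<And>F. T (vec_var W * F) = pscale \<sigma> (vec_var W * T F)"
    "\<And>F. T (dirac U F) = pscale \<sigma> (dirac U (T F))" "\<And>F. T (dirac W F) = pscale \<sigma> (dirac W (T F))"
    "\<And>F G. fischer (T F) G = fischer F (T G)"
  shows "sym_op X \<sigma> T"
  unfolding sym_op_def
proof (intro conjI allI ballI)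
  fix F
  show "T (vec_var X * F) = pscale \<sigma> (vec_var X * T F)"
    by (simp only: vec_var_X distrib_right assms(1,5,6) cpoly.scale_right_distrib)
  show "dirac X (T F) = pscale \<sigma> (T (dirac X F))"
    by (simp add: dirac_X assms(1,7,8,4) cpoly.scale_right_distrib)
qed (use assms(1-4,9) in auto)

lemma S_u_vec_var:
  "S_u p (vec_var U * F) = pscale ((-1) ^ p) (vec_var U * S_u p F)"
  "S_u p (vec_var W * F) = pscale ((-1) ^ p) (vec_var W * S_u p F)"
  by (simp_all add: S_u_def shifted_Gamma_vec_var shifted_Gamma_vec_var_disjoint c_e_P_vec_var
      cpoly.scale_minus_left del: One_nat_def add_Suc_right)

lemma S_v_vec_var:
  "S_v p q (vec_var U * F) = pscale (- ((-1) ^ p)) (vec_var U * S_v p q F)"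
  "S_v p q (vec_var W * F) = pscale (- ((-1) ^ p)) (vec_var W * S_v p q F)"
  unfolding S_v_def shifted_Gamma_vec_var [OF blocks(5)] shifted_Gamma_vec_var_disjoint [OF blocks(3)]
    mult_minus_right c_e_P_vec_var cpoly.scale_minus_left by simp_all

lemma S_u_dirac:
  "S_u p (dirac U F) = pscale ((-1) ^ p) (dirac U (S_u p F))"
  "S_u p (dirac W F) = pscale ((-1) ^ p) (dirac W (S_u p F))"
  unfolding S_u_def shifted_Gamma_dirac [OF blocks(4)] shifted_Gamma_dirac_disjoint [OF blocks(2)]
    mult_minus_right c_e_P_dirac cpoly.scale_minus_left by simp_all

lemma S_v_dirac:
  "S_v p q (dirac U F) = pscale (- ((-1) ^ p)) (dirac U (S_v p q F))"
  "S_v p q (dirac W F) = pscale (- ((-1) ^ p)) (dirac W (S_v p q F))"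
  unfolding S_v_def shifted_Gamma_dirac [OF blocks(5)] shifted_Gamma_dirac_disjoint [OF blocks(3)]
    mult_minus_right c_e_P_dirac cpoly.scale_minus_left by simp_all

lemma reflection_vec_var:
  "reflection p (vec_var U * F) = pscale ((-1) ^ p) (vec_var U * reflection p F)"
  "reflection p (vec_var W * F) = pscale ((-1) ^ p) (vec_var W * reflection p F)"
  unfolding reflection_def reflect_mult reflect_vec_var reflect_vec_var_disjoint [OF blocks(2)]
    mult_minus_left mult_minus_right c_e_P_vec_var cpoly.scale_minus_left by simp_all

lemma reflection_dirac:
  "reflection p (dirac U F) = pscale ((-1) ^ p) (dirac U (reflection p F))"
  "reflection p (dirac W F) = pscale ((-1) ^ p) (dirac W (reflection p F))"
proof -
  have "reflect U (dirac U F) = - dirac U (reflect U F)" by (simp add: dirac_reflect)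
  then show "reflection p (dirac U F) = pscale ((-1) ^ p) (dirac U (reflection p F))"
    unfolding reflection_def by (simp only: mult_minus_right c_e_P_dirac cpoly.scale_minus_left minus_minus)
  show "reflection p (dirac W F) = pscale ((-1) ^ p) (dirac W (reflection p F))"
    unfolding reflection_def dirac_reflect_disjoint [OF blocks(2), symmetric]
    by (rule c_e_P_dirac)
qed

lemma
  shows sym_op_S_u: "sym_op X ((-1) ^ p) (S_u p)"
    and sym_op_S_v: "sym_op X (- ((-1) ^ p)) (S_v p q)"
    and sym_op_Gamma: "sym_op X (-1) (shifted_Gamma X)"
    and sym_op_reflection: "sym_op X ((-1) ^ p) (reflection p)"
proof -
  have c: "pconst (c_e_P p) \<in> polys X"
    by (intro polys_pconst Cl_c_e_P) auto
  show "sym_op X ((-1) ^ p) (S_u p)"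
  proof (rule sym_opI [OF _ _ _ minus_one_power_sq S_u_vec_var S_u_dirac])
    show "fischer (S_u p F) G = fischer F (S_u p G)" for F G
      unfolding S_u_def c_e_P_shifted_Gamma fischer_shifted_Gamma fischer_pconst_mult cbar_c_e_P ..
  qed (auto simp: S_u_def shifted_Gamma_add shifted_Gamma_pscale distrib_left pscale_mult_right
      intro!: polys_mult c polys_shifted_Gamma)
  show "sym_op X (- ((-1) ^ p)) (S_v p q)"
  proof (rule sym_opI [OF _ _ _ _ S_v_vec_var S_v_dirac])
    show "fischer (S_v p q F) G = fischer F (S_v p q G)" for F G
      unfolding S_v_def c_e_P_shifted_Gamma fischer_shifted_Gamma fischer_pconst_mult cbar_c_e_P ..
  qed (auto simp: S_v_def shifted_Gamma_add shifted_Gamma_pscale distrib_left pscale_mult_right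
      minus_one_power_sq intro!: polys_mult c polys_shifted_Gamma)
  show "sym_op X ((-1) ^ p) (reflection p)"
  proof (rule sym_opI [OF _ _ _ minus_one_power_sq reflection_vec_var reflection_dirac])
    show "fischer (reflection p F) G = fischer F (reflection p G)" for F G
      by (simp add: reflection_def fischer_pconst_mult fischer_reflect reflect_mult)
  qed (auto simp: reflection_def reflect_add reflect_pscale distrib_left pscale_mult_right
      intro!: polys_mult c reflect_polys)
  show "sym_op X (-1) (shifted_Gamma X)"
    unfolding sym_op_def
    by (simp add: shifted_Gamma_add shifted_Gamma_pscale polys_shifted_Gamma shifted_Gamma_vec_var
        shifted_Gamma_dirac fischer_shifted_Gamma pscale_minus_one)
qed

text \<open>The pseudoscalar commutes with both shifted Gamma operators and squares to 1, so both
  sides reduce to products of shifted Gamma operators over disjoint blocks.\<close>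

lemma S_u_S_v_commute: "S_u p (S_v p q F) = S_v p q (S_u p F)"
proof -
  have cc: "pconst (c_e_P p) * (pconst (c_e_P p) * G) = G" for G
    by (simp flip: mult.assoc pconst_mult)
  show ?thesis
    unfolding S_u_def S_v_def c_e_P_shifted_Gamma [symmetric] cc
    by (rule shifted_Gamma_commute [OF blocks(2)])
qed

section \<open>Joint eigenspaces and the building blocks in them\<close>

definition joint_space :: "nat \<times> nat \<times> nat \<times> pm \<Rightarrow> cpoly set" where
  "joint_space = (\<lambda>(s, k, i, \<epsilon>). {F \<in> monogenic X.
     S_u p F = pscale (spec_u p s k \<epsilon>) F \<and> S_v p q F = pscale (spec_v p q s i \<epsilon>) F \<and>
     shifted_Gamma X F = pscale (spec_x p q s k i) F \<and>
     reflection p F = pscale (spec_reflection p s k \<epsilon>) F})"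

lemma joint_space_orthogonal:
  assumes "l \<noteq> l'" "F \<in> joint_space l" "G \<in> joint_space l'"
  shows "fischer F G = 0"
proof (rule ccontr)
  assume nz: "fischer F G \<noteq> 0"
  obtain s k i \<epsilon> where l: "l = (s, k, i, \<epsilon>)" by (metis prod_cases4)
  obtain s' k' i' \<epsilon>' where l': "l' = (s', k', i', \<epsilon>')" by (metis prod_cases4)
  have eq: "a = b" if "sym_op X \<sigma> T" "cnj a = a" "T F = pscale a F" "T G = pscale b G" for T \<sigma> a b
    using sym_op_orthogonal [OF that(1,3,4)] nz that(2) by auto
  note FG = assms(2,3)[unfolded l l' joint_space_def prod.case mem_Collect_eq]
  have "spec_u p s k \<epsilon> = spec_u p s' k' \<epsilon>'"
    using FG by (intro eq [OF sym_op_S_u spec_cnj(1)]) blast+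
  moreover have "spec_v p q s i \<epsilon> = spec_v p q s' i' \<epsilon>'"
    using FG by (intro eq [OF sym_op_S_v spec_cnj(2)]) blast+
  moreover have "spec_x p q s k i = spec_x p q s' k' i'"
    using FG by (intro eq [OF sym_op_Gamma spec_cnj(3)]) blast+
  ultimately have labels: "s = s' \<and> k = k' \<and> i = i'"
    by (rule spec_determines_labels [OF p q])
  have "spec_reflection p s k \<epsilon> = spec_reflection p s' k' \<epsilon>'"
    using FG by (intro eq [OF sym_op_reflection spec_cnj(4)]) blast+
  with labels have "\<epsilon> = \<epsilon>'"
    by (simp add: spec_reflection_def pm_value_inject)
  with labels assms(1) l l' show False by simp
qed

lemma subspace_joint_space: "cpoly.subspace (joint_space l)"
proof -
  have "cpoly.subspace {F. T F = pscale z F}" if "sym_op X \<sigma> T" for T z \<sigma>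
  proof -
    have T: "T (F + G) = T F + T G" "T (pscale z F) = pscale z (T F)" for F G z
      using that by (auto simp: sym_op_def)
    then have "T 0 = 0" by (metis cpoly.scale_zero_left)
    then show ?thesis
      by (intro cpoly.subspaceI) (auto simp: T cpoly.scale_right_distrib mult.commute)
  qed
  note S = this [OF sym_op_S_u] this [OF sym_op_S_v] this [OF sym_op_Gamma] this [OF sym_op_reflection]
  obtain s k i \<epsilon> where l: "l = (s, k, i, \<epsilon>)" by (metis prod_cases4)
  have "joint_space l = monogenic X \<inter> ({F. S_u p F = pscale (spec_u p s k \<epsilon>) F} \<inter>
      ({F. S_v p q F = pscale (spec_v p q s i \<epsilon>) F} \<inter>
      ({F. shifted_Gamma X F = pscale (spec_x p q s k i) F} \<inter>
       {F. reflection p F = pscale (spec_reflection p s k \<epsilon>) F})))"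
    by (auto simp: joint_space_def l)
  then show ?thesis
    using S subspace_monogenic by (simp only: cpoly.subspace_inter)
qed

lemma
  assumes K: "K \<in> monogenic_pm p \<epsilon> k" and G: "G \<in> monogenic_deg W i"
  shows building_block_in_joint_space: "P_M X (vec_var U ^ s * (K * G)) \<in> joint_space (s, k, i, \<epsilon>)"
    and building_block_nonzero: "K \<noteq> 0 \<Longrightarrow> G \<noteq> 0 \<Longrightarrow> P_M X (vec_var U ^ s * (K * G)) \<noteq> 0"
proof -
  have K1: "K \<in> monogenic_deg U k" and K2: "pconst (c_e_P p) * K = pscale (pm_value \<epsilon>) K"
    using K by (auto simp: monogenic_pm_def)
  note K3 = monogenic_degD [OF blocks(4) K1]
  note G3 = monogenic_degD [OF blocks(5) G]
  let ?Y = "K * G"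
  let ?F = "vec_var U ^ s * ?Y"
  have c: "pconst (c_e_P p) * ?Y = pscale (pm_value \<epsilon>) ?Y"
    by (simp add: K2 pscale_mult_left flip: mult.assoc)
  have dU: "dirac U ?Y = 0" and eU: "euler U ?Y = pscale (of_nat k) ?Y"
    using dirac_left_mult [OF blocks(2,9) G3(1), of K] euler_left_mult [OF blocks(2,9) G3(1), of K]
    by (simp_all add: K3 pscale_mult_left)
  \<comment> \<open>All powers are treated at once by viewing \<open>vec_var U ^ n * K\<close> as a
    polynomial in \<open>u\<close> alone. The case \<open>n = 0\<close> serves for
    \<open>S_v\<close>, the general one for the degree and for nonvanishing.\<close>
  have dW: "dirac W (vec_var U ^ n * ?Y) = 0" and eW: "euler W (vec_var U ^ n * ?Y) = pscale (of_nat i) (vec_var U ^ n * ?Y)" for n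
  proof -
    have uK: "vec_var U ^ n * K \<in> polys U"
      by (intro polys_mult polys_power polys_vec_var K3) simp
    show "dirac W (vec_var U ^ n * ?Y) = 0" "euler W (vec_var U ^ n * ?Y) = pscale (of_nat i) (vec_var U ^ n * ?Y)"
      using dirac_right_mult [OF blocks(2,9) uK, of G] euler_right_mult [OF blocks(2,9) uK, of G]
      by (simp_all add: G3 pscale_mult_right mult.assoc)
  qed
  have F: "?F \<in> polys X"
    by (intro polys_mult polys_power polys_vec_var blocks(10) polys_mono [OF blocks(10) K3(1)]
        polys_mono [OF blocks(11) G3(1)])
  have "shifted_Gamma U ?Y = pscale (- (of_nat k + (of_nat p - 1) / 2)) ?Y"
    using shifted_Gamma_eigen [OF blocks(4) dU eU] by simp
  then have "S_u p ?Y = pscale (pm_value \<epsilon> * (- (of_nat k + (of_nat p - 1) / 2))) ?Y"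
    by (simp only: S_u_def pscale_mult_right c cpoly.scale_scale mult.commute)
  from power_vec_var_eigen [of "S_u p", OF S_u_vec_var(1) this]
  have Su: "S_u p ?F = pscale (spec_u p s k \<epsilon>) ?F"
    by (simp only: spec_u_def)
  have "shifted_Gamma W ?Y = pscale (- (of_nat i + (of_nat q - 1) / 2)) ?Y"
    using shifted_Gamma_eigen [OF blocks(5), of ?Y i] dW [of 0] eW [of 0] by simp
  then have "S_v p q ?Y = pscale (pm_value \<epsilon> * (- (of_nat i + (of_nat q - 1) / 2))) ?Y"
    by (simp only: S_v_def pscale_mult_right c cpoly.scale_scale mult.commute)
  from power_vec_var_eigen [of "S_v p q", OF S_v_vec_var(1) this]
  have Sv: "S_v p q ?F = pscale (spec_v p q s i \<epsilon>) ?F"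
    by (simp only: spec_v_def)
  have "reflection p ?Y = pscale (pm_value \<epsilon> * (-1) ^ k) ?Y"
    by (simp only: reflection_def reflect_homogeneous [OF blocks(4) eU] pscale_mult_right c
        cpoly.scale_scale mult.commute)
  from power_vec_var_eigen [of "reflection p", OF reflection_vec_var(1) this]
  have R: "reflection p ?F = pscale (spec_reflection p s k \<epsilon>) ?F"
    by (simp only: spec_reflection_def)
  have "euler X ?F = pscale (of_nat (s + k + i)) ?F"
    unfolding blocks(1) euler_union [OF blocks(4,5,2)] euler_vec_var_power [OF blocks(4) eU] eW
    by (simp add: cpoly.scale_left_distrib)
  \<comment> \<open>\<open>?F\<close> itself need not be monogenic, so the eigenvalue of
    \<open>shifted_Gamma X\<close> is obtained from the degree of its projection.\<close>
  then have e: "euler X (P_M X ?F) = pscale (of_nat (s + k + i)) (P_M X ?F)"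
    by (rule P_M_euler [OF blocks(6,8) F])
  have M: "P_M X ?F \<in> monogenic X" by (rule P_M_monogenic [OF blocks(6,8) F])
  then have "shifted_Gamma X (P_M X ?F) = pscale (spec_x p q s k i) (P_M X ?F)"
    using shifted_Gamma_eigen [OF blocks(6) _ e] by (simp add: monogenic_def spec_x_def)
  with M Su Sv R show "P_M X ?F \<in> joint_space (s, k, i, \<epsilon>)"
    by (simp add: joint_space_def sym_op_P_M_eigen [OF sym_op_S_u blocks(6,8) F]
        sym_op_P_M_eigen [OF sym_op_S_v blocks(6,8) F] sym_op_P_M_eigen [OF sym_op_reflection blocks(6,8) F]
        del: One_nat_def)
  assume "K \<noteq> 0" "G \<noteq> 0"
  then have "?Y \<noteq> 0" by (rule mult_disjoint_nonzero [OF K3(1) G3(1) blocks(2)])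
  then have "?F \<noteq> 0" by (rule vec_var_power_nonzero [OF blocks(4,12) dU eU])
  then show "P_M X ?F \<noteq> 0"
    using P_M_nonzero [OF blocks(4,5,2,7) F[unfolded blocks(1)] dW] unfolding blocks(1) by blast
qed

lemma summand_subset_joint_space: "summand p q l \<subseteq> joint_space l"
proof -
  obtain s k i \<epsilon> where l: "l = (s, k, i, \<epsilon>)" by (metis prod_cases4)
  show ?thesis
    unfolding l summand_def tau_M_image_def prod.case
  proof (rule cpoly.span_minimal [OF _ subspace_joint_space], safe)
    fix K G assume "K \<in> monogenic_pm p \<epsilon> k" "G \<in> monogenic_deg W i"
    then show "P_M X (vec_var U ^ s * K * G) \<in> joint_space (s, k, i, \<epsilon>)"
      unfolding mult.assoc by (rule building_block_in_joint_space)
  qed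
qed

lemma subspace_summand: "cpoly.subspace (summand p q l)"
  by (cases l) (simp add: summand_def tau_M_image_def)

lemma building_block_in_summand:
  assumes "K \<in> monogenic_pm p \<epsilon> k" "G \<in> monogenic_deg W i"
  shows "P_M X (vec_var U ^ s * (K * G)) \<in> summand p q (s, k, i, \<epsilon>)"
  unfolding summand_def tau_M_image_def prod.case mult.assoc [symmetric]
  using assms by (intro cpoly.span_base) blast

section \<open>The summands span the monogenic polynomials\<close>

lemma polys_product:
  assumes "K \<in> monogenic_deg U k" "G \<in> monogenic_deg W i"
  shows "vec_var W ^ j * (vec_var U ^ s * (K * G)) \<in> polys X"
  using polys_mono [OF blocks(10) monogenic_degD(1) [OF blocks(4) assms(1)]]
    polys_mono [OF blocks(11) monogenic_degD(1) [OF blocks(5) assms(2)]]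
  by (intro polys_mult polys_power polys_vec_var blocks(10,11))

private abbreviation (input) "summand_span \<equiv> cpoly.span (\<Union>l. summand p q l)"

text \<open>\<open>K\<close> is split by the idempotents \<open>(1 + c_e_P p) / 2\<close> and
  \<open>(1 - c_e_P p) / 2\<close>. They preserve \<open>monogenic_deg\<close> because the
  pseudoscalar passes the Dirac operator of the block up to sign.\<close>

lemma P_M_monogenic_product:
  assumes K: "K \<in> monogenic_deg U k" and G: "G \<in> monogenic_deg W i"
  shows "P_M X (vec_var U ^ s * (K * G)) \<in> summand_span"
proof -
  let ?c = "pconst (c_e_P p)"
  have cc: "?c * (?c * F) = F" for F
    by (simp flip: mult.assoc pconst_mult)
  note K3 = monogenic_degD [OF blocks(4) K]
  have cK: "?c * K \<in> polys U" "dirac U (?c * K) = 0" "euler U (?c * K) = pscale (of_nat k) (?c * K)"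
    using c_e_P_dirac(1) [of p K]
    by (auto simp: K3 euler_pconst_mult pscale_mult_right intro!: polys_mult polys_pconst Cl_c_e_P)
  have "pscale (1 / 2) (K + ?c * K) \<in> monogenic_deg U k" "pscale (1 / 2) (K - ?c * K) \<in> monogenic_deg U k"
    using K3 cK
    by (intro monogenic_degI blocks polys_pscale polys_add polys_diff;
      simp add: dirac_pscale dirac_add dirac_diff euler_pscale euler_add euler_diff
        cpoly.scale_right_distrib cpoly.scale_right_diff_distrib mult.commute)+
  then have Kpm: "pscale (1 / 2) (K + ?c * K) \<in> monogenic_pm p Plus k"
      "pscale (1 / 2) (K - ?c * K) \<in> monogenic_pm p Minus k"
    by (simp_all add: monogenic_pm_def pscale_mult_right distrib_left right_diff_distrib cc
        pscale_minus_one add.commute flip: cpoly.scale_minus_right)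
  have sum: "pscale (1 / 2) (K + ?c * K) + pscale (1 / 2) (K - ?c * K) = K"
  proof -
    have "pscale (1 / 2) (K + ?c * K) + pscale (1 / 2) (K - ?c * K) = pscale (1 / 2) (pscale 2 K)"
      unfolding pscale_two by (simp flip: cpoly.scale_right_distrib)
    then show ?thesis by simp
  qed
  have in_polys: "vec_var U ^ s * (K' * G) \<in> polys X" if "K' \<in> monogenic_pm p \<epsilon> k" for K' \<epsilon>
    using that polys_product [of K' k G i 0 s] G by (simp add: monogenic_pm_def)
  have "P_M X (vec_var U ^ s * ((pscale (1 / 2) (K + ?c * K) + pscale (1 / 2) (K - ?c * K)) * G)) =
      P_M X (vec_var U ^ s * (pscale (1 / 2) (K + ?c * K) * G)) +
      P_M X (vec_var U ^ s * (pscale (1 / 2) (K - ?c * K) * G))"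
    unfolding distrib_right distrib_left
    by (rule P_M_add [OF blocks(6,8) in_polys [OF Kpm(1)] in_polys [OF Kpm(2)], unfolded distrib_left distrib_right])
  also have "\<dots> \<in> summand_span"
    using building_block_in_summand [OF Kpm(1) G] building_block_in_summand [OF Kpm(2) G]
    by (intro cpoly.span_add cpoly.span_base) blast+
  finally show ?thesis by (simp only: sum)
qed

lemma P_M_vec_var_block:
  assumes "F \<in> polys X"
  shows "P_M X (vec_var W * F) = - P_M X (vec_var U * F)"
proof -
  have "P_M X (vec_var U * F) + P_M X (vec_var W * F) = P_M X (vec_var X * F)"
    unfolding vec_var_X distrib_right
    by (intro P_M_add [OF blocks(6,8), symmetric] polys_mult polys_vec_var blocks assms)
  also have "\<dots> = 0" by (rule P_M_vec_var [OF blocks(6,8) assms])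
  finally show ?thesis by (simp add: eq_neg_iff_add_eq_0 add.commute)
qed

lemma vec_var_swap_power:
  "vec_var U * (vec_var W ^ j * F) = pscale ((-1) ^ j) (vec_var W ^ j * (vec_var U * F))"
  by (induction j) (simp_all add: mult.assoc vec_var_disjoint [OF blocks(2)] pscale_mult_right
      cpoly.scale_minus_left)

text \<open>Induction on the power of \<open>v\<close>: each exchange of a \<open>v\<close> for
  \<open>- u\<close> raises the power of \<open>u\<close>, hence the generalisation over
  \<open>s\<close>.\<close>

lemma P_M_vec_var_product:
  assumes K: "K \<in> monogenic_deg U k" and G: "G \<in> monogenic_deg W i"
  shows "P_M X (vec_var W ^ j * (vec_var U ^ s * (K * G))) \<in> summand_span"
proof (induction j arbitrary: s)
  case 0
  show ?case using P_M_monogenic_product [OF K G] by simp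
next
  case (Suc j)
  let ?F = "vec_var W ^ j * (vec_var U ^ s * (K * G))"
  have "P_M X (vec_var W ^ Suc j * (vec_var U ^ s * (K * G))) = - P_M X (vec_var U * ?F)"
    using P_M_vec_var_block [OF polys_product [OF K G]] by (simp add: mult.assoc)
  also have "vec_var U * ?F = pscale ((-1) ^ j) (vec_var W ^ j * (vec_var U ^ Suc s * (K * G)))"
    unfolding vec_var_swap_power by (simp add: mult.assoc)
  also have "- P_M X \<dots> = pscale (- ((-1) ^ j)) (P_M X (vec_var W ^ j * (vec_var U ^ Suc s * (K * G))))"
    by (simp only: P_M_pscale [OF blocks(6,8) polys_product [OF K G]] cpoly.scale_minus_left)
  also have "\<dots> \<in> summand_span"
    by (intro cpoly.span_scale Suc.IH)
  finally show ?case .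
qed

text \<open>\<open>P_M\<close> is known to be linear only on \<open>polys X\<close>, so membership
  in \<open>polys X\<close> is carried along in the subspace.\<close>

lemma P_M_span_induct:
  assumes "F \<in> cpoly.span S" "S \<subseteq> polys X" "\<And>F. F \<in> S \<Longrightarrow> P_M X F \<in> cpoly.span T"
  shows "P_M X F \<in> cpoly.span T"
proof -
  have "cpoly.span S \<subseteq> {F \<in> polys X. P_M X F \<in> cpoly.span T}"
  proof (rule cpoly.span_minimal)
    show "cpoly.subspace {F \<in> polys X. P_M X F \<in> cpoly.span T}"
    proof (rule cpoly.subspaceI)
      have "P_M X 0 = 0" using P_M_vec_var [OF blocks(6,8), of 0] by simp
      then show "0 \<in> {F \<in> polys X. P_M X F \<in> cpoly.span T}" by (simp add: cpoly.span_zero)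
    qed (auto simp: P_M_add [OF blocks(6,8)] P_M_pscale [OF blocks(6,8)]
        intro: polys_add polys_pscale cpoly.span_add cpoly.span_scale)
  qed (use assms in blast)
  with assms(1) show ?thesis by blast
qed

lemma P_M_mult_in_span:
  assumes "K \<in> polys U" "G \<in> polys W"
  shows "P_M X (K * G) \<in> summand_span"
proof -
  let ?SU = "{vec_var U ^ s * K | s k K. K \<in> monogenic_deg U k}"
  let ?SW = "{vec_var W ^ s * K | s k K. K \<in> monogenic_deg W k}"
  let ?S = "{K * G | K G. K \<in> ?SU \<and> G \<in> ?SW}"
  have S: "F \<in> polys X \<and> P_M X F \<in> summand_span" if F: "F \<in> ?S" for F
  proof -
    obtain M N where MN: "F = M * N" "M \<in> ?SU" "N \<in> ?SW" using F by blast
    obtain s k K where M: "M = vec_var U ^ s * K" "K \<in> monogenic_deg U k" using MN(2) by blast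
    obtain j i G where N: "N = vec_var W ^ j * G" "G \<in> monogenic_deg W i" using MN(3) by blast
    \<comment> \<open>The powers of \<open>v\<close> have to be brought to the front; passing
      \<open>K\<close> changes it only by main involutions.\<close>
    obtain K' where K': "K' \<in> monogenic_deg U k" "K * (vec_var W ^ j * G) = vec_var W ^ j * (K' * G)"
      using mult_vec_var_power [OF blocks(2,9,4) M(2)] by blast
    have swap: "vec_var U ^ s * (vec_var W ^ j * H) = pscale (((-1) ^ j) ^ s) (vec_var W ^ j * (vec_var U ^ s * H))" for H
    proof (induction s)
      case (Suc s)
      then show ?case
        by (simp add: mult.assoc pscale_mult_right vec_var_swap_power mult.commute)
    qed simp
    have "F = pscale (((-1) ^ j) ^ s) (vec_var W ^ j * (vec_var U ^ s * (K' * G)))"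
      unfolding MN(1) M(1) N(1) mult.assoc K'(2) swap ..
    then show ?thesis
      using polys_product [OF K'(1) N(2)] P_M_vec_var_product [OF K'(1) N(2)]
      by (simp add: P_M_pscale [OF blocks(6,8)] polys_pscale cpoly.span_scale)
  qed
  \<comment> \<open>Bilinearity of the product, handled in one factor at a time by two nested span
    arguments.\<close>
  have "cpoly.span ?SU \<subseteq> {K. \<forall>G\<in>cpoly.span ?SW. K * G \<in> cpoly.span ?S}"
  proof (rule cpoly.span_minimal)
    show "cpoly.subspace {K. \<forall>G\<in>cpoly.span ?SW. K * G \<in> cpoly.span ?S}"
      by (rule cpoly.subspaceI)
        (auto simp: distrib_right pscale_mult_left intro: cpoly.span_zero cpoly.span_add cpoly.span_scale)
    show "?SU \<subseteq> {K. \<forall>G\<in>cpoly.span ?SW. K * G \<in> cpoly.span ?S}"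
    proof (intro subsetI CollectI)
      fix K assume K: "K \<in> ?SU"
      have "cpoly.span ?SW \<subseteq> {G. K * G \<in> cpoly.span ?S}"
      proof (rule cpoly.span_minimal)
        show "cpoly.subspace {G. K * G \<in> cpoly.span ?S}"
          by (rule cpoly.subspaceI)
            (auto simp: distrib_left pscale_mult_right intro: cpoly.span_zero cpoly.span_add cpoly.span_scale)
        show "?SW \<subseteq> {G. K * G \<in> cpoly.span ?S}"
          using K by (intro subsetI CollectI cpoly.span_base) blast
      qed
      then show "\<forall>G\<in>cpoly.span ?SW. K * G \<in> cpoly.span ?S" by blast
    qed
  qed
  then have "K * G \<in> cpoly.span ?S"
    using polys_in_span_fischer_pieces [OF blocks(4,12) assms(1)]
      polys_in_span_fischer_pieces [OF blocks(5,7) assms(2)] by blast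
  then show ?thesis
    by (rule P_M_span_induct) (use S in blast)+
qed

lemma monogenic_spanned:
  assumes "F \<in> monogenic X"
  shows "F \<in> summand_span"
proof -
  have "F \<in> polys (U \<union> W)" using assms by (simp add: monogenic_def flip: blocks(1))
  then have "F \<in> cpoly.span {K * G | K G. K \<in> polys U \<and> G \<in> polys W}"
    by (rule polys_split [OF _ blocks(2)])
  then have "P_M X F \<in> summand_span"
  proof (rule P_M_span_induct)
    show "{K * G | K G. K \<in> polys U \<and> G \<in> polys W} \<subseteq> polys X"
      using polys_mono [OF blocks(10)] polys_mono [OF blocks(11)] polys_mult by blast
  qed (use P_M_mult_in_span in blast)
  then show ?thesis using P_M_id [OF blocks(6,8) assms] by simp
qed

section \<open>Orthogonality, direct sum and invariance under the spin groups\<close>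

lemma summand_orthogonal:
  "l \<noteq> l' \<Longrightarrow> F \<in> summand p q l \<Longrightarrow> G \<in> summand p q l' \<Longrightarrow> fischer F G = 0"
  using joint_space_orthogonal summand_subset_joint_space by blast

lemma direct_sum: "is_direct_sum (monogenic X) (summand p q)"
  unfolding is_direct_sum_def
proof (intro conjI allI ballI)
  show "summand p q l \<subseteq> monogenic X" for l
    using summand_subset_joint_space [of l] by (cases l) (auto simp: joint_space_def)
  show "\<exists>!H. decomposes (summand p q) F H" if F: "F \<in> monogenic X" for F
  proof -
    obtain H where H: "decomposes (summand p q) F H"
      using decomposes_exists [OF subspace_summand monogenic_spanned [OF F]] by blast
    moreover have "K = H" if "decomposes (summand p q) F K" for K
      by (rule decomposes_unique [of "summand p q", OF subspace_summand _ that H])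
        (rule summand_orthogonal)
    ultimately show ?thesis by blast
  qed
qed (rule subspace_monogenic subspace_summand)+

lemma joint_space_eq_summand: "joint_space l = summand p q l"
proof
  show "joint_space l \<subseteq> summand p q l"
  proof
    fix F assume F: "F \<in> joint_space l"
    then have "F \<in> monogenic X" by (cases l) (auto simp: joint_space_def)
    then obtain H where H: "decomposes (summand p q) F H"
      using decomposes_exists [OF subspace_summand monogenic_spanned] by blast
    \<comment> \<open>The decomposition along the summands is also one along the larger joint
      eigenspaces. There \<open>F\<close> has the one-term decomposition at \<open>l\<close> as
      well, and orthogonality makes the two equal.\<close>
    then have "decomposes joint_space F H"
      using summand_subset_joint_space unfolding decomposes_def by blast
    from decomposes_unique [of joint_space, OF subspace_joint_space _ this
        decomposes_component [of joint_space, OF subspace_joint_space F]]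
    have "H = (\<lambda>j. if j = l then F else 0)" using joint_space_orthogonal by blast
    then have "H l = F" by simp
    moreover have "H l \<in> summand p q l" using H unfolding decomposes_def by blast
    ultimately show "F \<in> summand p q l" by simp
  qed
qed (rule summand_subset_joint_space)

lemma Spin_in_Cl: "s \<in> Spin C \<Longrightarrow> C \<subseteq> X \<Longrightarrow> s \<in> Cl X"
proof -
  have "w \<in> Cl X" if "w \<in> unit_vectors C" "C \<subseteq> X" for w
    using that by (auto simp: unit_vectors_def intro!: Cl_sum Cl_mult Cl_gen)
  then have "prod_list vs \<in> Cl X" if "set vs \<subseteq> unit_vectors C" "C \<subseteq> X" for vs
    using that by (induction vs) (auto intro: Cl_mult)
  then show "s \<in> Spin C \<Longrightarrow> C \<subseteq> X \<Longrightarrow> s \<in> Cl X"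
    by (auto simp: Spin_def)
qed

lemma L_joint_space:
  assumes a: "a \<in> Spin U" and b: "b \<in> Spin W" and F: "F \<in> joint_space l"
  shows "L X (a * b) F \<in> joint_space l"
proof -
  let ?s = "a * b"
  have "versor U W a" "versor W U b"
    using a b versor_prod_list [OF _ blocks(4,5,2)] versor_prod_list [OF _ blocks(5,4,3)]
    by (auto simp: Spin_def)
  \<comment> \<open>Both orders of the blocks are recorded, because the rules for the spin action
    are stated for the first block only.\<close>
  then have v: "versor U W ?s" and v': "versor W U ?s"
    by (simp_all add: versor_mult versor_sym)
  have X': "X = W \<union> U" using blocks(1) by (simp add: Un_commute)
  have s: "?s \<in> Cl X" using Spin_in_Cl [OF a] Spin_in_Cl [OF b] blocks(10,11) by (intro Cl_mult)
  have c: "c_e_P p * ?s = ?s * c_e_P p"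
    using c_e_P_commute_Spin [of a p q] c_e_P_commute_Spin [of b p q] a b by (metis mult.assoc)
  note uv = L_vec_var [OF blocks(4,5,2,1) v] L_vec_var [OF blocks(5,4,3) X' v']
  note du = L_dirac [OF blocks(4,5,2,1) v] and dv = L_dirac [OF blocks(5,4,3) X' v']
  have L0: "L X ?s 0 = 0" by (simp add: L_def)
  have dx: "dirac X (L X ?s F) = L X ?s (dirac X F)" if "F \<in> polys X" for F
    by (simp only: dirac_X du [OF that] dv [OF that] L_add)
  have xx: "L X ?s (vec_var X * F) = vec_var X * L X ?s F" for F
    by (simp only: vec_var_X uv L_add distrib_right)
  note Gamma = L_shifted_Gamma [OF blocks(4,5,2,1) v]
  have cL: "pconst (c_e_P p) * L X ?s F = L X ?s (pconst (c_e_P p) * F)" for F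
    using arg_cong [OF c, of "\<lambda>d. pconst d * psubst (conj_coord X ?s) F"]
    unfolding L_def psubst_conj_mult [OF blocks(4,5,2,1) v] psubst_pconst pconst_mult mult.assoc .
  obtain s' k i \<epsilon> where l: "l = (s', k, i, \<epsilon>)" by (metis prod_cases4)
  have F': "F \<in> polys X" "dirac X F = 0"
    "S_u p F = pscale (spec_u p s' k \<epsilon>) F" "S_v p q F = pscale (spec_v p q s' i \<epsilon>) F"
    "shifted_Gamma X F = pscale (spec_x p q s' k i) F"
    "reflection p F = pscale (spec_reflection p s' k \<epsilon>) F"
    using F by (auto simp: l joint_space_def monogenic_def)
  note ps = L_pscale [OF blocks(4,5,2,1) v]
  have "S_u p (L X ?s F) = L X ?s (S_u p F)"
    unfolding S_u_def by (simp only: Gamma [OF blocks(10) uv(1) du F'(1)] cL)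
  moreover have "S_v p q (L X ?s F) = L X ?s (S_v p q F)"
    unfolding S_v_def by (simp only: Gamma [OF blocks(11) uv(2) dv F'(1)] cL)
  moreover have "shifted_Gamma X (L X ?s F) = L X ?s (shifted_Gamma X F)"
    by (rule Gamma [OF subset_refl xx dx F'(1)])
  moreover have "reflection p (L X ?s F) = L X ?s (reflection p F)"
    unfolding reflection_def by (simp only: L_reflect [OF blocks(4,5,2,1) v F'(1)] cL)
  moreover have "L X ?s F \<in> monogenic X"
    using L_polys [OF blocks(4,5,2,1) v s F'(1)] dx [OF F'(1)] F'(2) L0 by (simp add: monogenic_def)
  ultimately show ?thesis
    by (simp add: l joint_space_def F' ps)
qed

text \<open>The factor \<open>(-1)^s\<close> comes from replacing \<open>|u|^(2s)\<close> by
  \<open>u^(2s)\<close>, since the square of \<open>u\<close> is \<open>- |u|^2\<close>. It is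
  nonzero and so does not affect the eigenvalues.\<close>

lemma joint_eigenfunction_building_block:
  assumes K: "K \<in> monogenic_pm p \<epsilon> k" "K \<noteq> 0" and G: "G \<in> monogenic_deg W i" "G \<noteq> 0"
    and F: "F = pscale ((-1) ^ s) (vec_var U ^ (2 * s + of_bool b) * (K * G))"
  shows "joint_eigenfunction p q (P_M X F) (eigenvalues p q b \<epsilon> s k i)"
proof -
  let ?n = "2 * s + of_bool b"
  let ?F = "P_M X (vec_var U ^ ?n * (K * G))"
  have "K \<in> monogenic_deg U k" using K by (simp add: monogenic_pm_def)
  from polys_product [OF this G(1), of 0] have "P_M X F = pscale ((-1) ^ s) ?F"
    unfolding F by (intro P_M_pscale [OF blocks(6,8)]) simp
  moreover have "?F \<in> joint_space (?n, k, i, \<epsilon>)"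
    by (rule building_block_in_joint_space [OF K(1) G(1)])
  ultimately have "P_M X F \<in> joint_space (?n, k, i, \<epsilon>)"
    using cpoly.subspace_scale [OF subspace_joint_space] by simp
  moreover have "P_M X F \<noteq> 0"
    unfolding \<open>P_M X F = pscale ((-1) ^ s) ?F\<close>
    using building_block_nonzero [OF K(1) G(1) K(2) G(2)] by simp
  ultimately show ?thesis
    unfolding eigenvalues_eq_spec joint_eigenfunction_def eigenfunction_def joint_space_def by auto
qed

lemma norm_sq_power_mult: "norm_sq U ^ s * F = pscale ((-1) ^ s) (vec_var U ^ (2 * s) * F)"
proof (induction s arbitrary: F)
  case (Suc s)
  have "norm_sq U * F = - (vec_var U * (vec_var U * F))" for F
    using vec_var_sq [OF blocks(4)] by (simp add: minus_equation_iff flip: mult.assoc)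
  then show ?case
    using Suc by (simp add: mult.assoc pscale_mult_right cpoly.scale_minus_left)
qed simp

end

theorem theorem12:
  fixes p q :: nat
  assumes "p \<ge> 1" and "q \<ge> 1"
  shows
    "(\<forall>F\<in>polys {1..p + q}.
        S_u p (S_v p q F) = S_v p q (S_u p F) \<and>
        S_u p (shifted_Gamma {1..p + q} F) = shifted_Gamma {1..p + q} (S_u p F) \<and>
        S_v p q (shifted_Gamma {1..p + q} F) = shifted_Gamma {1..p + q} (S_v p q F))
   \<and> (\<forall>s k i. \<forall>Q \<in> monogenic_deg {p + 1..p + q} i. Q \<noteq> 0 \<longrightarrow>
        (\<forall>P \<in> monogenic_pm p Plus k. P \<noteq> 0 \<longrightarrow>
           joint_eigenfunction p q (P_M {1..p + q} (norm_sq {1..p} ^ s * P * Q))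
             (eigenvalues p q False Plus s k i)) \<and>
        (\<forall>P \<in> monogenic_pm p Minus k. P \<noteq> 0 \<longrightarrow>
           joint_eigenfunction p q (P_M {1..p + q} (norm_sq {1..p} ^ s * P * Q))
             (eigenvalues p q False Minus s k i)) \<and>
        (\<forall>P \<in> monogenic_pm p Plus k. P \<noteq> 0 \<longrightarrow>
           joint_eigenfunction p q
             (P_M {1..p + q} (vec_var {1..p} * norm_sq {1..p} ^ s * P * Q))
             (eigenvalues p q True Plus s k i)) \<and>
        (\<forall>P \<in> monogenic_pm p Minus k. P \<noteq> 0 \<longrightarrow>
           joint_eigenfunction p q
             (P_M {1..p + q} (vec_var {1..p} * norm_sq {1..p} ^ s * P * Q))
             (eigenvalues p q True Minus s k i)))
   \<and> (\<forall>b \<epsilon> s k i b' \<epsilon>' s' k' i'.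
        eigenvalues p q b \<epsilon> s k i = eigenvalues p q b' \<epsilon>' s' k' i' \<longrightarrow>
        b = b' \<and> s = s' \<and> k = k' \<and> i = i')
   \<and> (\<forall>a\<in>Spin {1..p}. \<forall>b\<in>Spin {p + 1..p + q}. \<forall>l. \<forall>F\<in>summand p q l.
        L {1..p + q} (a * b) F \<in> summand p q l)
   \<and> is_direct_sum (monogenic {1..p + q}) (summand p q)
   \<and> (\<forall>l l'. l \<noteq> l' \<longrightarrow>
        (\<forall>F\<in>summand p q l. \<forall>G\<in>summand p q l'. fischer F G = 0))"
    (is "?commute \<and> ?eigen \<and> ?labels \<and> ?invariant \<and> ?sum \<and> ?orthogonal")
proof (intro conjI)
  let ?I = "{1..p + q}" and ?U = "{1..p}"
  note pq = assms
  show ?commute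
    using S_u_S_v_commute [OF pq] sym_op_shifted_Gamma [OF sym_op_S_u [OF pq]]
      sym_op_shifted_Gamma [OF sym_op_S_v [OF pq]] by blast
  have blocks: "joint_eigenfunction p q (P_M ?I (norm_sq ?U ^ s * P * Q)) (eigenvalues p q False \<epsilon> s k i)"
    "joint_eigenfunction p q (P_M ?I (vec_var ?U * norm_sq ?U ^ s * P * Q)) (eigenvalues p q True \<epsilon> s k i)"
    if "Q \<in> monogenic_deg {p + 1..p + q} i" "Q \<noteq> 0" "P \<in> monogenic_pm p \<epsilon> k" "P \<noteq> 0" for s k i P Q \<epsilon>
  proof -
    have *: "norm_sq ?U ^ s * (P * Q) = pscale ((-1) ^ s) (vec_var ?U ^ (2 * s) * (P * Q))"
      by (rule norm_sq_power_mult [OF pq])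
    then have "norm_sq ?U ^ s * P * Q = pscale ((-1) ^ s) (vec_var ?U ^ (2 * s + of_bool False) * (P * Q))"
      by (simp add: mult.assoc)
    then show "joint_eigenfunction p q (P_M ?I (norm_sq ?U ^ s * P * Q)) (eigenvalues p q False \<epsilon> s k i)"
      by (rule joint_eigenfunction_building_block [OF pq that(3,4,1,2)])
    have "vec_var ?U * norm_sq ?U ^ s * P * Q = vec_var ?U * (norm_sq ?U ^ s * (P * Q))"
      by (simp only: mult.assoc)
    also have "\<dots> = pscale ((-1) ^ s) (vec_var ?U ^ (2 * s + of_bool True) * (P * Q))"
      unfolding * pscale_mult_right by (simp add: mult.assoc)
    finally show "joint_eigenfunction p q (P_M ?I (vec_var ?U * norm_sq ?U ^ s * P * Q)) (eigenvalues p q True \<epsilon> s k i)"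
      by (rule joint_eigenfunction_building_block [OF pq that(3,4,1,2)])
  qed
  show ?eigen
    using blocks by blast
  show ?labels
  proof (intro allI impI)
    fix b \<epsilon> s k i b' \<epsilon>' s' k' i'
    assume "eigenvalues p q b \<epsilon> s k i = eigenvalues p q b' \<epsilon>' s' k' i'"
    then have labels: "2 * s + of_bool b = 2 * s' + of_bool b' \<and> k = k' \<and> i = i'"
      unfolding eigenvalues_eq_spec Pair_inject using spec_determines_labels [OF pq] by blast
    \<comment> \<open>The exponent of \<open>u\<close> determines \<open>b\<close> as its
      parity.\<close>
    have "b = b' \<and> s = s'"
      using labels by (cases b; cases b') (simp_all, presburger+)
    with labels show "b = b' \<and> s = s' \<and> k = k' \<and> i = i'" by blast
  qed
  show ?invariant
    using L_joint_space [OF pq] unfolding joint_space_eq_summand [OF pq] by blast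
  show ?sum
    by (rule direct_sum [OF pq])
  show ?orthogonal
    using summand_orthogonal [OF pq] by blast
qed

end
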